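(* Let $b:\mathbb{R}^d\to\mathbb{R}^d$ be continuous, and let $X_0$ and $(Z_t)_{t\ge0}$ denote the random initial value and the driving process of a stationary solution $(X_t)_{t\ge0}$ to $dX_t=b(X_t)dt+dZ_t$, i.e. $Z_t=X_t-X_0-\int_0^tb(X_s)ds$. If $X_0$ is independent of $(Z_t)_{t\ge0}$, then $(Z_t)_{t\ge0}$ has independent increments. As a consequence, $Z=QW$ where $W$ is a standard $d$-dimensional Brownian motion and $Q$ is a deterministic matrix.
   Context: The driving process $(Z_t)_{t\ge0}$ is a continuous centered $\mathbb{R}^d$-valued Gaussian process with $Z_0=0$ and ergodic stationary increments (ergodic: for every $\gamma>0$ the stationary sequence $(Z_{n\gamma}-Z_{(n-1)\gamma})_{n\ge1}$ is ergodic). A stationary solution to $dX_t=b(X_t)dt+dZ_t$ is a continuous process $(X_t)_{t\ge0}$ such that $(X_t-X_0-\int_0^tb(X_s)ds)_{t\ge0}$ has the same finite-dimensional distributions as the given driving Gaussian process and such that, for all $n$, all $0\le t_1<\dots<t_n$ and all $t\ge0$, $(X_{t+t_1},\ldots,X_{t+t_n})$ and $(X_{t_1},\ldots,X_{t_n})$ have the same law. *)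

theory Defs
  imports "HOL-Probability.Probability"
begin

text \<open>
  Processes are functions of time and outcome. The time set is \<open>[0,\<infinity>)\<close>; values at negative
  times are never used.
\<close>

type_synonym ('w, 'd) process = "real \<Rightarrow> 'w \<Rightarrow> real ^ 'd"

definition continuous_process :: "'w measure \<Rightarrow> ('w, 'd::finite) process \<Rightarrow> bool" where
  "continuous_process M X \<longleftrightarrow>
     (\<forall>t\<ge>0. X t \<in> borel_measurable M) \<and>
     (\<forall>\<omega>\<in>space M. continuous_on {0..} (\<lambda>t. X t \<omega>))"

definition same_fdd ::
  "'v measure \<Rightarrow> ('v, 'd::finite) process \<Rightarrow> 'w measure \<Rightarrow> ('w, 'd) process \<Rightarrow> bool" where
  "same_fdd N Y M X \<longleftrightarrow>
     (\<forall>J. finite J \<and> J \<subseteq> {0..} \<longrightarrow>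
        distr N (\<Pi>\<^sub>M t\<in>J. borel) (\<lambda>\<omega>. \<lambda>t\<in>J. Y t \<omega>) =
        distr M (\<Pi>\<^sub>M t\<in>J. borel) (\<lambda>\<omega>. \<lambda>t\<in>J. X t \<omega>))"

definition stationary_process :: "'w measure \<Rightarrow> ('w, 'd::finite) process \<Rightarrow> bool" where
  "stationary_process M X \<longleftrightarrow> (\<forall>h\<ge>0. same_fdd M (\<lambda>t. X (h + t)) M X)"

definition stationary_increments :: "'w measure \<Rightarrow> ('w, 'd::finite) process \<Rightarrow> bool" where
  "stationary_increments M Z \<longleftrightarrow>
     (\<forall>h\<ge>0. same_fdd M (\<lambda>t \<omega>. Z (h + t) \<omega> - Z h \<omega>) M (\<lambda>t \<omega>. Z t \<omega> - Z 0 \<omega>))"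

text \<open>Degenerate (constant) Gaussians are included, with \<open>\<sigma> = 0\<close>.\<close>

definition gaussian_rv :: "'w measure \<Rightarrow> ('w \<Rightarrow> real) \<Rightarrow> bool" where
  "gaussian_rv M Y \<longleftrightarrow>
     Y \<in> borel_measurable M \<and>
     (\<exists>m \<sigma>. 0 \<le> \<sigma> \<and>
        distr M borel Y =
          (if \<sigma> = 0 then return borel m else density lborel (\<lambda>x. ennreal (normal_density m \<sigma> x))))"

definition gaussian_process :: "'w measure \<Rightarrow> ('w, 'd::finite) process \<Rightarrow> bool" where
  "gaussian_process M Z \<longleftrightarrow>
     (\<forall>t\<ge>0. Z t \<in> borel_measurable M) \<and>
     (\<forall>J a. finite J \<and> J \<subseteq> {0..} \<longrightarrow> gaussian_rv M (\<lambda>\<omega>. \<Sum>t\<in>J. a t \<bullet> Z t \<omega>))"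

definition centered_process :: "'w measure \<Rightarrow> ('w, 'd::finite) process \<Rightarrow> bool" where
  "centered_process M Z \<longleftrightarrow> (\<forall>t\<ge>0. integrable M (Z t) \<and> integral\<^sup>L M (Z t) = 0)"

text \<open>Every shift-invariant event of the law of the sequence is trivial.\<close>

definition ergodic_sequence :: "'w measure \<Rightarrow> (nat \<Rightarrow> 'w \<Rightarrow> real ^ 'd::finite) \<Rightarrow> bool" where
  "ergodic_sequence M \<xi> \<longleftrightarrow>
     (\<forall>A \<in> sets (\<Pi>\<^sub>M n\<in>(UNIV::nat set). (borel :: (real ^ 'd) measure)).
        {x. (\<lambda>n. x (Suc n)) \<in> A} = A \<longrightarrow>
        measure M {\<omega>\<in>space M. (\<lambda>n. \<xi> n \<omega>) \<in> A} \<in> {0, 1})"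

definition ergodic_increments :: "'w measure \<Rightarrow> ('w, 'd::finite) process \<Rightarrow> bool" where
  "ergodic_increments M Z \<longleftrightarrow>
     (\<forall>\<gamma>>0. ergodic_sequence M (\<lambda>n \<omega>. Z (real (Suc n) * \<gamma>) \<omega> - Z (real n * \<gamma>) \<omega>))"

definition driving_process :: "'w measure \<Rightarrow> ('w, 'd::finite) process \<Rightarrow> bool" where
  "driving_process M Z \<longleftrightarrow>
     prob_space M \<and>
     continuous_process M Z \<and>
     gaussian_process M Z \<and>
     centered_process M Z \<and>
     (\<forall>\<omega>\<in>space M. Z 0 \<omega> = 0) \<and>
     stationary_increments M Z \<and>
     ergodic_increments M Z"

definition noise_of :: "(real ^ 'd \<Rightarrow> real ^ 'd) \<Rightarrow> ('w, 'd::finite) process \<Rightarrow> ('w, 'd) process" where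
  "noise_of b X t \<omega> = X t \<omega> - X 0 \<omega> - integral {0..t} (\<lambda>s. b (X s \<omega>))"

text \<open>
  The given Gaussian process \<open>G\<close> on \<open>N\<close> only prescribes the law of the noise; the
  solution \<open>X\<close> may live on a different probability space \<open>M\<close>.
\<close>

definition stationary_solution ::
  "'v measure \<Rightarrow> ('v, 'd::finite) process \<Rightarrow> (real ^ 'd \<Rightarrow> real ^ 'd) \<Rightarrow>
   'w measure \<Rightarrow> ('w, 'd) process \<Rightarrow> bool" where
  "stationary_solution N G b M X \<longleftrightarrow>
     prob_space M \<and>
     continuous_process M X \<and>
     same_fdd M (noise_of b X) N G \<and>
     stationary_process M X"

text \<open>
  The constant \<open>indep_var\<close> requires both variables to have the same type, so independence of
  a random vector and a process is expressed through the \<open>\<sigma>\<close>-algebras they generate.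
\<close>

definition indep_of_process ::
  "'w measure \<Rightarrow> ('w \<Rightarrow> real ^ 'd::finite) \<Rightarrow> ('w, 'd) process \<Rightarrow> bool" where
  "indep_of_process M Y Z \<longleftrightarrow>
     prob_space.indep_set M
       (sets (vimage_algebra (space M) Y borel))
       (sets (vimage_algebra (space M) (\<lambda>\<omega>. \<lambda>t\<in>{0..}. Z t \<omega>) (\<Pi>\<^sub>M t\<in>{0..}. borel)))"

definition independent_increments :: "'w measure \<Rightarrow> ('w, 'd::finite) process \<Rightarrow> bool" where
  "independent_increments M Z \<longleftrightarrow>
     (\<forall>n. \<forall>t :: nat \<Rightarrow> real. 0 \<le> t 0 \<and> (\<forall>i<n. t i < t (Suc i)) \<longrightarrow>
        prob_space.indep_vars M (\<lambda>_. borel) (\<lambda>i \<omega>. Z (t (Suc i)) \<omega> - Z (t i) \<omega>) {..<n})"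

definition standard_brownian_motion :: "'w measure \<Rightarrow> ('w, 'd::finite) process \<Rightarrow> bool" where
  "standard_brownian_motion M W \<longleftrightarrow>
     prob_space M \<and>
     continuous_process M W \<and>
     (\<forall>\<omega>\<in>space M. W 0 \<omega> = 0) \<and>
     independent_increments M W \<and>
     (\<forall>s t. 0 \<le> s \<and> s < t \<longrightarrow>
        distributed M lborel (\<lambda>\<omega>. W t \<omega> - W s \<omega>)
          (\<lambda>x. ennreal (\<Prod>i\<in>UNIV. normal_density 0 (sqrt (t - s)) (x $ i))))"

text \<open>
  \<open>Z = Q W\<close> for a standard Brownian motion \<open>W\<close>, as an almost sure identity of paths. When
  \<open>Q\<close> is singular, \<open>Z\<close> need not carry enough randomness to define \<open>W\<close> (if \<open>Z = 0\<close>, the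
  space \<open>M\<close> may be a single point), so \<open>W\<close> is allowed to live on a product \<open>M \<Otimes>\<^sub>M M'\<close> of
  the original space with a further probability space \<open>M'\<close>.
\<close>

definition brownian_representation ::
  "'w measure \<Rightarrow> ('w, 'd::finite) process \<Rightarrow> real ^ 'd ^ 'd \<Rightarrow> bool" where
  "brownian_representation M Z Q \<longleftrightarrow>
     (\<exists>(M' :: (nat \<Rightarrow> real ^ 'd) measure) W.
        prob_space M' \<and>
        standard_brownian_motion (M \<Otimes>\<^sub>M M') W \<and>
        (AE \<omega> in M \<Otimes>\<^sub>M M'. \<forall>t\<ge>0. Z t (fst \<omega>) = Q *v W t \<omega>))"

end

(*
  Put d q for the covariance of the increment of Z over [s, s + q] with a later increment
  V = theta . (Z u - Z h), s < h <= u, and Z = R + V d / Var V with R independent of V. By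
  stationarity, X s is independent of all increments of Z after s, hence of V, so each X s with
  s <= h keeps its law when one conditions on V being close to a large number. This
  conditioning adds a drift along d to Z. If d were not identically 0 near q = 0, one could
  choose a short interval [s, s + t] and a level of V such that the extra drift displaces Z
  over this interval by an amount of fixed size, larger than the diameter of a ball carrying
  most of the law of X s, while R and the integral of b stay small by continuity. Then X s and
  X (s + t) could not both lie in that ball with high probability. So d is locally constant,
  hence 0; increments of Z are uncorrelated, and therefore independent. No integrability of
  X or of b(X) is needed.

  The covariance of Z t is then t S. A maximal S-orthonormal family (a i), i in I, gives
  Z t = sum over I of (a i . Z t) S (a i) almost surely, so one takes W = (a i . Z) on the
  coordinates in I and the coordinates of an auxiliary Brownian motion on the others.
*)
theory Submission
  imports Defs
begin

section \<open>Characteristic functions determine finite measures\<close>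

text \<open>Conditioning on \<open>V\<close> is never done through a conditional law. Each
  probability becomes an integral against a nonnegative weight \<open>w (V)\<close>, and three
  events, each of relative mass above 2/3, must meet in some outcome, where a deterministic estimate
  on the path fails. The weight has to be continuous: increments of the noise are reached only as
  limits of Riemann-sum functionals of \<open>X\<close>, so stationarity passes to them through
  continuous test functions. The obstacle is that \<open>b\<close> is merely continuous, so its
  integral is controlled only while the path stays in a ball, and this ball must be fixed before the
  interval is chosen. The added drift and the residual \<open>R\<close> therefore have to be bounded
  along the whole interval and not just at its end. Ending the interval where the norm of
  \<open>d\<close> is largest does this: the displacement is about 2 \<rho> + 3 at the end and not
  much larger before, however short the interval. Laws are identified throughout by characteristic
  functions.\<close>

lemma borel_measurable_cis [measurable]: "cis \<in> borel_measurable borel"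
  by (intro borel_measurable_continuous_onI continuous_intros)

text \<open>Taking \<open>t = 0\<close> shows that both measures have the same mass
  \<open>c\<close>; after division by \<open>c\<close> this is Levy's uniqueness theorem for
  probability measures. General mass is wanted because the densities used below are not
  normalised.\<close>

lemma finite_measure_eqI_cis_real:
  fixes \<mu> \<nu> :: "real measure"
  assumes fin: "finite_measure \<mu>" "finite_measure \<nu>"
    and sets: "sets \<mu> = sets borel" "sets \<nu> = sets borel"
    and eq: "\<And>t. (\<integral>x. cis (t * x) \<partial>\<mu>) = (\<integral>x. cis (t * x) \<partial>\<nu>)"
  shows "\<mu> = \<nu>"
proof -
  interpret m: finite_measure \<mu> by fact
  interpret n: finite_measure \<nu> by fact
  have sp: "space \<mu> = UNIV" "space \<nu> = UNIV"
    using sets_eq_imp_space_eq[OF sets(1)] sets_eq_imp_space_eq[OF sets(2)] by auto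
  note [measurable_cong] = sets
  define c where "c = measure \<mu> UNIV"
  have c': "c = measure \<nu> UNIV"
    using eq[of 0] by (simp add: c_def sp)
  have em: "emeasure \<mu> UNIV = ennreal c" "emeasure \<nu> UNIV = ennreal c"
    unfolding c_def using m.emeasure_eq_measure n.emeasure_eq_measure c' c_def by auto
  show ?thesis
  proof (cases "c = 0")
    case True
    have "emeasure \<mu> A = emeasure \<nu> A" for A
      using emeasure_mono[of A UNIV \<mu>] emeasure_mono[of A UNIV \<nu>] sets em True by auto
    then show ?thesis by (intro measure_eqI) (auto simp: sets)
  next
    case False
    then have c: "c > 0" unfolding c_def by (simp add: less_le)
    have scale: "real_distribution (density \<rho> (\<lambda>_. ennreal (1/c)))"
      if "sets \<rho> = sets borel" "emeasure \<rho> UNIV = ennreal c" for \<rho> :: "real measure"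
    proof -
      have "space \<rho> = UNIV" using sets_eq_imp_space_eq[OF that(1)] by auto
      then have "emeasure (density \<rho> (\<lambda>_. ennreal (1/c))) UNIV = 1"
        using that c by (subst emeasure_density_const) (auto simp: ennreal_mult[symmetric])
      then show ?thesis
        using that \<open>space \<rho> = UNIV\<close>
        by (auto intro!: prob_spaceI simp: real_distribution_def real_distribution_axioms_def)
    qed
    have char: "char (density \<rho> (\<lambda>_. ennreal (1/c))) t = (1/c) *\<^sub>R (\<integral>x. cis (t * x) \<partial>\<rho>)"
      if [measurable_cong]: "sets \<rho> = sets borel" for \<rho> :: "real measure" and t
      unfolding char_def using c
      by (subst integral_density) (auto simp: cis_conv_exp)
    have "density \<mu> (\<lambda>_. ennreal (1/c)) = density \<nu> (\<lambda>_. ennreal (1/c))"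
      by (rule Levy_uniqueness) (use scale sets em char eq in \<open>auto simp: fun_eq_iff\<close>)
    then have "density (density \<mu> (\<lambda>_. ennreal (1/c))) (\<lambda>_. ennreal c)
        = density (density \<nu> (\<lambda>_. ennreal (1/c))) (\<lambda>_. ennreal c)" by simp
    moreover have "density (density \<rho> (\<lambda>_. ennreal (1/c))) (\<lambda>_. ennreal c) = \<rho>" for \<rho> :: "real measure"
      using c by (subst density_density_eq) (auto simp: ennreal_mult[symmetric] density_1)
    ultimately show ?thesis by simp
  qed
qed

section \<open>Uniqueness for weighted laws, vectors and products\<close>

lemma integral_weighted_distr:
  fixes h :: "'a::euclidean_space \<Rightarrow> 'b::{banach, second_countable_topology}"
  assumes g: "integrable M g" "\<And>x. 0 \<le> g x" and [measurable]: "U \<in> borel_measurable M" "h \<in> borel_measurable borel"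
  shows "(\<integral>x. h x \<partial>distr (density M (\<lambda>x. ennreal (g x))) borel U) = (\<integral>x. g x *\<^sub>R h (U x) \<partial>M)"
  using g by (subst integral_distr) (auto intro!: integral_density)

lemma finite_weighted_distr:
  fixes U :: "'w \<Rightarrow> 'a::euclidean_space"
  assumes g: "integrable M g" "\<And>x. 0 \<le> g x" and [measurable]: "U \<in> borel_measurable M"
  shows "finite_measure (distr (density M (\<lambda>x. ennreal (g x))) borel U)"
proof (rule finite_measure.finite_measure_distr)
  have "emeasure (density M (\<lambda>x. ennreal (g x))) (space M) = (\<integral>\<^sup>+x. ennreal (g x) \<partial>M)"
    using g by (subst emeasure_density) (auto intro!: nn_integral_cong)
  also have "\<dots> < \<infinity>" using g by (simp add: nn_integral_eq_integral)
  finally show "finite_measure (density M (\<lambda>x. ennreal (g x)))"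
    by (intro finite_measureI) auto
qed auto

text \<open>Hypothesis \<open>eq\<close> compares the characteristic functions of the image measures
  of two densities. Uniqueness enters as the assumption \<open>uniq\<close>, which is discharged
  first for \<open>real\<close>, in order to prove \<open>finite_measure_eqI_cis\<close>, and
  afterwards by that theorem itself.\<close>

lemma integral_weighted_indicator_eq:
  fixes U :: "'w \<Rightarrow> 'a::euclidean_space" and U' :: "'v \<Rightarrow> 'a"
  assumes uniq: "\<And>\<mu> \<nu> :: 'a measure. finite_measure \<mu> \<Longrightarrow> finite_measure \<nu> \<Longrightarrow> sets \<mu> = sets borel \<Longrightarrow>
      sets \<nu> = sets borel \<Longrightarrow> (\<And>t. (\<integral>x. cis (t \<bullet> x) \<partial>\<mu>) = (\<integral>x. cis (t \<bullet> x) \<partial>\<nu>)) \<Longrightarrow> \<mu> = \<nu>"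
    and g: "integrable M g" "\<And>x. 0 \<le> g x" "integrable N g'" "\<And>x. 0 \<le> g' x"
    and U[measurable]: "U \<in> borel_measurable M" "U' \<in> borel_measurable N"
    and eq: "\<And>t. (\<integral>x. g x *\<^sub>R cis (t \<bullet> U x) \<partial>M) = (\<integral>x. g' x *\<^sub>R cis (t \<bullet> U' x) \<partial>N)"
    and B[measurable]: "B \<in> sets borel"
  shows "(\<integral>x. g x * indicator B (U x) \<partial>M) = (\<integral>x. g' x * indicator B (U' x) \<partial>N)"
proof -
  have *: "distr (density M (\<lambda>x. ennreal (g x))) borel U = distr (density N (\<lambda>x. ennreal (g' x))) borel U'"
    by (rule uniq) (use g U eq in \<open>auto intro!: finite_weighted_distr simp: integral_weighted_distr\<close>)
  show ?thesis
    using integral_weighted_distr[OF g(1,2) U(1), of "indicator B :: 'a \<Rightarrow> real"]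
      integral_weighted_distr[OF g(3,4) U(2), of "indicator B :: 'a \<Rightarrow> real"] *
    by simp
qed

lemma integrable_weighted:
  fixes f :: "'w \<Rightarrow> 'b::{banach, second_countable_topology}"
  assumes "integrable M g" "f \<in> borel_measurable M" "\<And>x. norm (f x) \<le> C"
  shows "integrable M (\<lambda>x. (g x :: real) *\<^sub>R f x)"
proof (rule Bochner_Integration.integrable_bound[where f="\<lambda>x. C * g x"])
  show "AE x in M. norm (g x *\<^sub>R f x) \<le> norm (C * g x)"
  proof (rule AE_I2)
    fix x
    have "norm (f x) \<le> \<bar>C\<bar>" using assms(3)[of x] by linarith
    then show "norm (g x *\<^sub>R f x) \<le> norm (C * g x)"
      by (auto simp: abs_mult mult.commute[of "\<bar>C\<bar>"] intro!: mult_left_mono)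
  qed
qed (use assms in auto)

text \<open>
  One variable is peeled off at a time; the remaining exponential is absorbed in the nonnegative
  weights \<open>g (1 + cos)\<close> and \<open>g (1 + sin)\<close>, to which uniqueness for measures applies.
\<close>

lemma integral_weighted_prod_indicator_eq:
  fixes U :: "'i \<Rightarrow> 'w \<Rightarrow> 'a::euclidean_space" and U' :: "'i \<Rightarrow> 'v \<Rightarrow> 'a"
  assumes uniq: "\<And>\<mu> \<nu> :: 'a measure. finite_measure \<mu> \<Longrightarrow> finite_measure \<nu> \<Longrightarrow> sets \<mu> = sets borel \<Longrightarrow>
      sets \<nu> = sets borel \<Longrightarrow> (\<And>t. (\<integral>x. cis (t \<bullet> x) \<partial>\<mu>) = (\<integral>x. cis (t \<bullet> x) \<partial>\<nu>)) \<Longrightarrow> \<mu> = \<nu>"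
    and "finite J"
    and g: "integrable M g" "\<And>x. 0 \<le> g x" "integrable N g'" "\<And>x. 0 \<le> g' x"
    and U: "\<And>j. j \<in> J \<Longrightarrow> U j \<in> borel_measurable M" "\<And>j. j \<in> J \<Longrightarrow> U' j \<in> borel_measurable N"
    and eq: "\<And>t. (\<integral>x. g x *\<^sub>R cis (\<Sum>j\<in>J. t j \<bullet> U j x) \<partial>M) = (\<integral>x. g' x *\<^sub>R cis (\<Sum>j\<in>J. t j \<bullet> U' j x) \<partial>N)"
    and B: "\<And>j. j \<in> J \<Longrightarrow> B j \<in> sets borel"
  shows "(\<integral>x. g x * (\<Prod>j\<in>J. indicator (B j) (U j x)) \<partial>M) = (\<integral>x. g' x * (\<Prod>j\<in>J. indicator (B j) (U' j x)) \<partial>N)"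
  using \<open>finite J\<close> g U eq B
proof (induction J arbitrary: g g' rule: finite_induct)
  case empty
  have "complex_of_real (\<integral>x. g x \<partial>M) = of_real (\<integral>x. g' x \<partial>N)"
    using empty.prems(7)[of undefined] by (simp flip: integral_complex_of_real add: scaleR_conv_of_real)
  then show ?case by (simp del: integral_complex_of_real)
next
  case (insert k J)
  note g = insert.prems(1-4) and eq = insert.prems(7)
  have Uk[measurable]: "U k \<in> borel_measurable M" "U' k \<in> borel_measurable N" "B k \<in> sets borel"
    and UJ[measurable]: "\<And>j. j \<in> J \<Longrightarrow> U j \<in> borel_measurable M" "\<And>j. j \<in> J \<Longrightarrow> U' j \<in> borel_measurable N"
    using insert.prems by auto
  note [measurable] = borel_measurable_integrable[OF g(1)] borel_measurable_integrable[OF g(3)]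
  have fin[simp]: "finite J" and k: "k \<notin> J" by fact+
  define L L' where "L t x = (\<Sum>j\<in>J. t j \<bullet> U j x)" and "L' t x' = (\<Sum>j\<in>J. t j \<bullet> U' j x')" for t x x'
  have Lm[measurable]: "L t \<in> borel_measurable M" "L' t \<in> borel_measurable N" for t
    unfolding L_def[abs_def] L'_def[abs_def] by measurable
  have eqs: "(\<integral>x. g x *\<^sub>R cis (s \<bullet> U k x + L t x) \<partial>M) = (\<integral>x. g' x *\<^sub>R cis (s \<bullet> U' k x + L' t x) \<partial>N)" for s t
  proof -
    have "(\<Sum>j\<in>insert k J. (t(k := s)) j \<bullet> u j) = s \<bullet> u k + (\<Sum>j\<in>J. t j \<bullet> u j)" for u :: "'i \<Rightarrow> 'a"
      using k by (auto intro!: sum.cong)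
    then show ?thesis using eq[of "t(k := s)"] by (simp add: L_def L'_def)
  qed
  have eq0: "(\<integral>x. g x *\<^sub>R cis (s \<bullet> U k x) \<partial>M) = (\<integral>x. g' x *\<^sub>R cis (s \<bullet> U' k x) \<partial>N)" for s
    using eqs[of s "\<lambda>_. 0"] by (simp add: L_def L'_def)
  have Lneg: "L (\<lambda>j. - t j) x = - L t x" "L' (\<lambda>j. - t j) x' = - L' t x'" for t x x'
    by (simp_all add: L_def L'_def sum_negf)
  have int: "integrable M (\<lambda>x. g x *\<^sub>R cis (f x))" if "f \<in> borel_measurable M" for f
    using that g by (intro integrable_weighted[where C=1]) auto
  have int': "integrable N (\<lambda>x. g' x *\<^sub>R cis (f x))" if "f \<in> borel_measurable N" for f
    using that g by (intro integrable_weighted[where C=1]) auto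
  define I I' where "I x = g x * indicator (B k) (U k x)" and "I' x' = g' x' * indicator (B k) (U' k x')" for x x'
  have Ii: "integrable M I" "integrable N I'"
    unfolding I_def[abs_def] I'_def[abs_def]
    using integrable_weighted[OF g(1), of "\<lambda>x. indicator (B k) (U k x) :: real" 1]
      integrable_weighted[OF g(3), of "\<lambda>x. indicator (B k) (U' k x) :: real" 1]
    by (auto simp: indicator_def)
  note [measurable] = borel_measurable_integrable[OF Ii(1)] borel_measurable_integrable[OF Ii(2)]
  have I0: "(\<integral>x. I x \<partial>M) = (\<integral>x. I' x \<partial>N)"
    unfolding I_def I'_def using g eq0 by (intro integral_weighted_indicator_eq[OF uniq]) auto
  \<comment> \<open>\<open>ci\<close> is a product-to-sum formula: it expresses the transform of the
    weight with factor \<open>1 + \<phi> (L t x)\<close> through \<open>eqs\<close> at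
    \<open>t\<close> and at \<open>- t\<close> and through \<open>eq0\<close>. Cancelling the
    contribution of 1 by \<open>I0\<close> leaves \<open>\<phi>\<close> alone.\<close>
  have trig: "integrable M (\<lambda>x. I x * \<phi> (L t x)) \<and> integrable N (\<lambda>x. I' x * \<phi> (L' t x)) \<and>
      (\<integral>x. I x * \<phi> (L t x) \<partial>M) = (\<integral>x. I' x * \<phi> (L' t x) \<partial>N)"
    if ci: "\<And>a b. (2 * \<phi> b) *\<^sub>R cis a = p * cis (a + b) + q * cis (a - b)"
      and [measurable]: "\<phi> \<in> borel_measurable borel" and bd: "\<And>x. \<bar>\<phi> x\<bar> \<le> 1"
    for \<phi> :: "real \<Rightarrow> real" and p q t
  proof -
    have bd': "\<bar>1 + \<phi> x\<bar> \<le> 2" "0 \<le> 1 + \<phi> x" for x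
      using bd[of x] by linarith+
    have 1: "(x * (1 + \<phi> b)) *\<^sub>R cis a = x *\<^sub>R cis a + (1/2) * (p * (x *\<^sub>R cis (a + b)) + q * (x *\<^sub>R cis (a - b)))" for a b x
    proof -
      have "p * (x *\<^sub>R cis (a + b)) + q * (x *\<^sub>R cis (a - b)) = x *\<^sub>R ((2 * \<phi> b) *\<^sub>R cis a)"
        unfolding ci by (simp add: algebra_simps)
      then show ?thesis by (simp add: scaleR_conv_of_real algebra_simps)
    qed
    have "(\<integral>x. (g x * (1 + \<phi> (L t x))) *\<^sub>R cis (s \<bullet> U k x) \<partial>M)
        = (\<integral>x. (g' x * (1 + \<phi> (L' t x))) *\<^sub>R cis (s \<bullet> U' k x) \<partial>N)" for s
      unfolding 1 using eqs[of s t] eqs[of s "\<lambda>j. - t j"] eq0[of s]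
      by (simp add: int int' Lneg del: mult_scaleR_right)
    then have "(\<integral>x. (g x * (1 + \<phi> (L t x))) * indicator (B k) (U k x) \<partial>M)
        = (\<integral>x. (g' x * (1 + \<phi> (L' t x))) * indicator (B k) (U' k x) \<partial>N)"
      using g bd' integrable_weighted[OF g(1), of "\<lambda>x. 1 + \<phi> (L t x)" 2]
        integrable_weighted[OF g(3), of "\<lambda>x. 1 + \<phi> (L' t x)" 2]
      by (intro integral_weighted_indicator_eq[OF uniq]) auto
    then have "(\<integral>x. I x + I x * \<phi> (L t x) \<partial>M) = (\<integral>x. I' x + I' x * \<phi> (L' t x) \<partial>N)"
      by (simp add: I_def I'_def algebra_simps)
    moreover have "integrable M (\<lambda>x. I x * \<phi> (L t x))" "integrable N (\<lambda>x. I' x * \<phi> (L' t x))"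
      using integrable_weighted[OF Ii(1), of "\<lambda>x. \<phi> (L t x)" 1]
        integrable_weighted[OF Ii(2), of "\<lambda>x. \<phi> (L' t x)" 1] bd by auto
    ultimately show ?thesis using Ii I0 by simp
  qed
  have trig_cos: "integrable M (\<lambda>x. I x * cos (L t x)) \<and> integrable N (\<lambda>x. I' x * cos (L' t x)) \<and>
      (\<integral>x. I x * cos (L t x) \<partial>M) = (\<integral>x. I' x * cos (L' t x) \<partial>N)" for t
    by (rule trig[where p=1 and q=1]) (auto simp: complex_eq_iff cos_add sin_add cos_diff sin_diff)
  have trig_sin: "integrable M (\<lambda>x. I x * sin (L t x)) \<and> integrable N (\<lambda>x. I' x * sin (L' t x)) \<and>
      (\<integral>x. I x * sin (L t x) \<partial>M) = (\<integral>x. I' x * sin (L' t x) \<partial>N)" for t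
    by (rule trig[where p="-\<i>" and q="\<i>"]) (auto simp: complex_eq_iff cos_add sin_add cos_diff sin_diff)
  have cs: "x *\<^sub>R cis a = complex_of_real (x * cos a) + \<i> * complex_of_real (x * sin a)" for x a
    by (simp add: complex_eq_iff)
  have eqI: "(\<integral>x. I x *\<^sub>R cis (\<Sum>j\<in>J. t j \<bullet> U j x) \<partial>M) = (\<integral>x. I' x *\<^sub>R cis (\<Sum>j\<in>J. t j \<bullet> U' j x) \<partial>N)" for t
    unfolding L_def[symmetric] L'_def[symmetric] cs
    using trig_cos[of t] trig_sin[of t]
    by (simp del: of_real_mult)
  have "(\<integral>x. I x * (\<Prod>j\<in>J. indicator (B j) (U j x)) \<partial>M) = (\<integral>x. I' x * (\<Prod>j\<in>J. indicator (B j) (U' j x)) \<partial>N)"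
    by (rule insert.IH[OF Ii(1) _ Ii(2)]) (use g insert.prems eqI in \<open>auto simp: I_def I'_def\<close>)
  then show ?case
    using k by (simp add: I_def I'_def mult.assoc)
qed

text \<open>Open boxes form an intersection-stable generator, and the indicator of a box is a
  product of indicators of coordinates. The real case, applied jointly to the functionals
  \<open>x \<bullet> j\<close>, therefore suffices.\<close>

theorem finite_measure_eqI_cis:
  fixes \<mu> \<nu> :: "'a::euclidean_space measure"
  assumes fin: "finite_measure \<mu>" "finite_measure \<nu>"
    and sets: "sets \<mu> = sets borel" "sets \<nu> = sets borel"
    and eq: "\<And>t. (\<integral>x. cis (t \<bullet> x) \<partial>\<mu>) = (\<integral>x. cis (t \<bullet> x) \<partial>\<nu>)"
  shows "\<mu> = \<nu>"
proof -
  interpret m: finite_measure \<mu> by fact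
  interpret n: finite_measure \<nu> by fact
  note [measurable_cong] = sets
  have sp: "space \<mu> = UNIV" "space \<nu> = UNIV"
    using sets_eq_imp_space_eq[OF sets(1)] sets_eq_imp_space_eq[OF sets(2)] by auto
  have s: "(\<Sum>j\<in>Basis. t j \<bullet> (x \<bullet> j)) = (\<Sum>j\<in>Basis. t j *\<^sub>R j) \<bullet> x" for t and x :: 'a
    by (simp add: inner_sum_left inner_commute[of x])
  show ?thesis
  proof (rule measure_eqI_generator_eq)
    let ?E = "range (\<lambda>(a, b). box a b::'a set)"
    show "Int_stable ?E" by (auto simp: Int_stable_def box_Int_box)
    show "?E \<subseteq> Pow UNIV" by auto
    show "sets \<mu> = sigma_sets UNIV ?E" "sets \<nu> = sigma_sets UNIV ?E"
      by (simp_all add: sets borel_eq_box)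
    let ?A = "\<lambda>n::nat. box (- (real n *\<^sub>R One)) (real n *\<^sub>R One) :: 'a set"
    show "range ?A \<subseteq> ?E" "(\<Union>i. ?A i) = UNIV"
      unfolding UN_box_eq_UNIV by auto
    show "emeasure \<mu> (?A i) \<noteq> \<infinity>" for i by simp
    fix X assume "X \<in> ?E"
    then obtain a b :: 'a where X: "X = box a b" by auto
    have "(\<integral>x. (1::real) * (\<Prod>j\<in>Basis. indicator {a \<bullet> j<..<b \<bullet> j} (x \<bullet> j)) \<partial>\<mu>) = (\<integral>x. (1::real) * (\<Prod>j\<in>Basis. indicator {a \<bullet> j<..<b \<bullet> j} (x \<bullet> j)) \<partial>\<nu>)"
      by (rule integral_weighted_prod_indicator_eq[OF finite_measure_eqI_cis_real])
        (use eq in \<open>auto simp: inner_real_def[symmetric] s simp del: inner_real_def\<close>)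
    moreover have "(\<Prod>j\<in>Basis. indicator {a \<bullet> j<..<b \<bullet> j} (x \<bullet> j)) = (indicator X x :: real)" for x
      by (auto simp: X box_def indicator_def prod_zero_iff)
    ultimately have "measure \<mu> X = measure \<nu> X"
      using X by (simp add: sp)
    then show "emeasure \<mu> X = emeasure \<nu> X"
      by (simp add: m.emeasure_eq_measure n.emeasure_eq_measure)
  qed
qed

text \<open>The right-hand side of \<open>eq\<close> is the characteristic function of the product
  of the marginal laws, so the joint law gives every rectangle its product mass.\<close>

lemma (in prob_space) indep_vars_if_cis:
  fixes W :: "'i \<Rightarrow> 'a \<Rightarrow> 'b::euclidean_space"
  assumes fin: "finite I" and rv: "\<And>i. i \<in> I \<Longrightarrow> W i \<in> borel_measurable M"
    and eq: "\<And>t. (\<integral>x. cis (\<Sum>i\<in>I. t i \<bullet> W i x) \<partial>M) = (\<Prod>i\<in>I. \<integral>x. cis (t i \<bullet> W i x) \<partial>M)"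
  shows "indep_vars (\<lambda>_. borel) W I"
proof (cases "I = {}")
  case True
  then show ?thesis by (simp add: indep_vars_def indep_sets_def)
next
  case False
  \<comment> \<open>The Dirac measure outside \<open>I\<close> is a filler:
    \<open>product_prob_space\<close> asks for a probability measure at every index.\<close>
  define D where "D i = (if i \<in> I then distr M borel (W i) else return borel 0)" for i
  have Dp: "prob_space (D i)" for i
    using rv by (auto simp: D_def intro!: prob_space_distr prob_space_return)
  interpret D: product_prob_space D by (rule product_prob_spaceI) (rule Dp)
  have [measurable_cong, simp]: "sets (D i) = sets borel" for i by (simp add: D_def)
  have sp: "space (D i) = UNIV" for i by (simp add: D_def)
  have DW: "PiM I D = (\<Pi>\<^sub>M i\<in>I. distr M borel (W i))" by (rule PiM_cong) (auto simp: D_def)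
  have "distr M (\<Pi>\<^sub>M i\<in>I. borel) (\<lambda>x. \<lambda>i\<in>I. W i x) = PiM I D"
  proof (rule D.PiM_eqI[OF fin])
    show "sets (distr M (\<Pi>\<^sub>M i\<in>I. borel) (\<lambda>x. \<lambda>i\<in>I. W i x)) = sets (PiM I D)"
      by (simp cong: sets_PiM_cong)
    fix A assume A: "\<And>i. i \<in> I \<Longrightarrow> A i \<in> sets (D i)"
    have A': "Pi\<^sub>E I A \<in> sets (\<Pi>\<^sub>M i\<in>I. (borel :: 'b measure))"
      using A fin by (intro sets_PiM_I_finite) auto
    have "(\<integral>x. (1::real) * (\<Prod>j\<in>I. indicator (A j) (W j x)) \<partial>M) = (\<integral>x. 1 * (\<Prod>j\<in>I. indicator (A j) (x j)) \<partial>PiM I D)"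
    proof (rule integral_weighted_prod_indicator_eq[OF finite_measure_eqI_cis fin])
      fix t :: "'i \<Rightarrow> 'b"
      have "(\<integral>x. cis (\<Sum>j\<in>I. t j \<bullet> x j) \<partial>PiM I D) = (\<integral>x. (\<Prod>j\<in>I. cis (t j \<bullet> x j)) \<partial>PiM I D)"
        using fin by (simp add: cis_conv_exp exp_sum[symmetric] sum_distrib_left)
      also have "\<dots> = (\<Prod>j\<in>I. \<integral>x. cis (t j \<bullet> x) \<partial>D j)"
      proof (rule D.product_integral_prod[OF fin])
        show "integrable (D i) (\<lambda>x. cis (t i \<bullet> x))" for i
          by (rule finite_measure.integrable_const_bound[OF prob_space.axioms(1)[OF Dp], where B=1]) auto
      qed
      also have "\<dots> = (\<Prod>i\<in>I. \<integral>x. cis (t i \<bullet> W i x) \<partial>M)"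
        using rv by (intro prod.cong refl) (simp add: D_def integral_distr)
      finally show "(\<integral>x. 1 *\<^sub>R cis (\<Sum>j\<in>I. t j \<bullet> W j x) \<partial>M) = (\<integral>x. 1 *\<^sub>R cis (\<Sum>j\<in>I. t j \<bullet> x j) \<partial>PiM I D)"
        using eq by simp
    qed (use A rv in \<open>auto\<close>)
    moreover have "(\<Prod>j\<in>I. indicator (A j) (W j x)) = (indicator {x. \<forall>i\<in>I. W i x \<in> A i} x :: real)" for x
      using fin by (auto simp: indicator_def prod_zero_iff)
    moreover have "(\<Prod>j\<in>I. indicator (A j) (x j)) = (indicator (Pi\<^sub>E I A) x :: real)" if "x \<in> space (PiM I D)" for x
      using fin that by (auto simp: indicator_def prod_zero_iff space_PiM PiE_def Pi_iff)
    ultimately have "measure M ({x. \<forall>i\<in>I. W i x \<in> A i} \<inter> space M) = measure (PiM I D) (Pi\<^sub>E I A \<inter> space (PiM I D))"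
      by (simp cong: Bochner_Integration.integral_cong)
    moreover have "Pi\<^sub>E I A \<inter> space (PiM I D) = Pi\<^sub>E I A" by (auto simp: space_PiM sp)
    moreover have "(\<lambda>x. \<lambda>i\<in>I. W i x) -` Pi\<^sub>E I A \<inter> space M = {x. \<forall>i\<in>I. W i x \<in> A i} \<inter> space M"
      by auto
    ultimately have "emeasure (distr M (\<Pi>\<^sub>M i\<in>I. borel) (\<lambda>x. \<lambda>i\<in>I. W i x)) (Pi\<^sub>E I A) = emeasure (PiM I D) (Pi\<^sub>E I A)"
      using A' rv by (subst emeasure_distr) (auto intro!: measurable_restrict simp: emeasure_eq_measure finite_measure.emeasure_eq_measure[OF prob_space.axioms(1)[OF prob_space_PiM[OF Dp]]])
    then show "emeasure (distr M (\<Pi>\<^sub>M i\<in>I. borel) (\<lambda>x. \<lambda>i\<in>I. W i x)) (Pi\<^sub>E I A) = (\<Prod>i\<in>I. emeasure (D i) (A i))"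
      using A by (simp add: D.emeasure_PiM fin)
  qed
  then show ?thesis
    by (subst indep_vars_iff_distr_eq_PiM'[OF False rv]) (simp_all add: DW)
qed

section \<open>Centred Gaussian processes with continuous paths\<close>

text \<open>For \<open>\<sigma> = 0\<close> the law is a point mass, located at 0 by the mean;
  otherwise the claims come from rescaling to the standard normal law and from its positive density.
  The last claim is what allows a variable to be localised near an arbitrarily remote level.\<close>

lemma (in prob_space) centered_gaussian_rv:
  assumes Y: "gaussian_rv M Y" and mean: "(\<integral>x. Y x \<partial>M) = 0"
  shows centered_gaussian_square_integrable: "integrable M (\<lambda>x. (Y x)\<^sup>2)"
    and centered_gaussian_cis: "(\<integral>x. cis (Y x) \<partial>M) = exp (- (\<integral>x. (Y x)\<^sup>2 \<partial>M) / 2)"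
    and centered_gaussian_interval_pos:
      "(\<integral>x. (Y x)\<^sup>2 \<partial>M) \<noteq> 0 \<Longrightarrow> a < b \<Longrightarrow> 0 < measure M {x\<in>space M. a < Y x \<and> Y x < b}"
proof -
  have [measurable]: "Y \<in> borel_measurable M" using Y by (simp add: gaussian_rv_def)
  obtain m \<sigma> where \<sigma>: "0 \<le> \<sigma>" and d: "distr M borel Y =
      (if \<sigma> = 0 then return borel m else density lborel (\<lambda>x. ennreal (normal_density m \<sigma> x)))"
    using Y unfolding gaussian_rv_def by blast
  have "integrable M (\<lambda>x. (Y x)\<^sup>2) \<and> (\<integral>x. cis (Y x) \<partial>M) = exp (- (\<integral>x. (Y x)\<^sup>2 \<partial>M) / 2) \<and>
     ((\<integral>x. (Y x)\<^sup>2 \<partial>M) \<noteq> 0 \<longrightarrow> a < b \<longrightarrow> 0 < measure M {x\<in>space M. a < Y x \<and> Y x < b})"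
  proof (cases "\<sigma> = 0")
    case True
    then have d: "distr M borel Y = return borel m" using d by simp
    have "AE x in distr M borel Y. x = m"
      unfolding d by (subst AE_return) auto
    then have ae: "AE x in M. Y x = m" by (subst (asm) AE_distr_iff) auto
    have "(\<integral>x. Y x \<partial>M) = (\<integral>x. m \<partial>M)" using ae by (intro integral_cong_AE) auto
    then have [simp]: "m = 0" using mean by (simp add: prob_space)
    have "(\<integral>x. (Y x)\<^sup>2 \<partial>M) = (\<integral>x. 0 \<partial>M)" using ae by (intro integral_cong_AE) auto
    moreover have "(\<integral>x. cis (Y x) \<partial>M) = (\<integral>x. 1 \<partial>M)" using ae by (intro integral_cong_AE) auto
    moreover have "integrable M (\<lambda>x. (Y x)\<^sup>2) \<longleftrightarrow> integrable M (\<lambda>x. 0::real)"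
      using ae by (intro integrable_cong_AE) auto
    ultimately show ?thesis by (simp add: prob_space)
  next
    case False
    then have s: "\<sigma> > 0" using \<sigma> by simp
    have D: "distributed M lborel Y (normal_density m \<sigma>)"
      using d False distr_cong[of M M lborel borel Y Y] by (auto simp: distributed_def)
    have m: "m = 0" using normal_distributed_expectation[OF s D] mean by simp
    note D = D[unfolded m]
    have v: "(\<integral>x. (Y x)\<^sup>2 \<partial>M) = \<sigma>\<^sup>2"
      using normal_distributed_variance[OF s D] mean by simp
    have int: "integrable M (\<lambda>x. (Y x)\<^sup>2)"
      using distributed_integrable[OF D, of "\<lambda>x. x\<^sup>2"] integrable_normal_moment[OF s, of 0 2] by simp
    have "distributed M lborel (\<lambda>x. (Y x - 0) / \<sigma>) std_normal_density"
      using normal_standard_normal_convert[OF s, of Y 0] D by simp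
    then have std: "distr M borel (\<lambda>x. Y x / \<sigma>) = std_normal_distribution"
      using distr_cong[of M M lborel borel "\<lambda>x. Y x / \<sigma>"] by (simp add: distributed_def)
    have "(\<integral>x. cis (Y x) \<partial>M) = char (distr M borel (\<lambda>x. Y x / \<sigma>)) \<sigma>"
      unfolding char_def using s by (subst integral_distr) (auto simp: cis_conv_exp)
    also have "\<dots> = exp (- \<sigma>\<^sup>2 / 2)" unfolding std char_std_normal_distribution by simp
    finally have c: "(\<integral>x. cis (Y x) \<partial>M) = exp (- \<sigma>\<^sup>2 / 2)" .
    have "0 < measure M {x\<in>space M. a < Y x \<and> Y x < b}" if "a < b"
    proof (rule ccontr)
      assume "\<not> ?thesis"
      then have "measure M {x\<in>space M. a < Y x \<and> Y x < b} = 0"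
        using measure_nonneg[of M] by (simp add: order.antisym not_less)
      then have "emeasure (distr M borel Y) {a<..<b} = 0"
        by (subst emeasure_distr) (auto simp: emeasure_eq_measure vimage_def Int_def conj_commute)
      then have "emeasure (density lborel (\<lambda>x. ennreal (normal_density 0 \<sigma> x))) {a<..<b} = 0"
        using d False m by simp
      then have "AE x in lborel. ennreal (normal_density 0 \<sigma> x) * indicator {a<..<b} x = 0"
        by (subst (asm) emeasure_density) (auto simp: nn_integral_0_iff_AE)
      then have "AE x in lborel. x \<notin> {a<..<b}"
        using normal_density_pos[OF s, of 0, THEN less_imp_neq] by (auto elim!: eventually_mono split: split_indicator_asm)
      then have "emeasure lborel {a<..<b} = 0" by (subst (asm) AE_iff_measurable[OF _ refl]) (auto simp: greaterThanLessThan_def greaterThan_def lessThan_def Int_def)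
      then show False using that by simp
    qed
    then show ?thesis using v int c by simp
  qed
  then show "integrable M (\<lambda>x. (Y x)\<^sup>2)" "(\<integral>x. cis (Y x) \<partial>M) = exp (- (\<integral>x. (Y x)\<^sup>2 \<partial>M) / 2)"
    "(\<integral>x. (Y x)\<^sup>2 \<partial>M) \<noteq> 0 \<Longrightarrow> a < b \<Longrightarrow> 0 < measure M {x\<in>space M. a < Y x \<and> Y x < b}"
    by auto
qed

locale centered_gaussian_paths = prob_space M for M :: "'w measure" +
  fixes Z :: "('w, 'd::finite) process"
  assumes paths: "continuous_process M Z"
    and gaussian: "gaussian_process M Z"
    and centered: "centered_process M Z"
begin

lemma Z_measurable [measurable]: "0 \<le> t \<Longrightarrow> Z t \<in> borel_measurable M"
  using paths by (simp add: continuous_process_def)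

text \<open>The Gaussian space of the process, without closure. It is linear, contains all
  functionals of increments and consists of centred Gaussian variables, so within it zero covariance
  gives independence.\<close>

definition gspan :: "('w \<Rightarrow> real) set" where
  "gspan = {Y. \<exists>J a. finite J \<and> J \<subseteq> {0..} \<and> Y = (\<lambda>x. \<Sum>t\<in>J. a t \<bullet> Z t x)}"

lemma gspan_add:
  assumes "Y \<in> gspan" "Y' \<in> gspan"
  shows "(\<lambda>x. Y x + Y' x) \<in> gspan"
proof -
  obtain J a J' a' where 1: "finite J" "J \<subseteq> {0..}" "Y = (\<lambda>x. \<Sum>t\<in>J. a t \<bullet> Z t x)"
     "finite J'" "J' \<subseteq> {0..}" "Y' = (\<lambda>x. \<Sum>t\<in>J'. a' t \<bullet> Z t x)"
    using assms unfolding gspan_def by blast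
  define c where "c t = (if t \<in> J then a t else 0) + (if t \<in> J' then a' t else 0)" for t
  have "(\<Sum>t\<in>J \<union> J'. c t \<bullet> Z t x) = (\<Sum>t\<in>J. a t \<bullet> Z t x) + (\<Sum>t\<in>J'. a' t \<bullet> Z t x)" for x
  proof -
    have "(\<Sum>t\<in>J \<union> J'. (if t \<in> J then a t else 0) \<bullet> Z t x) = (\<Sum>t\<in>J. a t \<bullet> Z t x)"
      using 1 by (intro sum.mono_neutral_cong_right) auto
    moreover have "(\<Sum>t\<in>J \<union> J'. (if t \<in> J' then a' t else 0) \<bullet> Z t x) = (\<Sum>t\<in>J'. a' t \<bullet> Z t x)"
      using 1 by (intro sum.mono_neutral_cong_right) auto
    ultimately show ?thesis by (simp add: c_def inner_add_left sum.distrib)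
  qed
  then show ?thesis unfolding gspan_def using 1
    by (intro CollectI exI[of _ "J \<union> J'"] exI[of _ c]) auto
qed

lemma gspan_scale: "Y \<in> gspan \<Longrightarrow> (\<lambda>x. k * Y x) \<in> gspan"
proof -
  assume "Y \<in> gspan"
  then obtain J a where 1: "finite J" "J \<subseteq> {0..}" "Y = (\<lambda>x. \<Sum>t\<in>J. a t \<bullet> Z t x)"
    unfolding gspan_def by blast
  then show ?thesis unfolding gspan_def
    by (intro CollectI exI[of _ J] exI[of _ "\<lambda>t. k *\<^sub>R a t"]) (auto simp: sum_distrib_left)
qed

lemma gspan_Z: "0 \<le> t \<Longrightarrow> (\<lambda>x. a \<bullet> Z t x) \<in> gspan"
  unfolding gspan_def by (intro CollectI exI[of _ "{t}"] exI[of _ "\<lambda>_. a"]) auto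

lemma gspan_diff: "Y \<in> gspan \<Longrightarrow> Y' \<in> gspan \<Longrightarrow> (\<lambda>x. Y x - Y' x) \<in> gspan"
  using gspan_add[OF _ gspan_scale, of Y Y' "-1"] by simp

lemma gspan_incr: "0 \<le> s \<Longrightarrow> 0 \<le> t \<Longrightarrow> (\<lambda>x. a \<bullet> (Z t x - Z s x)) \<in> gspan"
  unfolding inner_diff_right by (intro gspan_diff gspan_Z)

lemma gspan_sum: "finite I \<Longrightarrow> (\<And>i. i \<in> I \<Longrightarrow> Y i \<in> gspan) \<Longrightarrow> (\<lambda>x. \<Sum>i\<in>I. Y i x) \<in> gspan"
proof (induction I rule: finite_induct)
  case empty
  show ?case unfolding gspan_def by (intro CollectI exI[of _ "{}"] exI[of _ undefined]) auto
next
  case (insert i I)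
  then show ?case by (simp add: gspan_add)
qed

lemma gspan_gaussian: "Y \<in> gspan \<Longrightarrow> gaussian_rv M Y"
  using gaussian unfolding gspan_def gaussian_process_def by blast

lemma gspan_measurable: "Y \<in> gspan \<Longrightarrow> Y \<in> borel_measurable M"
  using gspan_gaussian by (simp add: gaussian_rv_def)

lemma gspan_mean: "Y \<in> gspan \<Longrightarrow> (\<integral>x. Y x \<partial>M) = 0"
proof -
  assume "Y \<in> gspan"
  then obtain J a where 1: "finite J" "J \<subseteq> {0..}" "Y = (\<lambda>x. \<Sum>t\<in>J. a t \<bullet> Z t x)"
    unfolding gspan_def by blast
  have "integrable M (Z t)" "(\<integral>x. Z t x \<partial>M) = 0" if "t \<in> J" for t
    using centered that 1 by (auto simp: centered_process_def)
  then show ?thesis unfolding 1(3) by (subst Bochner_Integration.integral_sum) auto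
qed

lemma gspan_square_integrable: "Y \<in> gspan \<Longrightarrow> integrable M (\<lambda>x. (Y x)\<^sup>2)"
  using centered_gaussian_square_integrable gspan_gaussian gspan_mean by blast

lemma gspan_cis: "Y \<in> gspan \<Longrightarrow> (\<integral>x. cis (Y x) \<partial>M) = exp (- (\<integral>x. (Y x)\<^sup>2 \<partial>M) / 2)"
  using centered_gaussian_cis gspan_gaussian gspan_mean by blast

lemma gspan_prod_integrable:
  assumes "Y \<in> gspan" "Y' \<in> gspan"
  shows "integrable M (\<lambda>x. Y x * Y' x)"
proof (rule Bochner_Integration.integrable_bound)
  show "integrable M (\<lambda>x. (Y x)\<^sup>2 + (Y' x)\<^sup>2)"
    using assms gspan_square_integrable by auto
  show "AE x in M. norm (Y x * Y' x) \<le> norm ((Y x)\<^sup>2 + (Y' x)\<^sup>2)"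
  proof (rule AE_I2)
    fix x
    have "2 * \<bar>Y x\<bar> * \<bar>Y' x\<bar> \<le> (Y x)\<^sup>2 + (Y' x)\<^sup>2"
      using sum_squares_bound[of "\<bar>Y x\<bar>" "\<bar>Y' x\<bar>"] by simp
    moreover have "0 \<le> \<bar>Y x\<bar> * \<bar>Y' x\<bar>" by simp
    ultimately have "\<bar>Y x\<bar> * \<bar>Y' x\<bar> \<le> (Y x)\<^sup>2 + (Y' x)\<^sup>2" by linarith
    then show "norm (Y x * Y' x) \<le> norm ((Y x)\<^sup>2 + (Y' x)\<^sup>2)" by (simp add: abs_mult)
  qed
qed (use assms gspan_measurable in auto)

lemma gspan_square_add:
  assumes "Y \<in> gspan" "Y' \<in> gspan"
  shows "(\<integral>x. (k * Y x + Y' x)\<^sup>2 \<partial>M) = k\<^sup>2 * (\<integral>x. (Y x)\<^sup>2 \<partial>M) + 2 * k * (\<integral>x. Y x * Y' x \<partial>M) + (\<integral>x. (Y' x)\<^sup>2 \<partial>M)"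
proof -
  have "(k * Y x + Y' x)\<^sup>2 = k\<^sup>2 * (Y x)\<^sup>2 + 2 * k * (Y x * Y' x) + (Y' x)\<^sup>2" for x
    by (simp add: power2_eq_square algebra_simps)
  then show ?thesis using assms gspan_square_integrable gspan_prod_integrable by simp
qed

lemma gspan_cauchy_schwarz:
  assumes "Y \<in> gspan" "Y' \<in> gspan"
  shows "(\<integral>x. Y x * Y' x \<partial>M)\<^sup>2 \<le> (\<integral>x. (Y x)\<^sup>2 \<partial>M) * (\<integral>x. (Y' x)\<^sup>2 \<partial>M)"
proof -
  define A B C where "A = (\<integral>x. (Y x)\<^sup>2 \<partial>M)" "B = (\<integral>x. Y x * Y' x \<partial>M)" "C = (\<integral>x. (Y' x)\<^sup>2 \<partial>M)"
  have q: "0 \<le> k\<^sup>2 * A + 2 * k * B + C" for k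
    using gspan_square_add[OF assms, of k, symmetric] by (simp add: A_B_C_def)
  have "0 \<le> A" by (simp add: A_B_C_def)
  have "B\<^sup>2 \<le> A * C"
  proof (cases "A = 0")
    case True
    have "B = 0"
    proof (rule ccontr)
      assume "B \<noteq> 0"
      \<comment> \<open>Here the quadratic reduces to \<open>2 * k * B + C\<close>, and this
        \<open>k\<close> gives it the value -1.\<close>
      then show False using q[of "- (C + 1) / (2 * B)"] True by (simp add: field_simps)
    qed
    then show ?thesis using True by simp
  next
    case False
    then show ?thesis using q[of "- B / A"] \<open>0 \<le> A\<close> by (simp add: power2_eq_square field_simps)
  qed
  then show ?thesis by (simp add: A_B_C_def)
qed

text \<open>Zero covariance makes the variance of each combination of \<open>V\<close> and
  \<open>L\<close> split into two terms; the joint characteristic function then factors, so the two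
  variables are independent.\<close>

lemma gspan_indep_cis:
  assumes V: "V \<in> gspan" and L: "L \<in> gspan" and cov: "(\<integral>x. V x * L x \<partial>M) = 0"
    and w[measurable]: "w \<in> borel_measurable borel" and wb: "\<And>x. \<bar>w x\<bar> \<le> (1::real)"
  shows "(\<integral>x. w (V x) *\<^sub>R cis (L x) \<partial>M) = (\<integral>x. w (V x) \<partial>M) *\<^sub>R (\<integral>x. cis (L x) \<partial>M)"
proof -
  note [measurable] = gspan_measurable[OF V] gspan_measurable[OF L]
  have "indep_vars (\<lambda>_. borel) (case_bool V L) UNIV"
  proof (rule indep_vars_if_cis)
    fix t :: "bool \<Rightarrow> real"
    have vl: "V x * (t False * L x) = t False * (V x * L x)" for x by simp
    have cov': "(\<integral>x. V x * (t False * L x) \<partial>M) = 0" unfolding vl using cov by simp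
    have "(\<integral>x. cis (t True * V x + t False * L x) \<partial>M) =
       exp (- ((t True)\<^sup>2 * (\<integral>x. (V x)\<^sup>2 \<partial>M) + (\<integral>x. (t False * L x)\<^sup>2 \<partial>M)) / 2)"
      using gspan_square_add[OF V gspan_scale[OF L], of "t True" "t False"] cov'
      by (subst gspan_cis) (auto intro!: gspan_add gspan_scale V L)
    also have "\<dots> = exp (- (\<integral>x. (t True * V x)\<^sup>2 \<partial>M) / 2) * exp (- (\<integral>x. (t False * L x)\<^sup>2 \<partial>M) / 2)"
      by (simp add: exp_add[symmetric] power_mult_distrib field_simps flip: of_real_mult)
    also have "\<dots> = (\<integral>x. cis (t True * V x) \<partial>M) * (\<integral>x. cis (t False * L x) \<partial>M)"
      by (simp add: gspan_cis gspan_scale V L)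
    finally show "(\<integral>x. cis (\<Sum>i\<in>UNIV. t i \<bullet> case_bool V L i x) \<partial>M) =
        (\<Prod>i\<in>UNIV. \<integral>x. cis (t i \<bullet> case_bool V L i x) \<partial>M)"
      by (simp add: UNIV_bool add.commute mult.commute)
  qed (auto split: bool.split)
  then have iv: "indep_var borel V borel L" 
    unfolding indep_var_def by (simp add: fun_eq_iff[THEN iffD2, of "case_bool borel borel" "\<lambda>_. borel"] split: bool.split)
  have "indep_var borel ((\<lambda>x. complex_of_real (w x)) \<circ> V) borel (cis \<circ> L)"
    by (rule indep_var_compose[OF iv]) auto
  moreover have "integrable M ((\<lambda>x. complex_of_real (w x)) \<circ> V)" "integrable M (cis \<circ> L)"
    using wb by (auto intro!: integrable_const_bound[where B=1] simp: comp_def)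
  ultimately show ?thesis
    using indep_var_lebesgue_integral by (fastforce simp: scaleR_conv_of_real comp_def)
qed

text \<open>Two measures on the tuples \<open>R j\<close> are compared, one with density
  \<open>w (V)\<close> and one with the mean of \<open>w (V)\<close> as constant density. Every
  combination of the \<open>R j\<close> lies in \<open>gspan\<close> and is uncorrelated with
  \<open>V\<close>, so \<open>gspan_indep_cis\<close> matches their transforms. Being a density
  forces \<open>0 \<le> w x\<close>.\<close>

lemma gspan_indep_indicator:
  fixes R :: "'i \<Rightarrow> 'w \<Rightarrow> real ^ 'd"
  assumes V: "V \<in> gspan" and J: "finite J" and R: "\<And>j \<theta>. j \<in> J \<Longrightarrow> (\<lambda>x. \<theta> \<bullet> R j x) \<in> gspan"
    and Rm: "\<And>j. j \<in> J \<Longrightarrow> R j \<in> borel_measurable M"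
    and cov: "\<And>j \<theta>. j \<in> J \<Longrightarrow> (\<integral>x. V x * (\<theta> \<bullet> R j x) \<partial>M) = 0"
    and w[measurable]: "w \<in> borel_measurable borel" and wb: "\<And>x. 0 \<le> w x" "\<And>x. w x \<le> (1::real)"
    and B: "\<And>j. j \<in> J \<Longrightarrow> B j \<in> sets borel"
  shows "(\<integral>x. w (V x) * (\<Prod>j\<in>J. indicator (B j) (R j x)) \<partial>M)
      = (\<integral>x. w (V x) \<partial>M) * (\<integral>x. (\<Prod>j\<in>J. indicator (B j) (R j x)) \<partial>M)"
proof -
  note [measurable] = gspan_measurable[OF V]
  have i: "integrable M (\<lambda>x. w (V x))" using wb by (auto intro!: integrable_const_bound[where B=1])
  have "(\<integral>x. w (V x) * (\<Prod>j\<in>J. indicator (B j) (R j x)) \<partial>M)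
      = (\<integral>x. (\<integral>x. w (V x) \<partial>M) * (\<Prod>j\<in>J. indicator (B j) (R j x)) \<partial>M)"
  proof (rule integral_weighted_prod_indicator_eq[OF finite_measure_eqI_cis J])
    fix t :: "'i \<Rightarrow> real ^ 'd"
    define L where "L x = (\<Sum>j\<in>J. t j \<bullet> R j x)" for x
    have L: "L \<in> gspan" unfolding L_def[abs_def] using J R by (rule gspan_sum)
    have "(\<integral>x. V x * L x \<partial>M) = (\<Sum>j\<in>J. \<integral>x. V x * (t j \<bullet> R j x) \<partial>M)"
      unfolding L_def sum_distrib_left
      using R V by (intro Bochner_Integration.integral_sum gspan_prod_integrable) auto
    then have "(\<integral>x. V x * L x \<partial>M) = 0" using cov by simp
    then have "(\<integral>x. w (V x) *\<^sub>R cis (L x) \<partial>M) = (\<integral>x. w (V x) \<partial>M) *\<^sub>R (\<integral>x. cis (L x) \<partial>M)"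
      using wb by (intro gspan_indep_cis V L w) (auto simp: abs_le_iff intro: order_trans)
    then show "(\<integral>x. w (V x) *\<^sub>R cis (\<Sum>j\<in>J. t j \<bullet> R j x) \<partial>M) = (\<integral>x. (\<integral>x. w (V x) \<partial>M) *\<^sub>R cis (\<Sum>j\<in>J. t j \<bullet> R j x) \<partial>M)"
      by (simp add: L_def)
  qed (use wb i Rm B in auto)
  then show ?thesis by simp
qed

text \<open>Continuity of paths and dominated convergence give convergence of the characteristic
  function. For a centred Gaussian variable that function is the exponential of minus half the
  variance, so a logarithm turns pathwise continuity into mean-square continuity.\<close>

lemma gspan_incr_square_tendsto:
  assumes t: "t \<longlonglongrightarrow> s" "\<And>n. 0 \<le> t n" "0 \<le> s"
  shows "(\<lambda>n. \<integral>x. (\<theta> \<bullet> (Z (t n) x - Z s x))\<^sup>2 \<partial>M) \<longlonglongrightarrow> 0"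
proof -
  let ?v = "\<lambda>n. \<integral>x. (\<theta> \<bullet> (Z (t n) x - Z s x))\<^sup>2 \<partial>M"
  have "(\<lambda>n. \<integral>x. cis (\<theta> \<bullet> (Z (t n) x - Z s x)) \<partial>M) \<longlonglongrightarrow> (\<integral>x. cis 0 \<partial>M)"
  proof (rule integral_dominated_convergence[where w="\<lambda>_. 1"])
    show "AE x in M. (\<lambda>n. cis (\<theta> \<bullet> (Z (t n) x - Z s x))) \<longlonglongrightarrow> cis 0"
    proof (rule AE_I2)
      fix x assume "x \<in> space M"
      then have "continuous_on {0..} (\<lambda>t. Z t x)" using paths by (simp add: continuous_process_def)
      then have "(\<lambda>n. Z (t n) x) \<longlonglongrightarrow> Z s x"
        using t by (auto simp: continuous_on_sequentially comp_def)
      then have "(\<lambda>n. \<theta> \<bullet> (Z (t n) x - Z s x)) \<longlonglongrightarrow> \<theta> \<bullet> (Z s x - Z s x)"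
        by (intro tendsto_intros)
      then have "(\<lambda>n. \<theta> \<bullet> (Z (t n) x - Z s x)) \<longlonglongrightarrow> 0" by simp
      moreover have "isCont cis 0" using continuous_on_eq_continuous_at[of UNIV cis] by (auto intro: continuous_intros)
      ultimately show "(\<lambda>n. cis (\<theta> \<bullet> (Z (t n) x - Z s x))) \<longlonglongrightarrow> cis 0"
        by (rule isCont_tendsto_compose[rotated])
    qed
  qed (use t in auto)
  then have "(\<lambda>n. complex_of_real (exp (- ?v n / 2))) \<longlonglongrightarrow> 1"
    using t gspan_cis[OF gspan_incr] by (simp add: prob_space exp_of_real)
  then have "(\<lambda>n. exp (- ?v n / 2)) \<longlonglongrightarrow> 1"
    using tendsto_Re by fastforce
  then have "(\<lambda>n. - 2 * ln (exp (- ?v n / 2))) \<longlonglongrightarrow> - 2 * ln 1"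
    by (intro tendsto_intros) auto
  then show ?thesis by simp
qed

end

section \<open>Paths of the equation\<close>

text \<open>By uniform continuity each cell of length \<open>h\<close> contributes an error of at
  most \<open>e' * h\<close>, and these errors add up by induction over the cells. The sums present
  the drift as a limit of functions of finitely many path values, which finite-dimensional laws
  control.\<close>

lemma riemann_sums_tendsto_integral:
  fixes f :: "real \<Rightarrow> 'a::banach"
  assumes f: "continuous_on {0..t} f" and t: "0 \<le> t"
  shows "(\<lambda>n. \<Sum>i<n. (t / real n) *\<^sub>R f (real i * t / real n)) \<longlonglongrightarrow> integral {0..t} f"
proof (rule LIMSEQ_I)
  fix e :: real assume e: "0 < e"
  \<comment> \<open>The \<open>+ 1\<close> covers \<open>t = 0\<close> and makes the final bound
    \<open>e' * t < e\<close> strict.\<close>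
  define e' where "e' = e / (t + 1)"
  have e': "0 < e'" using e t by (simp add: e'_def)
  have "uniformly_continuous_on {0..t} f" using f by (intro compact_uniformly_continuous) auto
  then obtain d where d: "0 < d" and du: "\<And>x y. x \<in> {0..t} \<Longrightarrow> y \<in> {0..t} \<Longrightarrow> dist y x < d \<Longrightarrow> dist (f y) (f x) < e'"
    using e' unfolding uniformly_continuous_on_def by blast
  obtain n0 where n0: "t / d < real n0" using reals_Archimedean2 by blast
  show "\<exists>no. \<forall>n\<ge>no. norm ((\<Sum>i<n. (t / real n) *\<^sub>R f (real i * t / real n)) - integral {0..t} f) < e"
  proof (intro exI[of _ "Suc n0"] allI impI)
    fix n assume n: "Suc n0 \<le> n"
    define h where "h = t / real n"
    have n0': "0 < real n" using n by simp
    have nh: "real n * h = t" using n0' by (simp add: h_def)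
    have h0: "0 \<le> h" using t by (simp add: h_def)
    have hd: "h < d"
    proof -
      have "t / d < real n" using n0 n by linarith
      then have "t < d * real n" using d by (simp add: field_simps)
      then show ?thesis using n0' by (simp add: h_def field_simps)
    qed
    have "norm ((\<Sum>i<k. h *\<^sub>R f (real i * h)) - integral {0..real k * h} f) \<le> real k * (e' * h)" if "k \<le> n" for k
      using that
    proof (induction k)
      case 0
      then show ?case by simp
    next
      case (Suc k)
      have le: "real (Suc k) * h \<le> t"
        unfolding nh[symmetric] using Suc.prems h0 by (intro mult_right_mono) auto
      have kh: "real k * h \<le> real (Suc k) * h" "0 \<le> real k * h" using h0 by (auto intro: mult_right_mono)
      have c: "continuous_on {real k * h..real (Suc k) * h} f" "continuous_on {0..real (Suc k) * h} f"
        using le kh by (auto intro: continuous_on_subset[OF f])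
      have i1: "integral {0..real (Suc k) * h} f = integral {0..real k * h} f + integral {real k * h..real (Suc k) * h} f"
        using kh c by (intro Henstock_Kurzweil_Integration.integral_combine[symmetric] integrable_continuous_real) auto
      have i2: "norm (integral {real k * h..real (Suc k) * h} (\<lambda>x. f x - f (real k * h))) \<le> e' * (real (Suc k) * h - real k * h)"
      proof (rule integral_bound)
        fix x assume x: "x \<in> {real k * h..real (Suc k) * h}"
        have "dist x (real k * h) < d" using x hd by (auto simp: dist_real_def algebra_simps)
        then have "dist (f x) (f (real k * h)) < e'" using x kh le by (intro du) auto
        then show "norm (f x - f (real k * h)) \<le> e'" by (simp add: dist_norm)
      qed (use kh c in \<open>auto intro!: continuous_intros\<close>)
      have i3: "integral {real k * h..real (Suc k) * h} (\<lambda>x. f x - f (real k * h)) =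
          integral {real k * h..real (Suc k) * h} f - h *\<^sub>R f (real k * h)"
        using c kh by (subst Henstock_Kurzweil_Integration.integral_diff)
          (auto intro!: integrable_continuous_real simp: algebra_simps)
      have "h *\<^sub>R f (real k * h) - integral {real k * h..real (Suc k) * h} f =
          - integral {real k * h..real (Suc k) * h} (\<lambda>x. f x - f (real k * h))"
        unfolding i3 by simp
      then have "norm (h *\<^sub>R f (real k * h) - integral {real k * h..real (Suc k) * h} f) =
          norm (integral {real k * h..real (Suc k) * h} (\<lambda>x. f x - f (real k * h)))"
        by (simp only: norm_minus_cancel)
      also have "\<dots> \<le> e' * h" using i2 by (simp add: algebra_simps)
      finally have 1: "norm (h *\<^sub>R f (real k * h) - integral {real k * h..real (Suc k) * h} f) \<le> e' * h" .
      have "(\<Sum>i<Suc k. h *\<^sub>R f (real i * h)) - integral {0..real (Suc k) * h} f =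
        ((\<Sum>i<k. h *\<^sub>R f (real i * h)) - integral {0..real k * h} f) + (h *\<^sub>R f (real k * h) - integral {real k * h..real (Suc k) * h} f)"
        using i1 by simp
      also have "norm \<dots> \<le> real k * (e' * h) + e' * h"
        by (rule order_trans[OF norm_triangle_ineq]) (use Suc.IH Suc.prems 1 in \<open>intro add_mono; simp\<close>)
      finally show ?case by (simp add: algebra_simps)
    qed
    from this[of n] have "norm ((\<Sum>i<n. h *\<^sub>R f (real i * h)) - integral {0..t} f) \<le> e' * t"
      using nh by (simp add: mult.left_commute)
    also have "\<dots> < e" using e t by (simp add: e'_def field_simps)
    finally show "norm ((\<Sum>i<n. (t / real n) *\<^sub>R f (real i * t / real n)) - integral {0..t} f) < e"
      by (simp add: h_def)
  qed
qed

lemma continuous_on_halfline: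
  fixes f :: "real \<Rightarrow> 'a::topological_space"
  assumes "\<And>T. 0 < T \<Longrightarrow> continuous_on {0..T} f"
  shows "continuous_on {0..} f"
proof -
  have "continuous (at x within {0..}) f" if "0 \<le> x" for x
  proof -
    have "continuous (at x within {0..x + 1}) f"
      using that assms[of "x + 1"] by (auto simp: continuous_on_eq_continuous_within)
    moreover have "at x within {0..} = at x within {0..x + 1}"
      by (rule at_within_nhd[of _ "{x - 1<..<x + 1}"]) auto
    ultimately show ?thesis by simp
  qed
  then show ?thesis by (simp add: continuous_on_eq_continuous_within)
qed

lemma continuous_on_indefinite_integral:
  fixes f :: "real \<Rightarrow> 'a::euclidean_space"
  assumes f: "continuous_on {0..} f"
  shows "continuous_on {0..} (\<lambda>t. integral {0..t} f)"
  by (intro continuous_on_halfline indefinite_integral_continuous_1 integrable_continuous_real continuous_on_subset[OF f]) auto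

text \<open>
  A path of the equation can only leave a large ball through its driving part: until its exit
  time the drift is at most \<open>B\<close>.
\<close>

lemma drift_bounded_path:
  fixes x :: "real \<Rightarrow> 'a::euclidean_space"
  assumes x: "continuous_on {0..t} x" and b: "continuous_on UNIV b"
    and x0: "norm (x 0) \<le> \<rho>"
    and drive: "\<And>r. 0 \<le> r \<Longrightarrow> r \<le> t \<Longrightarrow> norm (x r - x 0 - integral {0..r} (\<lambda>s. b (x s))) \<le> K"
    and B: "\<And>y. norm y \<le> \<rho> + K + 1 \<Longrightarrow> norm (b y) \<le> B"
    and Bt: "B * t \<le> 1/2" and B0: "0 \<le> B" and r: "0 \<le> r" "r \<le> t"
  shows "norm (integral {0..r} (\<lambda>s. b (x s))) \<le> 1/2"
proof -
  have K: "0 \<le> K" using drive[of 0] r by simp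
  have int: "norm (integral {0..q} (\<lambda>s. b (x s))) \<le> 1/2"
    if "0 \<le> q" "q \<le> t" "\<And>s. 0 \<le> s \<Longrightarrow> s \<le> q \<Longrightarrow> norm (x s) \<le> \<rho> + K + 1" for q
  proof -
    have "norm (integral {0..q} (\<lambda>s. b (x s))) \<le> B * (q - 0)"
      using that B by (intro integral_bound continuous_on_compose2[OF b] continuous_on_subset[OF x]) auto
    also have "\<dots> \<le> B * t" using that B0 by (intro mult_left_mono) auto
    finally show ?thesis using Bt by simp
  qed
  have "norm (x s) \<le> \<rho> + K + 1" if s: "0 \<le> s" "s \<le> t" for s
  proof (rule ccontr)
    assume "\<not> ?thesis"
    then have gt: "\<rho> + K + 1 \<le> norm (x s)" by simp
    \<comment> \<open>The least element \<open>\<tau>\<close> of \<open>C\<close> is the time at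
      which the path first reaches the sphere. Up to then the drift integral is at most 1/2, so the
      norm at \<open>\<tau>\<close> is at most \<open>\<rho> + K + 1/2\<close>, short of the level
      that defines \<open>C\<close>.\<close>
    define C where "C = {q\<in>{0..s}. norm (x q) = \<rho> + K + 1}"
    have cont: "continuous_on {0..q} (\<lambda>q. norm (x q))" if "q \<le> s" for q
      using that s by (intro continuous_intros continuous_on_subset[OF x]) auto
    have "closed ({0..s} \<inter> (\<lambda>q. norm (x q)) -` {\<rho> + K + 1})"
      by (intro continuous_closed_preimage cont) auto
    then have "compact ({0..s} \<inter> ({0..s} \<inter> (\<lambda>q. norm (x q)) -` {\<rho> + K + 1}))"
      by (intro compact_Int_closed) auto
    also have "{0..s} \<inter> ({0..s} \<inter> (\<lambda>q. norm (x q)) -` {\<rho> + K + 1}) = C"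
      by (auto simp: C_def)
    finally have "compact C" .
    moreover have "C \<noteq> {}"
      using IVT'[of "\<lambda>q. norm (x q)" 0 "\<rho> + K + 1" s] x0 K gt s cont[of s] by (auto simp: C_def)
    ultimately obtain \<tau> where \<tau>: "\<tau> \<in> C" "\<And>q. q \<in> C \<Longrightarrow> \<tau> \<le> q"
      using compact_attains_inf[of C] by auto
    have "norm (x q) \<le> \<rho> + K + 1" if q: "0 \<le> q" "q \<le> \<tau>" for q
    proof (rule ccontr)
      assume gt: "\<not> norm (x q) \<le> \<rho> + K + 1"
      have qs: "q \<le> s" using q \<tau> by (auto simp: C_def)
      obtain q' where "0 \<le> q'" "q' \<le> q" "norm (x q') = \<rho> + K + 1"
        using IVT'[of "\<lambda>q. norm (x q)" 0 "\<rho> + K + 1" q] x0 K gt q cont[OF qs] by auto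
      then have "q' \<in> C" using qs by (auto simp: C_def)
      then have "q' = q" using \<tau>(2)[of q'] q \<open>q' \<le> q\<close> by auto
      then show False using gt \<open>norm (x q') = _\<close> by simp
    qed
    then have 1: "norm (integral {0..\<tau>} (\<lambda>s. b (x s))) \<le> 1/2"
      using \<tau> s by (intro int) (auto simp: C_def)
    define A where "A = x \<tau> - x 0 - integral {0..\<tau>} (\<lambda>s. b (x s))"
    have 2: "norm A \<le> K"
      unfolding A_def using \<tau> s by (intro drive) (auto simp: C_def)
    have "x \<tau> = x 0 + A + integral {0..\<tau>} (\<lambda>s. b (x s))"
      by (simp add: A_def)
    then have "norm (x \<tau>) \<le> norm (x 0) + norm A + norm (integral {0..\<tau>} (\<lambda>s. b (x s)))"
      using norm_triangle_ineq[of "x 0 + A" "integral {0..\<tau>} (\<lambda>s. b (x s))"] norm_triangle_ineq[of "x 0" A] by simp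
    then have "norm (x \<tau>) \<le> \<rho> + K + 1/2" using x0 1 2 by simp
    then show False using \<tau> by (auto simp: C_def)
  qed
  then show ?thesis using int r by auto
qed

text \<open>Local constancy is known only to the right, so the argument runs over the supremum of
  the initial intervals on which \<open>f\<close> equals \<open>f 0\<close>: continuity carries the
  equality to the supremum, and \<open>loc\<close> pushes it further unless the supremum is
  \<open>r\<close>.\<close>

lemma locally_constant_right:
  fixes f :: "real \<Rightarrow> 'a::t2_space"
  assumes f: "continuous_on {0..h} f" and r: "0 \<le> r" "r \<le> h"
    and loc: "\<And>s. 0 \<le> s \<Longrightarrow> s < h \<Longrightarrow> \<exists>\<delta>>0. \<forall>q. 0 \<le> q \<and> q \<le> \<delta> \<longrightarrow> f (s + q) = f s"
  shows "f r = f 0"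
proof (rule ccontr)
  assume ne: "f r \<noteq> f 0"
  define P where "P q \<longleftrightarrow> f q = f 0" for q
  define S where "S = {s\<in>{0..r}. \<forall>q\<in>{0..s}. P q}"
  have "P 0" by (simp add: P_def)
  then have S0: "0 \<in> S" using r by (auto simp: S_def)
  have bd: "bdd_above S" by (rule bdd_aboveI[of _ r]) (simp add: S_def)
  define m where "m = Sup S"
  have "m \<le> r" unfolding m_def by (rule cSup_least) (use S0 in \<open>auto simp: S_def\<close>)
  moreover have "0 \<le> m" unfolding m_def by (rule cSup_upper[OF S0 bd])
  ultimately have m: "0 \<le> m" "m \<le> r" by simp_all
  have below: "P q" if q: "0 \<le> q" "q < m" for q
  proof -
    have "S \<noteq> {}" using S0 by blast
    from less_cSup_iff[OF this bd, of q] q(2)[unfolded m_def] obtain s where s: "s \<in> S" "q < s" by blast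
    from s(1) have "\<forall>q\<in>{0..s}. P q" unfolding S_def by blast
    then show ?thesis using q(1) s(2) by simp
  qed
  have fm: "f m = f 0"
  proof (cases "m = 0")
    case False
    then have m0: "0 < m" using m by simp
    have "continuous_on {0..m} f" using m r by (intro continuous_on_subset[OF f]) simp
    then have "(f \<longlongrightarrow> f m) (at m within {0..m})" using m unfolding continuous_on_def by simp
    then have 1: "(f \<longlongrightarrow> f m) (at_left m)"
      unfolding at_within_Icc_at_left[OF m0] .
    have "(f \<longlongrightarrow> f 0) (at_left m)"
    proof (rule tendsto_eventually)
      have "eventually P (at_left m)"
        unfolding eventually_at_left[OF m0] using below m0 by (intro exI[of _ 0]) simp
      then show "\<forall>\<^sub>F q in at_left m. f q = f 0"
        by (rule eventually_mono) (simp only: P_def)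
    qed
    then show ?thesis by (rule tendsto_unique[OF trivial_limit_at_left_real 1])
  qed (simp only:)
  have "m \<noteq> r" using fm ne by blast
  then have "m < r" using m by simp
  then obtain \<delta> where \<delta>: "\<delta> > 0" "\<And>q. 0 \<le> q \<Longrightarrow> q \<le> \<delta> \<Longrightarrow> f (m + q) = f m"
    using loc[OF m(1)] r(2) by (meson less_le_trans)
  have "min (m + \<delta>) r \<in> S"
    unfolding S_def
  proof (safe intro!: CollectI)
    fix q assume q: "q \<in> {0..min (m + \<delta>) r}"
    show "P q"
    proof (cases "q < m")
      case True
      then show ?thesis using below[of q] q by auto
    next
      case False
      then have "f (m + (q - m)) = f m" using q by (intro \<delta>(2)) auto
      then show ?thesis by (simp add: P_def fm)
    qed
  qed (use m r \<delta>(1) in auto)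
  then have "min (m + \<delta>) r \<le> m" unfolding m_def using bd by (rule cSup_upper)
  then show False using \<open>m < r\<close> \<delta>(1) by auto
qed

section \<open>The noise as a functional of the stationary solution\<close>

locale stationary_sde = prob_space M for M :: "'w measure" +
  fixes b :: "real ^ 'd \<Rightarrow> real ^ 'd" and X :: "('w, 'd::finite) process"
  assumes b: "continuous_on UNIV b"
    and X_paths: "continuous_process M X"
    and X_stationary: "stationary_process M X"
begin

abbreviation Z :: "('w, 'd) process" where "Z \<equiv> noise_of b X"

lemma X_measurable [measurable]: "0 \<le> t \<Longrightarrow> X t \<in> borel_measurable M"
  using X_paths by (simp add: continuous_process_def)

lemma b_measurable [measurable]: "b \<in> borel_measurable borel"
  using b by (rule borel_measurable_continuous_onI)

lemma X_continuous: "\<omega> \<in> space M \<Longrightarrow> continuous_on {0..} (\<lambda>t. X t \<omega>)"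
  using X_paths by (simp add: continuous_process_def)

lemma drift_continuous: "\<omega> \<in> space M \<Longrightarrow> continuous_on {0..} (\<lambda>t. b (X t \<omega>))"
  using continuous_on_compose2[OF b X_continuous] by simp

lemma Z_continuous: "\<omega> \<in> space M \<Longrightarrow> continuous_on {0..} (\<lambda>t. Z t \<omega>)"
  unfolding noise_of_def
  by (intro continuous_intros X_continuous continuous_on_indefinite_integral drift_continuous)

lemma Z_0: "Z 0 \<omega> = 0"
  by (simp add: noise_of_def)

text \<open>The noise functional with the time integral replaced by a left Riemann sum. It reads the
  path only at the finitely many \<open>riemann_times n t\<close>, so its law is governed by
  finite-dimensional laws of \<open>X\<close>.\<close>

definition riemann_noise :: "nat \<Rightarrow> real \<Rightarrow> (real \<Rightarrow> real ^ 'd) \<Rightarrow> real ^ 'd" where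
  "riemann_noise n t x = x t - x 0 - (\<Sum>i<n. (t / real n) *\<^sub>R b (x (real i * t / real n)))"

definition riemann_times :: "nat \<Rightarrow> real \<Rightarrow> real set" where
  "riemann_times n t = {0, t} \<union> (\<lambda>i. real i * t / real n) ` {..<n}"

lemma riemann_times: "finite (riemann_times n t)" "0 \<le> t \<Longrightarrow> riemann_times n t \<subseteq> {0..}"
  "0 \<in> riemann_times n t" "t \<in> riemann_times n t" "i < n \<Longrightarrow> real i * t / real n \<in> riemann_times n t"
  by (auto simp: riemann_times_def)

text \<open>Translating the integral shows that the increments after \<open>s\<close> are the noise
  functional of the path restarted at \<open>s\<close>; this is how a shift of \<open>X\<close> acts
  on them.\<close>

lemma Z_increment:
  assumes \<omega>: "\<omega> \<in> space M" and s: "0 \<le> s" and t: "0 \<le> t"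
  shows "Z (s + t) \<omega> - Z s \<omega> = X (s + t) \<omega> - X s \<omega> - integral {0..t} (\<lambda>r. b (X (s + r) \<omega>))"
proof -
  have int: "(\<lambda>r. b (X r \<omega>)) integrable_on {0..s + t}"
    by (intro integrable_continuous_real continuous_on_subset[OF drift_continuous[OF \<omega>]]) auto
  have "integral {0..t} (\<lambda>r. b (X (s + r) \<omega>)) = integral {s..s + t} (\<lambda>r. b (X r \<omega>))"
    using integral_shift_Icc_real[of 0 t "\<lambda>r. b (X r \<omega>)" s] by (simp add: comp_def add.commute)
  also have "\<dots> = integral {0..s + t} (\<lambda>r. b (X r \<omega>)) - integral {0..s} (\<lambda>r. b (X r \<omega>))"
    using Henstock_Kurzweil_Integration.integral_combine[OF _ _ int, of s] s t by (simp add: algebra_simps)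
  finally show ?thesis by (simp add: noise_of_def)
qed

lemma riemann_noise_tendsto:
  assumes \<omega>: "\<omega> \<in> space M" and s: "0 \<le> s" and t: "0 \<le> t"
  shows "(\<lambda>n. riemann_noise n t (\<lambda>r. X (s + r) \<omega>)) \<longlonglongrightarrow> Z (s + t) \<omega> - Z s \<omega>"
proof -
  have "continuous_on {0..t} (\<lambda>r. b (X (s + r) \<omega>))"
    using s by (intro continuous_on_compose2[OF drift_continuous[OF \<omega>]] continuous_intros) auto
  then show ?thesis
    unfolding riemann_noise_def Z_increment[OF assms]
    by (auto intro!: tendsto_intros riemann_sums_tendsto_integral t)
qed

lemma riemann_noise_measurable:
  assumes Y: "\<And>r. r \<in> riemann_times n t \<Longrightarrow> (\<lambda>\<omega>. Y \<omega> r) \<in> borel_measurable A"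
  shows "(\<lambda>\<omega>. riemann_noise n t (Y \<omega>)) \<in> borel_measurable A"
proof -
  have [measurable]: "(\<lambda>\<omega>. Y \<omega> 0) \<in> borel_measurable A" "(\<lambda>\<omega>. Y \<omega> t) \<in> borel_measurable A"
    by (auto intro: Y riemann_times)
  have [measurable]: "(\<lambda>\<omega>. Y \<omega> (real i * t / real n)) \<in> borel_measurable A" if "i < n" for i
    using that by (intro Y riemann_times)
  show ?thesis unfolding riemann_noise_def by measurable
qed

lemma Z_measurable: "0 \<le> t \<Longrightarrow> Z t \<in> borel_measurable M"
proof (rule borel_measurable_LIMSEQ_metric)
  assume t: "0 \<le> t"
  show "(\<lambda>\<omega>. riemann_noise n t (\<lambda>r. X r \<omega>)) \<in> borel_measurable M" for n
    using riemann_times(2)[OF t, of n] by (intro riemann_noise_measurable) auto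
  show "(\<lambda>n. riemann_noise n t (\<lambda>r. X r \<omega>)) \<longlonglongrightarrow> Z t \<omega>" if "\<omega> \<in> space M" for \<omega>
    using riemann_noise_tendsto[OF that order_refl t] by (simp add: Z_0)
qed

lemma Z_paths: "continuous_process M Z"
  unfolding continuous_process_def using Z_measurable Z_continuous by auto

text \<open>
  Stationarity of \<open>X\<close> passes to the pair of \<open>X s\<close> and the increments of \<open>Z\<close> after \<open>s\<close>, because
  the latter are limits of functions of finitely many values of \<open>X\<close> after \<open>s\<close>.
\<close>

lemma shift_invariance:
  fixes w :: "real \<Rightarrow> real"
  assumes s: "0 \<le> s" and r: "0 \<le> r1" "0 \<le> r2" and B[measurable]: "B \<in> sets borel"
    and w: "continuous_on UNIV w" "\<And>x. \<bar>w x\<bar> \<le> 1"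
  shows "(\<integral>\<omega>. indicator B (X s \<omega>) * w (\<theta> \<bullet> (Z (s + r2) \<omega> - Z (s + r1) \<omega>)) \<partial>M)
       = (\<integral>\<omega>. indicator B (X 0 \<omega>) * w (\<theta> \<bullet> (Z r2 \<omega> - Z r1 \<omega>)) \<partial>M)"
proof -
  have [measurable]: "w \<in> borel_measurable borel" using w(1) by (rule borel_measurable_continuous_onI)
  define F where "F n x = indicator B (x 0) * w (\<theta> \<bullet> (riemann_noise n r2 x - riemann_noise n r1 x))"
    for n and x :: "real \<Rightarrow> real ^ 'd"
  define J where "J n = riemann_times n r1 \<union> riemann_times n r2" for n
  have J: "finite (J n)" "J n \<subseteq> {0..}" "0 \<in> J n" for n
    using riemann_times r by (auto simp: J_def)
  have restr: "F n (restrict x (J n)) = F n x" for n x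
  proof -
    have "riemann_noise n r1 (restrict x (J n)) = riemann_noise n r1 x"
      "riemann_noise n r2 (restrict x (J n)) = riemann_noise n r2 x"
      using riemann_times by (auto simp: riemann_noise_def J_def intro!: sum.cong)
    then show ?thesis using J(3)[of n] by (simp add: F_def)
  qed
  have comp: "(\<lambda>x. x t) \<in> borel_measurable (\<Pi>\<^sub>M t\<in>J n. (borel :: (real ^ 'd) measure))" if "t \<in> J n" for t n
    using that by (rule measurable_component_singleton)
  have Fm[measurable]: "F n \<in> borel_measurable (\<Pi>\<^sub>M t\<in>J n. borel)" for n
  proof -
    have [measurable]: "riemann_noise n r1 \<in> borel_measurable (\<Pi>\<^sub>M t\<in>J n. borel)"
      "riemann_noise n r2 \<in> borel_measurable (\<Pi>\<^sub>M t\<in>J n. borel)"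
      "(\<lambda>x. x 0) \<in> borel_measurable (\<Pi>\<^sub>M t\<in>J n. (borel :: (real ^ 'd) measure))"
      using comp J(3) by (auto intro!: riemann_noise_measurable simp: J_def)
    show ?thesis unfolding F_def[abs_def] by measurable
  qed
  have eq: "(\<integral>\<omega>. F n (\<lambda>r. X (s + r) \<omega>) \<partial>M) = (\<integral>\<omega>. F n (\<lambda>r. X r \<omega>) \<partial>M)" for n
  proof -
    have 1: "(\<integral>\<omega>. F n (\<lambda>r. X (q + r) \<omega>) \<partial>M) = integral\<^sup>L (distr M (\<Pi>\<^sub>M t\<in>J n. borel) (\<lambda>\<omega>. \<lambda>t\<in>J n. X (q + t) \<omega>)) (F n)"
      if q: "0 \<le> q" for q
    proof (subst integral_distr)
      show "(\<lambda>\<omega>. \<lambda>t\<in>J n. X (q + t) \<omega>) \<in> M \<rightarrow>\<^sub>M (\<Pi>\<^sub>M t\<in>J n. borel)"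
        using J(2)[of n] q by (intro measurable_restrict X_measurable) auto
    qed (use restr in auto)
    have "distr M (\<Pi>\<^sub>M t\<in>J n. borel) (\<lambda>\<omega>. \<lambda>t\<in>J n. X (s + t) \<omega>) = distr M (\<Pi>\<^sub>M t\<in>J n. borel) (\<lambda>\<omega>. \<lambda>t\<in>J n. X t \<omega>)"
      using X_stationary s J[of n] by (auto simp: stationary_process_def same_fdd_def)
    then show ?thesis using 1[OF s] 1[of 0] by simp
  qed
  \<comment> \<open>Used for \<open>q = s\<close> and \<open>q = 0\<close>. The value
    \<open>x 0\<close> is read exactly by every \<open>F n\<close>, so \<open>B\<close> may be any
    Borel set, while the noise is only approximated and its limit passes through \<open>w\<close> by
    continuity.\<close>
  have lim: "(\<lambda>n. \<integral>\<omega>. F n (\<lambda>r. X (q + r) \<omega>) \<partial>M) \<longlonglongrightarrow>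
      (\<integral>\<omega>. indicator B (X q \<omega>) * w (\<theta> \<bullet> (Z (q + r2) \<omega> - Z (q + r1) \<omega>)) \<partial>M)" if q: "0 \<le> q" for q
  proof (rule integral_dominated_convergence[where w="\<lambda>_. 1"])
    show "(\<lambda>\<omega>. indicator B (X q \<omega>) * w (\<theta> \<bullet> (Z (q + r2) \<omega> - Z (q + r1) \<omega>))) \<in> borel_measurable M"
    proof -
      have [measurable]: "Z (q + r1) \<in> borel_measurable M" "Z (q + r2) \<in> borel_measurable M" "X q \<in> borel_measurable M"
        using q r by (auto intro: Z_measurable X_measurable)
      show ?thesis by measurable
    qed
    show "(\<lambda>\<omega>. F n (\<lambda>r. X (q + r) \<omega>)) \<in> borel_measurable M" for n
    proof -
      have "(\<lambda>\<omega>. F n (\<lambda>t\<in>J n. X (q + t) \<omega>)) \<in> borel_measurable M"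
        using J(2)[of n] q by (intro measurable_compose[OF _ Fm] measurable_restrict X_measurable) auto
      then show ?thesis by (simp add: restr)
    qed
    show "AE \<omega> in M. (\<lambda>n. F n (\<lambda>r. X (q + r) \<omega>)) \<longlonglongrightarrow> indicator B (X q \<omega>) * w (\<theta> \<bullet> (Z (q + r2) \<omega> - Z (q + r1) \<omega>))"
    proof (rule AE_I2)
      fix \<omega> assume \<omega>: "\<omega> \<in> space M"
      have "(\<lambda>n. \<theta> \<bullet> (riemann_noise n r2 (\<lambda>r. X (q + r) \<omega>) - riemann_noise n r1 (\<lambda>r. X (q + r) \<omega>)))
          \<longlonglongrightarrow> \<theta> \<bullet> ((Z (q + r2) \<omega> - Z q \<omega>) - (Z (q + r1) \<omega> - Z q \<omega>))"
        by (intro tendsto_intros riemann_noise_tendsto \<omega> q r)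
      then have "(\<lambda>n. \<theta> \<bullet> (riemann_noise n r2 (\<lambda>r. X (q + r) \<omega>) - riemann_noise n r1 (\<lambda>r. X (q + r) \<omega>)))
          \<longlonglongrightarrow> \<theta> \<bullet> (Z (q + r2) \<omega> - Z (q + r1) \<omega>)" by simp
      then have "(\<lambda>n. w (\<theta> \<bullet> (riemann_noise n r2 (\<lambda>r. X (q + r) \<omega>) - riemann_noise n r1 (\<lambda>r. X (q + r) \<omega>))))
          \<longlonglongrightarrow> w (\<theta> \<bullet> (Z (q + r2) \<omega> - Z (q + r1) \<omega>))"
        using w(1) by (intro continuous_on_tendsto_compose[OF w(1)]) auto
      then show "(\<lambda>n. F n (\<lambda>r. X (q + r) \<omega>)) \<longlonglongrightarrow> indicator B (X q \<omega>) * w (\<theta> \<bullet> (Z (q + r2) \<omega> - Z (q + r1) \<omega>))"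
        unfolding F_def by (auto intro!: tendsto_intros)
    qed
    show "AE \<omega> in M. norm (F n (\<lambda>r. X (q + r) \<omega>)) \<le> 1" for n
      using w(2) by (auto simp: F_def indicator_def)
  qed simp
  from lim[OF s] lim[of 0] show ?thesis
    unfolding eq by (auto dest: LIMSEQ_unique)
qed

end

section \<open>Independence of present and future\<close>

locale independent_sde = stationary_sde +
  assumes X0_indep: "indep_of_process M (X 0) Z"
    and Z_gaussian: "gaussian_process M Z"
    and Z_centered: "centered_process M Z"
begin

sublocale centered_gaussian_paths M Z
  by unfold_locales (rule Z_paths Z_gaussian Z_centered)+

text \<open>The hypothesis concerns generated \<sigma>-algebras. The indicator of \<open>X 0\<close>
  and the functional of the increment are real variables, each measurable for one of them, so they
  are independent and the integral of the product factors.\<close>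

lemma X0_Z_indep:
  assumes t: "0 \<le> t1" "0 \<le> t2" and B[measurable]: "B \<in> sets borel"
    and w[measurable]: "w \<in> borel_measurable borel" and wb: "\<And>x. \<bar>w x\<bar> \<le> (1 :: real)"
  shows "(\<integral>\<omega>. indicator B (X 0 \<omega>) * w (\<theta> \<bullet> (Z t2 \<omega> - Z t1 \<omega>)) \<partial>M)
       = measure M {\<omega>\<in>space M. X 0 \<omega> \<in> B} * (\<integral>\<omega>. w (\<theta> \<bullet> (Z t2 \<omega> - Z t1 \<omega>)) \<partial>M)"
proof -
  define V where "V \<omega> = \<theta> \<bullet> (Z t2 \<omega> - Z t1 \<omega>)" for \<omega>
  have [measurable]: "V \<in> borel_measurable M" unfolding V_def[abs_def] using t by measurable
  let ?Y = "\<lambda>\<omega>. indicator B (X 0 \<omega>) :: real"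
  define S1 where "S1 = sets (vimage_algebra (space M) (X 0) borel)"
  define S2 where "S2 = sets (vimage_algebra (space M) (\<lambda>\<omega>. \<lambda>t\<in>{0..}. Z t \<omega>) (\<Pi>\<^sub>M t\<in>{0..}. borel))"
  have ind: "prob (A1 \<inter> A2) = prob A1 * prob A2" if "A1 \<in> S1" "A2 \<in> S2" for A1 A2
    using X0_indep that unfolding indep_of_process_def S1_def S2_def indep_sets2_eq by blast
  have gm: "(\<lambda>z. \<theta> \<bullet> (z t2 - z t1)) \<in> borel_measurable (\<Pi>\<^sub>M t\<in>{0..}. (borel :: (real ^ 'b) measure))"
    using t by (intro borel_measurable_inner borel_measurable_diff measurable_component_singleton) auto
  have S2: "V -` C \<inter> space M \<in> S2" if "C \<in> sets borel" for C
  proof -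
    have "(\<lambda>\<omega>. \<lambda>t\<in>{0..}. Z t \<omega>) -` ((\<lambda>z. \<theta> \<bullet> (z t2 - z t1)) -` C \<inter> space (\<Pi>\<^sub>M t\<in>{0..}. borel)) \<inter> space M \<in> S2"
      unfolding S2_def by (intro in_vimage_algebra measurable_sets[OF gm that])
    also have "(\<lambda>\<omega>. \<lambda>t\<in>{0..}. Z t \<omega>) -` ((\<lambda>z. \<theta> \<bullet> (z t2 - z t1)) -` C \<inter> space (\<Pi>\<^sub>M t\<in>{0..}. borel)) \<inter> space M = V -` C \<inter> space M"
      using t by (auto simp: V_def space_PiM)
    finally show ?thesis .
  qed
  have S1: "?Y -` C \<inter> space M \<in> S1" if "C \<in> sets borel" for C
  proof -
    have "X 0 -` ((\<lambda>x. indicator B x :: real) -` C \<inter> space borel) \<inter> space M \<in> S1"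
      unfolding S1_def
      by (intro in_vimage_algebra measurable_sets[OF _ that]) auto
    then show ?thesis by (simp add: vimage_def)
  qed
  have stable: "Int_stable {f -` C \<inter> space M |C. C \<in> sets (borel :: real measure)}" for f :: "'a \<Rightarrow> real"
  proof (rule Int_stableI, elim CollectE exE conjE)
    fix P Q C D assume "P = f -` C \<inter> space M" "Q = f -` D \<inter> space M" "C \<in> sets (borel :: real measure)" "D \<in> sets (borel :: real measure)"
    then show "P \<inter> Q \<in> {f -` C \<inter> space M |C. C \<in> sets borel}"
      by (intro CollectI exI[of _ "C \<inter> D"]) auto
  qed
  have "indep_var borel ?Y borel V"
    unfolding indep_var_eq
    by (intro conjI indep_set_sigma_sets indep_setI stable) (auto simp: ind S1 S2)
  then have "indep_var borel ((\<lambda>x. x) \<circ> ?Y) borel (w \<circ> V)"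
    by (rule indep_var_compose) auto
  moreover have "integrable M ((\<lambda>x. x) \<circ> ?Y)" "integrable M (w \<circ> V)"
    using wb by (auto intro!: integrable_const_bound[where B=1] simp: comp_def)
  ultimately have "(\<integral>\<omega>. ?Y \<omega> * w (V \<omega>) \<partial>M) = (\<integral>\<omega>. ?Y \<omega> \<partial>M) * (\<integral>\<omega>. w (V \<omega>) \<partial>M)"
    using indep_var_lebesgue_integral[of "(\<lambda>x. x) \<circ> ?Y" "w \<circ> V"] by (simp add: comp_def)
  also have "(\<integral>\<omega>. ?Y \<omega> \<partial>M) = (\<integral>\<omega>. indicator {\<omega>\<in>space M. X 0 \<omega> \<in> B} \<omega> \<partial>M)"
    by (intro Bochner_Integration.integral_cong) (auto simp: indicator_def)
  also have "\<dots> = measure M {\<omega>\<in>space M. X 0 \<omega> \<in> B}" by simp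
  finally show ?thesis by (simp add: V_def)
qed

text \<open>Shifting by \<open>s\<close> reduces the joint integral to time 0, where
  \<open>X0_Z_indep\<close> applies. The remaining integral over shifted increments returns to the
  original one by the same shift with \<open>B = UNIV\<close>.\<close>

lemma X_indep_future:
  fixes w :: "real \<Rightarrow> real"
  assumes st: "0 \<le> s" "s \<le> t1" "s \<le> t2" and B: "B \<in> sets borel"
    and w: "continuous_on UNIV w" "\<And>x. \<bar>w x\<bar> \<le> 1"
  shows "(\<integral>\<omega>. indicator B (X s \<omega>) * w (\<theta> \<bullet> (Z t2 \<omega> - Z t1 \<omega>)) \<partial>M)
       = measure M {\<omega>\<in>space M. X 0 \<omega> \<in> B} * (\<integral>\<omega>. w (\<theta> \<bullet> (Z t2 \<omega> - Z t1 \<omega>)) \<partial>M)"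
proof -
  have w': "w \<in> borel_measurable borel" using w(1) by (rule borel_measurable_continuous_onI)
  have *: "0 \<le> t1 - s" "0 \<le> t2 - s" using st by auto
  have "(\<integral>\<omega>. indicator UNIV (X s \<omega>) * w (\<theta> \<bullet> (Z t2 \<omega> - Z t1 \<omega>)) \<partial>M)
      = (\<integral>\<omega>. indicator UNIV (X 0 \<omega>) * w (\<theta> \<bullet> (Z (t2 - s) \<omega> - Z (t1 - s) \<omega>)) \<partial>M)"
    using shift_invariance[OF st(1) *, of UNIV w \<theta>] w by simp
  then show ?thesis
    using shift_invariance[OF st(1) * B w, of \<theta>] X0_Z_indep[OF * B w' w(2), of \<theta>] by simp
qed

end

section \<open>The core argument: increments are uncorrelated with the past\<close>

context centered_gaussian_paths
begin

lemma Z_path: "\<omega> \<in> space M \<Longrightarrow> continuous_on {0..} (\<lambda>t. Z t \<omega>)"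
  using paths by (simp add: continuous_process_def)

text \<open>For centred variables this is the covariance vector. Divided by the variance of
  \<open>V\<close> it is the regression coefficient of \<open>Z r\<close> on \<open>V\<close>, that
  is, the direction in which conditioning on \<open>V\<close> displaces \<open>Z r\<close>.\<close>

definition cov :: "('w \<Rightarrow> real) \<Rightarrow> real \<Rightarrow> real ^ 'd" where
  "cov V r = (\<chi> i. \<integral>\<omega>. V \<omega> * Z r \<omega> $ i \<partial>M)"

lemma inner_cov:
  assumes V: "V \<in> gspan" and r: "0 \<le> r"
  shows "x \<bullet> cov V r = (\<integral>\<omega>. V \<omega> * (x \<bullet> Z r \<omega>) \<partial>M)"
proof -
  have "integrable M (\<lambda>\<omega>. V \<omega> * Z r \<omega> $ i)" for i
    using gspan_prod_integrable[OF V gspan_Z[OF r, of "axis i 1"]] by (simp add: inner_axis')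
  then have "(\<integral>\<omega>. (\<Sum>i\<in>UNIV. x $ i * (V \<omega> * Z r \<omega> $ i)) \<partial>M) = (\<Sum>i\<in>UNIV. x $ i * (\<integral>\<omega>. V \<omega> * Z r \<omega> $ i \<partial>M))"
    by (subst Bochner_Integration.integral_sum) auto
  then show ?thesis
    by (simp add: inner_vec_def cov_def sum_distrib_left mult.left_commute)
qed

lemma inner_cov_diff:
  assumes V: "V \<in> gspan" and r: "0 \<le> r" "0 \<le> s"
  shows "x \<bullet> (cov V r - cov V s) = (\<integral>\<omega>. V \<omega> * (x \<bullet> (Z r \<omega> - Z s \<omega>)) \<partial>M)"
proof -
  have "(\<integral>\<omega>. V \<omega> * (x \<bullet> (Z r \<omega> - Z s \<omega>)) \<partial>M) = (\<integral>\<omega>. V \<omega> * (x \<bullet> Z r \<omega>) - V \<omega> * (x \<bullet> Z s \<omega>) \<partial>M)"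
    by (simp add: inner_diff_right right_diff_distrib)
  also have "\<dots> = x \<bullet> cov V r - x \<bullet> cov V s"
    using assms by (simp add: inner_cov gspan_prod_integrable gspan_Z)
  finally show ?thesis by (simp add: inner_diff_right)
qed

text \<open>The Cauchy-Schwarz inequality bounds the change of \<open>cov V\<close> by the variance
  of an increment of \<open>Z\<close>, which tends to 0 by mean-square continuity.\<close>

lemma cov_continuous:
  assumes V: "V \<in> gspan"
  shows "continuous_on {0..} (cov V)"
  unfolding continuous_on_sequentially
proof (intro allI ballI impI)
  fix t :: "nat \<Rightarrow> real" and s assume s: "s \<in> {0..}" and t: "(\<forall>n. t n \<in> {0..}) \<and> t \<longlonglongrightarrow> s"
  have "(\<lambda>n. cov V (t n) $ i) \<longlonglongrightarrow> cov V s $ i" for i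
  proof -
    let ?a = "axis i 1 :: real ^ 'd"
    let ?f = "\<lambda>n. \<integral>\<omega>. (?a \<bullet> (Z (t n) \<omega> - Z s \<omega>))\<^sup>2 \<partial>M"
    have "(\<lambda>n. (\<integral>\<omega>. (V \<omega>)\<^sup>2 \<partial>M) * ?f n) \<longlonglongrightarrow> (\<integral>\<omega>. (V \<omega>)\<^sup>2 \<partial>M) * 0"
      using s t by (intro tendsto_intros gspan_incr_square_tendsto) auto
    then have 1: "(\<lambda>n. (\<integral>\<omega>. (V \<omega>)\<^sup>2 \<partial>M) * ?f n) \<longlonglongrightarrow> 0" by simp
    have "(\<lambda>n. (?a \<bullet> (cov V (t n) - cov V s))\<^sup>2) \<longlonglongrightarrow> 0"
    proof (rule tendsto_sandwich[OF _ _ tendsto_const 1])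
      show "\<forall>\<^sub>F n in sequentially. (?a \<bullet> (cov V (t n) - cov V s))\<^sup>2 \<le> (\<integral>\<omega>. (V \<omega>)\<^sup>2 \<partial>M) * ?f n"
        using s t V by (intro always_eventually allI, subst inner_cov_diff)
          (auto intro!: gspan_cauchy_schwarz gspan_incr)
    qed simp
    from tendsto_real_sqrt[OF this] have "(\<lambda>n. ?a \<bullet> (cov V (t n) - cov V s)) \<longlonglongrightarrow> 0"
      by (simp add: tendsto_rabs_zero_iff)
    then show ?thesis
      by (subst LIM_zero_iff[symmetric]) (simp add: inner_axis')
  qed
  then show "(cov V \<circ> t) \<longlonglongrightarrow> cov V s"
    by (intro vec_tendstoI) (simp add: comp_def)
qed

end

context independent_sde
begin

text \<open>The threshold 2/3 is the one beyond which three events of that mass must have a common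
  outcome: \<open>X\<close> in the ball at both ends of an interval, and a small residual in
  between.\<close>

lemma X0_tight: "\<exists>\<rho>>0. 2/3 < measure M {\<omega>\<in>space M. X 0 \<omega> \<in> cball 0 \<rho>}"
proof -
  have "(\<lambda>n. measure M {\<omega>\<in>space M. X 0 \<omega> \<in> cball 0 (real n)}) \<longlonglongrightarrow> measure M (\<Union>n. {\<omega>\<in>space M. X 0 \<omega> \<in> cball 0 (real n)})"
    by (rule finite_Lim_measure_incseq) (auto simp: incseq_def)
  moreover have "(\<Union>n. {\<omega>\<in>space M. X 0 \<omega> \<in> cball 0 (real n)}) = space M"
    using real_arch_simple by auto
  ultimately have "(\<lambda>n. measure M {\<omega>\<in>space M. X 0 \<omega> \<in> cball 0 (real n)}) \<longlonglongrightarrow> 1"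
    by (simp add: prob_space)
  then have "\<forall>\<^sub>F n in sequentially. 2/3 < measure M {\<omega>\<in>space M. X 0 \<omega> \<in> cball 0 (real n)}"
    by (rule order_tendstoD) simp
  with eventually_gt_at_top[of 0] have "\<forall>\<^sub>F n::nat in sequentially. 0 < n \<and> 2/3 < measure M {\<omega>\<in>space M. X 0 \<omega> \<in> cball 0 (real n)}"
    by eventually_elim simp
  then obtain n :: nat where "0 < n" "2/3 < measure M {\<omega>\<in>space M. X 0 \<omega> \<in> cball 0 (real n)}"
    using eventually_happens'[OF sequentially_bot] by blast
  then show ?thesis by (intro exI[of _ "real n"]) auto
qed

text \<open>
  In the proof, \<open>d\<close> is the normalised covariance of \<open>V\<close> with the increments of \<open>Z\<close> after \<open>s\<close>, \<open>t\<close>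
  maximises \<open>|d|\<close> on \<open>[0, \<delta>]\<close>, and conditioning on \<open>V \<approx> l\<close> is done through the weight \<open>w (V)\<close>, with
  \<open>l |d t| = 2 \<rho> + 3\<close> exceeding the diameter of the ball of radius \<open>\<rho>\<close>.
\<close>

lemma cov_locally_constant:
  assumes s: "0 \<le> s" "s < h" and u: "h \<le> u"
    and V: "V = (\<lambda>\<omega>. \<theta> \<bullet> (Z u \<omega> - Z h \<omega>))" and var: "(\<integral>\<omega>. (V \<omega>)\<^sup>2 \<partial>M) \<noteq> 0"
  shows "\<exists>\<delta>>0. \<forall>q. 0 \<le> q \<and> q \<le> \<delta> \<longrightarrow> cov V (s + q) = cov V s"
proof -
  have Vg: "V \<in> gspan" unfolding V using s u by (intro gspan_incr) auto
  note [measurable] = gspan_measurable[OF Vg]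
  define \<sigma>2 where "\<sigma>2 = (\<integral>\<omega>. (V \<omega>)\<^sup>2 \<partial>M)"
  have \<sigma>2: "\<sigma>2 > 0" using var by (simp add: \<sigma>2_def less_le)
  \<comment> \<open>Gaussian regression of the increments after \<open>s\<close> on
    \<open>V\<close>: the residual \<open>R q\<close> is uncorrelated with \<open>V\<close> by
    \<open>Rcov\<close>, hence independent of it.\<close>
  define d where "d q = (cov V (s + q) - cov V s) /\<^sub>R \<sigma>2" for q
  define R where "R q \<omega> = (Z (s + q) \<omega> - Z s \<omega>) - V \<omega> *\<^sub>R d q" for q \<omega>
  have d0: "d 0 = 0" by (simp add: d_def)
  have dcont: "continuous_on {0..} d"
    unfolding d_def using s by (intro continuous_intros continuous_on_compose2[OF cov_continuous[OF Vg]]) auto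
  have Rcont: "continuous_on {0..} (\<lambda>q. R q \<omega>)" if "\<omega> \<in> space M" for \<omega>
    unfolding R_def using s that
    by (intro continuous_intros dcont continuous_on_compose2[OF Z_path[OF that]]) auto
  have Rm[measurable]: "R q \<in> borel_measurable M" if "0 \<le> q" for q
  proof -
    have [measurable]: "Z (s + q) \<in> borel_measurable M" "Z s \<in> borel_measurable M"
      using that s by (auto intro: Z_measurable)
    show ?thesis unfolding R_def[abs_def] by measurable
  qed
  have Rspan: "(\<lambda>\<omega>. x \<bullet> R q \<omega>) \<in> gspan" if "0 \<le> q" for x q
  proof -
    have "(\<lambda>\<omega>. x \<bullet> (Z (s + q) \<omega> - Z s \<omega>) - (x \<bullet> d q) * V \<omega>) \<in> gspan"
      using that s by (intro gspan_diff gspan_incr gspan_scale Vg) auto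
    then show ?thesis by (simp add: R_def inner_diff_right mult.commute)
  qed
  have Rcov: "(\<integral>\<omega>. V \<omega> * (x \<bullet> R q \<omega>) \<partial>M) = 0" if q: "0 \<le> q" for x q
  proof -
    have "(\<integral>\<omega>. V \<omega> * (x \<bullet> R q \<omega>) \<partial>M) = (\<integral>\<omega>. V \<omega> * (x \<bullet> (Z (s + q) \<omega> - Z s \<omega>)) - (x \<bullet> d q) * (V \<omega>)\<^sup>2 \<partial>M)"
      by (intro Bochner_Integration.integral_cong) (auto simp: R_def inner_diff_right algebra_simps power2_eq_square)
    also have "\<dots> = (\<integral>\<omega>. V \<omega> * (x \<bullet> (Z (s + q) \<omega> - Z s \<omega>)) \<partial>M) - (x \<bullet> d q) * \<sigma>2"
      unfolding \<sigma>2_def using q s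
      by (subst Bochner_Integration.integral_diff)
        (auto intro!: gspan_prod_integrable gspan_incr Vg gspan_square_integrable)
    also have "\<dots> = 0"
      using inner_cov_diff[OF Vg, of "s + q" s x] q s \<sigma>2 by (simp add: d_def)
    finally show ?thesis .
  qed
  obtain \<rho> where \<rho>: "\<rho> > 0" "2/3 < measure M {\<omega>\<in>space M. X 0 \<omega> \<in> cball 0 \<rho>}"
    using X0_tight by blast
  \<comment> \<open>\<open>K\<close> bounds the driving part on whatever interval is chosen later:
    1/2 from \<open>R\<close>, and \<open>(l + 1) * norm (d t) \<le> 2 * \<rho> + 3 + 1/4\<close>
    from \<open>V\<close>. Hence \<open>B\<close> can be fixed before the interval.\<close>
  define K where "K = 2 * \<rho> + 4"
  have "compact (b ` cball 0 (\<rho> + K + 1))"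
    by (intro compact_continuous_image continuous_on_subset[OF b]) auto
  then have "bounded (b ` cball 0 (\<rho> + K + 1))" by (rule compact_imp_bounded)
  then obtain B where "0 < B" "\<forall>y\<in>b ` cball 0 (\<rho> + K + 1). norm y \<le> B"
    unfolding bounded_pos by blast
  then have B: "0 < B" "\<And>y. norm y \<le> \<rho> + K + 1 \<Longrightarrow> norm (b y) \<le> B"
    by simp_all
  define \<epsilon> where "\<epsilon> n = inverse (real (Suc n))" for n
  have \<epsilon>0: "0 < \<epsilon> n" for n by (simp add: \<epsilon>_def)
  \<comment> \<open>Smallness is required at all times of the interval, because
    \<open>drift_bounded_path\<close> needs the driving part up to every intermediate time. The
    events grow to the whole space, since \<open>R 0\<close> vanishes and the paths of
    \<open>R\<close> are continuous.\<close>
  define A where "A n = {\<omega>\<in>space M. \<forall>q\<in>{0..\<epsilon> n}. norm (R q \<omega>) \<le> 1/2}" for n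
  \<comment> \<open>A countable dense set of times reduces \<open>A n\<close> to countably many
    conditions, both for its measurability and for its independence of \<open>V\<close>.\<close>
  have "\<forall>n. \<exists>T. countable T \<and> T \<noteq> {} \<and> T \<subseteq> {0..\<epsilon> n} \<and> {0..\<epsilon> n} \<subseteq> closure T"
  proof
    fix n
    obtain T where T: "countable T" "T \<subseteq> {0..\<epsilon> n}" "{0..\<epsilon> n} \<subseteq> closure T"
      by (rule separable[of "{0..\<epsilon> n}"])
    moreover have "T \<noteq> {}" using T(3) \<epsilon>0[of n] by auto
    ultimately show "\<exists>T. countable T \<and> T \<noteq> {} \<and> T \<subseteq> {0..\<epsilon> n} \<and> {0..\<epsilon> n} \<subseteq> closure T"
      by blast
  qed
  from choice[OF this] obtain T where T': "\<forall>n. countable (T n) \<and> T n \<noteq> {} \<and> T n \<subseteq> {0..\<epsilon> n} \<and> {0..\<epsilon> n} \<subseteq> closure (T n)"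
    by blast
  then have T: "countable (T n)" "T n \<noteq> {}" "T n \<subseteq> {0..\<epsilon> n}"
    "{0..\<epsilon> n} \<subseteq> closure (T n)" for n by blast+
  define e where "e n = from_nat_into (T n)" for n
  have e: "range (e n) = T n" for n using T by (simp add: e_def range_from_nat_into)
  have e0: "0 \<le> e n k" for n k using rangeI[of "e n" k] T(3)[of n] unfolding e by auto
  have A_eq: "A n = {\<omega>\<in>space M. \<forall>k. norm (R (e n k) \<omega>) \<le> 1/2}" for n
  proof -
    have cl: "closure (T n) = {0..\<epsilon> n}"
      using T(3,4)[of n] closure_minimal[OF T(3)] by auto
    have "(\<forall>q\<in>{0..\<epsilon> n}. norm (R q \<omega>) \<le> 1/2) \<longleftrightarrow> (\<forall>q\<in>T n. norm (R q \<omega>) \<le> 1/2)"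
      if "\<omega> \<in> space M" for \<omega>
    proof
      assume *: "\<forall>q\<in>T n. norm (R q \<omega>) \<le> 1/2"
      show "\<forall>q\<in>{0..\<epsilon> n}. norm (R q \<omega>) \<le> 1/2"
        using continuous_on_closure_norm_le[of "T n" "\<lambda>q. R q \<omega>" "1/2"] * cl
          continuous_on_subset[OF Rcont[OF that], of "closure (T n)"] by auto
    qed (use T(3) in auto)
    moreover have "(\<forall>q\<in>T n. norm (R q \<omega>) \<le> 1/2) \<longleftrightarrow> (\<forall>k. norm (R (e n k) \<omega>) \<le> 1/2)" for \<omega>
      unfolding e[of n, symmetric] by auto
    ultimately show ?thesis by (auto simp: A_def)
  qed
  have Am[measurable]: "A n \<in> sets M" for n unfolding A_eq using e0 by measurable
  have "incseq A"
  proof (intro incseq_SucI subsetI)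
    fix n \<omega> assume "\<omega> \<in> A n"
    moreover have "\<epsilon> (Suc n) \<le> \<epsilon> n" unfolding \<epsilon>_def by (intro le_imp_inverse_le) auto
    then have "{0..\<epsilon> (Suc n)} \<subseteq> {0..\<epsilon> n}" by simp
    ultimately show "\<omega> \<in> A (Suc n)" unfolding A_def by blast
  qed
  have inv0: "(\<lambda>n. \<epsilon> n) \<longlonglongrightarrow> 0" unfolding \<epsilon>_def by (rule LIMSEQ_inverse_real_of_nat)
  have small: "\<forall>\<^sub>F n in sequentially. \<forall>q\<in>{0..\<epsilon> n}. norm (f q) \<le> c"
    if f: "continuous_on {0..} f" "f 0 = 0" and c: "0 < c" for f :: "real \<Rightarrow> real ^ 'b" and c :: real
  proof -
    have "\<exists>\<eta>>0. \<forall>x\<in>{0..}. dist x 0 < \<eta> \<longrightarrow> dist (f x) (f 0) < c"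
      using f(1)[unfolded continuous_on_iff, rule_format, of 0 c] c by auto
    then obtain \<eta> where \<eta>: "\<eta> > 0" "\<And>x. 0 \<le> x \<Longrightarrow> x < \<eta> \<Longrightarrow> norm (f x) < c"
      using f(2) by (auto simp: dist_real_def)
    have "\<forall>\<^sub>F n in sequentially. \<epsilon> n < \<eta>"
      using inv0 \<eta>(1) by (rule order_tendstoD)
    then show ?thesis by eventually_elim (use \<eta>(2) in \<open>force simp: less_imp_le\<close>)
  qed
  have "(\<Union>n. A n) = space M"
  proof (intro equalityI subsetI)
    fix \<omega> assume \<omega>: "\<omega> \<in> space M"
    have "\<forall>\<^sub>F n in sequentially. \<omega> \<in> A n"
      using small[OF Rcont[OF \<omega>], of "1/2"] \<omega> by (simp add: R_def d0 A_def)
    then show "\<omega> \<in> (\<Union>n. A n)" using eventually_happens'[OF sequentially_bot] by blast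
  qed (auto simp: A_def)
  then have "(\<lambda>n. measure M (A n)) \<longlonglongrightarrow> 1"
    using finite_Lim_measure_incseq[of A] \<open>incseq A\<close> by (simp add: prob_space image_subset_iff)
  then have "\<forall>\<^sub>F n in sequentially. 2/3 < measure M (A n)" by (rule order_tendstoD) simp
  moreover have "\<forall>\<^sub>F n in sequentially. \<epsilon> n < 1 / (2 * B)"
    using inv0 B(1) by (intro order_tendstoD) auto
  moreover have "\<forall>\<^sub>F n in sequentially. \<epsilon> n < h - s"
    using inv0 s by (intro order_tendstoD) auto
  moreover have "\<forall>\<^sub>F n in sequentially. \<forall>q\<in>{0..\<epsilon> n}. norm (d q) \<le> 1/4"
    by (rule small[OF dcont d0]) simp
  \<comment> \<open>The four bounds serve these ends: enough mass for the residual event; a drift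
    integral of at most 1/2; \<open>s + t\<close> before \<open>h\<close>, so that
    \<open>X (s + t)\<close> is still covered by \<open>X_indep_future\<close>; and an error of at
    most 1/4 in the displacement when \<open>V\<close> is off its level by less than 1.\<close>
  ultimately have "\<forall>\<^sub>F n in sequentially. 2/3 < measure M (A n) \<and> \<epsilon> n < 1 / (2 * B) \<and>
      \<epsilon> n < h - s \<and> (\<forall>q\<in>{0..\<epsilon> n}. norm (d q) \<le> 1/4)"
    by eventually_elim simp
  then obtain n where n: "2/3 < measure M (A n)" "\<epsilon> n < 1 / (2 * B)"
    "\<epsilon> n < h - s" "\<And>q. q \<in> {0..\<epsilon> n} \<Longrightarrow> norm (d q) \<le> 1/4"
    using eventually_happens'[OF sequentially_bot] by blast
  define \<delta> where "\<delta> = \<epsilon> n"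
  have \<delta>: "0 < \<delta>" "B * \<delta> < 1/2" "s + \<delta> < h" "\<And>q. 0 \<le> q \<Longrightarrow> q \<le> \<delta> \<Longrightarrow> norm (d q) \<le> 1/4"
    using n B(1) \<epsilon>0 by (auto simp: \<delta>_def field_simps)
  \<comment> \<open>Finitely many residuals are independent of \<open>V\<close> by
    \<open>gspan_indep_indicator\<close>; the finite products \<open>f k\<close> of their indicators
    converge to the indicator of \<open>A n\<close>.\<close>
  have A_indep: "(\<integral>\<omega>. w (V \<omega>) * indicator (A n) \<omega> \<partial>M) = (\<integral>\<omega>. w (V \<omega>) \<partial>M) * measure M (A n)"
    if w[measurable]: "w \<in> borel_measurable borel" and wb: "\<And>x. 0 \<le> w x" "\<And>x. w x \<le> (1::real)" for w
  proof -
    define f where "f k \<omega> = (\<Prod>j\<le>k. indicator (cball 0 (1/2)) (R (e n j) \<omega>) :: real)" for k \<omega>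
    have Re[measurable]: "R (e n j) \<in> borel_measurable M" for j using e0 by simp
    have [measurable]: "cball 0 (1/2) \<in> sets (borel :: (real ^ 'b) measure)" by simp
    have fm[measurable]: "f k \<in> borel_measurable M" for k unfolding f_def[abs_def] by measurable
    have f01: "0 \<le> f k \<omega>" "f k \<omega> \<le> 1" for k \<omega>
      unfolding f_def by (auto intro!: prod_nonneg prod_le_1 simp: indicator_def)
    have lim: "(\<lambda>k. f k \<omega>) \<longlonglongrightarrow> indicator (A n) \<omega>" if sp: "\<omega> \<in> space M" for \<omega>
    proof (cases "\<omega> \<in> A n")
      case True
      then have "f k \<omega> = 1" for k by (auto simp: f_def A_eq indicator_def intro!: prod.neutral)
      then show ?thesis using True by simp
    next
      case False
      then obtain k where k: "\<not> norm (R (e n k) \<omega>) \<le> 1/2" using sp by (auto simp: A_eq)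
      have "\<forall>\<^sub>F m in sequentially. f m \<omega> = 0"
        using eventually_ge_at_top[of k]
        by eventually_elim (use k in \<open>auto simp: f_def prod_zero_iff indicator_def\<close>)
      then show ?thesis using False by (simp add: tendsto_eventually)
    qed
    have eq: "(\<integral>\<omega>. w (V \<omega>) * f k \<omega> \<partial>M) = (\<integral>\<omega>. w (V \<omega>) \<partial>M) * (\<integral>\<omega>. f k \<omega> \<partial>M)" for k
      unfolding f_def using wb e0 by (intro gspan_indep_indicator Vg w Rspan Rcov) auto
    have "(\<lambda>k. \<integral>\<omega>. w (V \<omega>) * f k \<omega> \<partial>M) \<longlonglongrightarrow> (\<integral>\<omega>. w (V \<omega>) * indicator (A n) \<omega> \<partial>M)"
    proof (rule integral_dominated_convergence[where w="\<lambda>_. 1"])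
      show "AE \<omega> in M. (\<lambda>k. w (V \<omega>) * f k \<omega>) \<longlonglongrightarrow> w (V \<omega>) * indicator (A n) \<omega>"
        by (intro AE_I2 tendsto_intros lim)
      show "AE \<omega> in M. norm (w (V \<omega>) * f k \<omega>) \<le> 1" for k
        using wb f01 by (intro AE_I2) (auto simp: abs_mult intro!: mult_le_one)
    qed auto
    moreover have "(\<lambda>k. \<integral>\<omega>. f k \<omega> \<partial>M) \<longlonglongrightarrow> (\<integral>\<omega>. indicator (A n) \<omega> \<partial>M)"
      by (rule integral_dominated_convergence[where w="\<lambda>_. 1"]) (use lim f01 in auto)
    then have "(\<lambda>k. (\<integral>\<omega>. w (V \<omega>) \<partial>M) * (\<integral>\<omega>. f k \<omega> \<partial>M)) \<longlonglongrightarrow> (\<integral>\<omega>. w (V \<omega>) \<partial>M) * (\<integral>\<omega>. indicator (A n) \<omega> \<partial>M)"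
      by (intro tendsto_intros)
    ultimately show ?thesis unfolding eq by (auto dest: LIMSEQ_unique)
  qed
  have "d q = 0" if q: "0 \<le> q" "q \<le> \<delta>" for q
  proof (rule ccontr)
    assume "d q \<noteq> 0"
    have "continuous_on {0..\<delta>} (\<lambda>q. norm (d q))"
      by (intro continuous_intros continuous_on_subset[OF dcont]) auto
    then obtain t where t: "0 \<le> t" "t \<le> \<delta>" "\<And>q. 0 \<le> q \<Longrightarrow> q \<le> \<delta> \<Longrightarrow> norm (d q) \<le> norm (d t)"
      using continuous_attains_sup[of "{0..\<delta>}" "\<lambda>q. norm (d q)"] \<delta>(1) by fastforce
    have dt: "0 < norm (d t)" using t(3)[OF q] \<open>d q \<noteq> 0\<close> by (smt (verit) zero_less_norm_iff)
    define l where "l = (2 * \<rho> + 3) / norm (d t)"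
    have l: "l * norm (d t) = 2 * \<rho> + 3" "0 < l" using dt \<rho>(1) by (auto simp: l_def)
    define w where "w x = max 0 (1 - \<bar>x - l\<bar>)" for x :: real
    have wc: "continuous_on UNIV w" unfolding w_def by (intro continuous_intros)
    then have wm[measurable]: "w \<in> borel_measurable borel" by (rule borel_measurable_continuous_onI)
    have w01: "0 \<le> w x" "w x \<le> 1" "\<bar>w x\<bar> \<le> 1" for x by (auto simp: w_def)
    define E where "E = (\<integral>\<omega>. w (V \<omega>) \<partial>M)"
    have wi: "integrable M (\<lambda>\<omega>. w (V \<omega>))" using w01 by (auto intro!: integrable_const_bound[where B=1])
    \<comment> \<open>On \<open>S\<close> the weight is at least 1/2, so the positive mass of this
      interval under the Gaussian law of \<open>V\<close> gives \<open>E > 0\<close>.\<close>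
    define S where "S = {\<omega>\<in>space M. l - 1/2 < V \<omega> \<and> V \<omega> < l + 1/2}"
    have [measurable]: "S \<in> sets M" unfolding S_def by measurable
    have Sw: "indicator S \<omega> \<le> 2 * w (V \<omega>)" for \<omega>
    proof (cases "\<omega> \<in> S")
      case True
      then have "l - 1/2 < V \<omega>" "V \<omega> < l + 1/2" by (simp_all add: S_def)
      then have "\<bar>V \<omega> - l\<bar> \<le> 1/2" by linarith
      then show ?thesis using True by (simp add: w_def)
    qed (use w01(1) in simp)
    have "0 < measure M S"
      using centered_gaussian_interval_pos[OF gspan_gaussian[OF Vg] gspan_mean[OF Vg] var] by (simp add: S_def)
    also have "\<dots> = (\<integral>\<omega>. indicator S \<omega> \<partial>M)" by simp
    also have "\<dots> \<le> (\<integral>\<omega>. 2 * w (V \<omega>) \<partial>M)"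
      using wi Sw by (intro integral_mono) (auto simp: integrable_indicator_iff emeasure_eq_measure)
    finally have E: "0 < E" by (simp add: E_def)
    define p where "p = measure M {\<omega>\<in>space M. X 0 \<omega> \<in> cball 0 \<rho>}"
    define H where "H r \<omega> = indicator (cball 0 \<rho>) (X r \<omega>) * w (V \<omega>)" for r \<omega>
    have ind: "(\<integral>\<omega>. H r \<omega> \<partial>M) = p * E"
      if "0 \<le> r" "r \<le> h" for r
      unfolding E_def p_def H_def V using that u by (intro X_indep_future wc w01) auto
    \<comment> \<open>If this failed, all three terms would equal \<open>w (V \<omega>) > 0\<close>.
      Then \<open>X\<close> would start and end in the ball and move by at most
      \<open>2 * \<rho>\<close>, whereas \<open>V\<close> pushes it by at least
      \<open>2 * \<rho> + 3 - 1/4\<close> and drift and residual make up for at most 1 of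
      that.\<close>
    have key: "H s \<omega> + H (s + t) \<omega> + w (V \<omega>) * indicator (A n) \<omega> \<le> 2 * w (V \<omega>)"
      if \<omega>: "\<omega> \<in> space M" for \<omega>
    proof (rule ccontr)
      assume c: "\<not> ?thesis"
      have "norm (X s \<omega>) \<le> \<rho> \<and> norm (X (s + t) \<omega>) \<le> \<rho> \<and> \<omega> \<in> A n \<and> w (V \<omega>) \<noteq> 0"
        using c w01(1)[of "V \<omega>"] unfolding H_def
        by (cases "norm (X s \<omega>) \<le> \<rho>"; cases "norm (X (s + t) \<omega>) \<le> \<rho>"; cases "\<omega> \<in> A n") auto
      then have X: "norm (X s \<omega>) \<le> \<rho>" "norm (X (s + t) \<omega>) \<le> \<rho>" and Vl: "\<bar>V \<omega> - l\<bar> < 1"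
        and Rb: "\<And>q. 0 \<le> q \<Longrightarrow> q \<le> \<delta> \<Longrightarrow> norm (R q \<omega>) \<le> 1/2"
        by (auto simp: w_def A_def \<delta>_def max_def split: if_splits)
      have incr: "X (s + r) \<omega> - X s \<omega> - integral {0..r} (\<lambda>q. b (X (s + q) \<omega>)) = R r \<omega> + V \<omega> *\<^sub>R d r" if "0 \<le> r" for r
        using Z_increment[OF \<omega> s(1) that] by (simp add: R_def)
      have Vd: "norm (V \<omega> *\<^sub>R d r) \<le> 2 * \<rho> + 3 + 1/4" if "0 \<le> r" "r \<le> \<delta>" for r
      proof -
        have "norm (V \<omega> *\<^sub>R d r) \<le> (l + 1) * norm (d t)"
          unfolding norm_scaleR using Vl l t(3)[OF that] by (intro mult_mono) auto
        also have "\<dots> \<le> 2 * \<rho> + 3 + 1/4" using l \<delta>(4)[OF t(1,2)] by (simp add: algebra_simps)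
        finally show ?thesis .
      qed
      have "norm (integral {0..t} (\<lambda>q. b (X (s + q) \<omega>))) \<le> 1/2"
      proof (rule drift_bounded_path[where x="\<lambda>q. X (s + q) \<omega>" and b=b and r=t and t=t and \<rho>=\<rho> and K=K and B=B])
        show "continuous_on {0..t} (\<lambda>q. X (s + q) \<omega>)"
          using s by (intro continuous_on_compose2[OF X_continuous[OF \<omega>]] continuous_intros) auto
        show "norm (X (s + r) \<omega> - X (s + 0) \<omega> - integral {0..r} (\<lambda>q. b (X (s + q) \<omega>))) \<le> K" if "0 \<le> r" "r \<le> t" for r
          using incr[OF that(1)] norm_triangle_ineq[of "R r \<omega>" "V \<omega> *\<^sub>R d r"] Rb[of r] Vd[of r] that t by (simp add: K_def)
        have "B * t \<le> B * \<delta>" using t B(1) by simp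
        then show "B * t \<le> 1/2" using \<delta>(2) by simp
      qed (use X B b t in auto)
      moreover have "norm (V \<omega> *\<^sub>R d t) \<le> norm (X (s + t) \<omega>) + norm (X s \<omega>) + norm (integral {0..t} (\<lambda>q. b (X (s + q) \<omega>))) + norm (R t \<omega>)"
      proof -
        have eqV: "V \<omega> *\<^sub>R d t = (X (s + t) \<omega> - X s \<omega>) - integral {0..t} (\<lambda>q. b (X (s + q) \<omega>)) - R t \<omega>"
          using incr[OF t(1)] by simp
        show ?thesis
          unfolding eqV
          using norm_triangle_ineq4[of "(X (s + t) \<omega> - X s \<omega>) - integral {0..t} (\<lambda>q. b (X (s + q) \<omega>))" "R t \<omega>"]
            norm_triangle_ineq4[of "X (s + t) \<omega> - X s \<omega>" "integral {0..t} (\<lambda>q. b (X (s + q) \<omega>))"]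
            norm_triangle_ineq4[of "X (s + t) \<omega>" "X s \<omega>"] by linarith
      qed
      moreover have "norm (V \<omega> *\<^sub>R d t) \<ge> (l - 1) * norm (d t)"
        unfolding norm_scaleR using Vl by (intro mult_right_mono) auto
      moreover have "(l - 1) * norm (d t) \<ge> 2 * \<rho> + 3 - 1/4"
        using l \<delta>(4)[OF t(1,2)] by (simp add: algebra_simps)
      ultimately show False using X Rb[OF t(1,2)] by linarith
    qed
    have [measurable]: "cball 0 \<rho> \<in> sets (borel :: (real ^ 'b) measure)" by simp
    have i: "integrable M (H r)" if "0 \<le> r" for r
    proof -
      note [measurable] = X_measurable[OF that]
      show ?thesis unfolding H_def[abs_def]
        using w01 by (intro integrable_const_bound[where B=1]) (auto simp: abs_mult intro!: mult_le_one)
    qed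
    have iA: "integrable M (\<lambda>\<omega>. w (V \<omega>) * indicator (A n) \<omega>)"
      using w01 by (intro integrable_const_bound[where B=1]) (auto simp: abs_mult intro!: mult_le_one)
    \<comment> \<open>Integrated, \<open>key\<close> says that three masses relative to
      \<open>E\<close>, each above 2/3, have sum at most 2.\<close>
    have "(\<integral>\<omega>. H s \<omega> + H (s + t) \<omega> + w (V \<omega>) * indicator (A n) \<omega> \<partial>M) \<le> (\<integral>\<omega>. 2 * w (V \<omega>) \<partial>M)"
      using key i iA wi s t by (intro integral_mono) auto
    then have "p * E + p * E + E * measure M (A n) \<le> 2 * E"
      using i[of s] i[of "s + t"] iA ind[of s] ind[of "s + t"] s t \<delta>(3) A_indep[OF wm w01(1,2)]
      by (simp add: E_def[symmetric])
    then have "E * (2 * p + measure M (A n)) \<le> E * 2"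
      by (simp add: algebra_simps)
    then have "2 * p + measure M (A n) \<le> 2"
      using E by (simp only: mult_le_cancel_left_pos)
    then show False using n(1) \<rho>(2) by (simp add: p_def)
  qed
  then have "cov V (s + q) = cov V s" if "0 \<le> q" "q \<le> \<delta>" for q
    using that \<sigma>2 by (auto simp: d_def)
  then show ?thesis using \<delta>(1) by blast
qed

text \<open>By \<open>cov_locally_constant\<close> and continuity, \<open>cov V\<close> keeps up to
  time \<open>h\<close> its value at time 0, which vanishes because \<open>Z 0\<close> does. A
  degenerate \<open>V\<close> has no levels to condition on and is handled by the Cauchy-Schwarz
  inequality.\<close>

theorem uncorrelated_increments:
  assumes r: "0 \<le> r" "r \<le> h" and u: "h \<le> u"
  shows "(\<integral>\<omega>. (\<theta> \<bullet> (Z u \<omega> - Z h \<omega>)) * (x \<bullet> Z r \<omega>) \<partial>M) = 0"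
proof -
  define V where "V = (\<lambda>\<omega>. \<theta> \<bullet> (Z u \<omega> - Z h \<omega>))"
  have Vg: "V \<in> gspan" unfolding V_def using r u by (intro gspan_incr) auto
  show ?thesis
  proof (cases "(\<integral>\<omega>. (V \<omega>)\<^sup>2 \<partial>M) = 0")
    case True
    then show ?thesis
      using gspan_cauchy_schwarz[OF Vg gspan_Z[OF r(1), of x]] by (simp add: V_def)
  next
    case False
    have "cov V r = cov V 0"
      using cov_locally_constant[OF _ _ u V_def False] r
      by (intro locally_constant_right[of h]) (auto intro: continuous_on_subset[OF cov_continuous[OF Vg]])
    also have "\<dots> = 0" by (simp add: cov_def Z_0 vec_eq_iff)
    finally show ?thesis using inner_cov[OF Vg r(1), of x] by (simp add: V_def)
  qed
qed

end

section \<open>Gaussian processes with uncorrelated increments\<close>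

lemma chain_mono:
  fixes t :: "nat \<Rightarrow> 'a::preorder"
  assumes "\<And>i. i < n \<Longrightarrow> t i \<le> t (Suc i)" and "i \<le> j" "j \<le> n"
  shows "t i \<le> t j"
  using assms(2,3)
proof (induction j)
  case (Suc j)
  then show ?case using assms(1)[of j] by (cases "i = Suc j") (auto intro: order_trans)
qed simp

text \<open>Setting all but one \<open>\<theta> i\<close> to 0 and using \<open>q 0 = 0\<close>
  gives the transform of a single increment; the joint formula is then the product of these. It
  serves both \<open>Z\<close>, with \<open>q\<close> its covariance form, and \<open>W\<close>,
  with \<open>q\<close> the squared norm.\<close>

lemma independent_increments_if_cis:
  fixes Y :: "('w, 'd::finite) process"
  assumes M: "prob_space M" and Y: "\<And>t. 0 \<le> t \<Longrightarrow> Y t \<in> borel_measurable M" and q: "q 0 = (0::real)"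
    and cis: "\<And>n t \<theta>. 0 \<le> t 0 \<Longrightarrow> (\<And>i. i < n \<Longrightarrow> t i \<le> t (Suc i)) \<Longrightarrow>
      (\<integral>\<omega>. cis (\<Sum>i<n. \<theta> i \<bullet> (Y (t (Suc i)) \<omega> - Y (t i) \<omega>)) \<partial>M) =
      complex_of_real (exp (- (\<Sum>i<n. (t (Suc i) - t i) * q (\<theta> i)) / 2))"
  shows "independent_increments M Y"
  unfolding independent_increments_def
proof (intro allI impI)
  interpret prob_space M by fact
  fix n and t :: "nat \<Rightarrow> real" assume t: "0 \<le> t 0 \<and> (\<forall>i<n. t i < t (Suc i))"
  then have pos: "0 \<le> t i" if "i \<le> n" for i
    using chain_mono[of n t 0 i] that by (force simp: less_imp_le)
  show "indep_vars (\<lambda>_. borel) (\<lambda>i \<omega>. Y (t (Suc i)) \<omega> - Y (t i) \<omega>) {..<n}"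
  proof (rule indep_vars_if_cis)
    show "(\<lambda>\<omega>. Y (t (Suc i)) \<omega> - Y (t i) \<omega>) \<in> borel_measurable M" if "i \<in> {..<n}" for i
      using that pos by (intro borel_measurable_diff Y) auto
    fix \<theta> :: "nat \<Rightarrow> real ^ 'd"
    have single: "(\<integral>\<omega>. cis (\<theta> i \<bullet> (Y (t (Suc i)) \<omega> - Y (t i) \<omega>)) \<partial>M) =
        complex_of_real (exp (- ((t (Suc i) - t i) * q (\<theta> i)) / 2))" if i: "i < n" for i
    proof -
      have 1: "(\<Sum>j<n. (if j = i then \<theta> i else 0) \<bullet> z j) = \<theta> i \<bullet> z i" for z :: "nat \<Rightarrow> real ^ 'd"
        using i by (subst sum.mono_neutral_cong_right[where S="{i}"]) auto
      have 2: "(\<Sum>j<n. (t (Suc j) - t j) * q (if j = i then \<theta> i else 0)) = (t (Suc i) - t i) * q (\<theta> i)"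
        using i q by (subst sum.mono_neutral_cong_right[where S="{i}"]) auto
      show ?thesis
        using cis[of t n "\<lambda>j. if j = i then \<theta> i else 0"] t unfolding 1 2 by (simp add: less_imp_le)
    qed
    have "(\<integral>\<omega>. cis (\<Sum>i<n. \<theta> i \<bullet> (Y (t (Suc i)) \<omega> - Y (t i) \<omega>)) \<partial>M) =
      complex_of_real (exp (\<Sum>i<n. - ((t (Suc i) - t i) * q (\<theta> i)) / 2))"
      using t by (subst cis) (auto simp: less_imp_le sum_negf sum_divide_distrib)
    also have "\<dots> = (\<Prod>i<n. complex_of_real (exp (- ((t (Suc i) - t i) * q (\<theta> i)) / 2)))"
      by (simp add: exp_sum)
    also have "\<dots> = (\<Prod>i<n. \<integral>\<omega>. cis (\<theta> i \<bullet> (Y (t (Suc i)) \<omega> - Y (t i) \<omega>)) \<partial>M)"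
      by (intro prod.cong refl single[symmetric]) simp
    finally show "(\<integral>\<omega>. cis (\<Sum>i<n. \<theta> i \<bullet> (Y (t (Suc i)) \<omega> - Y (t i) \<omega>)) \<partial>M) =
      (\<Prod>i<n. \<integral>\<omega>. cis (\<theta> i \<bullet> (Y (t (Suc i)) \<omega> - Y (t i) \<omega>)) \<partial>M)" .
  qed simp
qed

text \<open>The form may be degenerate, so a maximal orthonormal family replaces a basis. A residual
  \<open>y\<close> of positive length could be normalised and placed at a free index, against
  maximality; without a free index the family is a basis and \<open>y\<close> vanishes. Indices are
  taken from the coordinates so that the family can label the columns of a square matrix.\<close>

lemma psd_orthonormal_family:
  fixes S :: "real ^ 'd ^ 'd"
  assumes sym: "\<And>x y. x \<bullet> (S *v y) = y \<bullet> (S *v x)" and psd: "\<And>x. 0 \<le> x \<bullet> (S *v x)"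
  shows "\<exists>(I :: 'd set) a. (\<forall>i\<in>I. \<forall>j\<in>I. a i \<bullet> (S *v a j) = (if i = j then 1 else 0)) \<and>
    (\<forall>x y. y = x - (\<Sum>i\<in>I. (x \<bullet> (S *v a i)) *\<^sub>R a i) \<longrightarrow> y \<bullet> (S *v y) = 0)"
proof -
  define P where "P I a \<longleftrightarrow> (\<forall>i\<in>I. \<forall>j\<in>I. a i \<bullet> (S *v a j) = (if i = j then 1 else 0))"
    for I :: "'d set" and a :: "'d \<Rightarrow> real ^ 'd"
  have "{} \<in> {I. \<exists>a. P I a}" by (simp add: P_def)
  then obtain I where I: "\<exists>a. P I a" "\<And>I'. \<exists>a. P I' a \<Longrightarrow> I \<subseteq> I' \<Longrightarrow> I = I'"
    using finite_has_maximal[of "{I. \<exists>a. P I a}"] by auto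
  then obtain a where a: "P I a" by blast
  have on: "a i \<bullet> (S *v a j) = (if i = j then 1 else 0)" if "i \<in> I" "j \<in> I" for i j
    using a that by (simp add: P_def)
  have "y \<bullet> (S *v y) = 0" if y: "y = x - (\<Sum>i\<in>I. (x \<bullet> (S *v a i)) *\<^sub>R a i)" for x y
  proof (cases "I = UNIV")
    case True
    \<comment> \<open>The vectors equal to their expansion form a subspace that contains the family.
      Orthonormality makes the family independent, and it has as many members as there are
      coordinates, so this subspace is the whole space.\<close>
    define V where "V = {x. x = (\<Sum>i\<in>UNIV. (x \<bullet> (S *v a i)) *\<^sub>R a i)}"
    have "subspace V"
      unfolding subspace_def V_def
      by (auto simp: inner_add_left scaleR_add_left sum.distrib scaleR_sum_right[symmetric] simp flip: scaleR_scaleR)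
    moreover have "range a \<subseteq> V"
      using on True by (auto simp: V_def if_distrib[of "\<lambda>c. c *\<^sub>R _"] cong: if_cong)
    ultimately have sub: "span (range a) \<subseteq> V" by (intro span_minimal)
    have inj: "inj a"
    proof (rule injI, rule ccontr)
      fix i j assume "a i = a j" "i \<noteq> j"
      then show False using on[of i j] on[of j j] True by simp
    qed
    have "independent (range a)"
      unfolding dependent_def
    proof (clarify)
      fix j assume j: "a j \<in> span (range a - {a j})"
      have "range a - {a j} \<subseteq> {x. x \<bullet> (S *v a j) = 0}"
        using on True by auto
      moreover have "subspace {x. x \<bullet> (S *v a j) = 0}"
        by (auto simp: subspace_def inner_add_left)
      ultimately have "span (range a - {a j}) \<subseteq> {x. x \<bullet> (S *v a j) = 0}" by (rule span_minimal)
      then show False using j on[of j j] True by auto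
    qed
    then have "UNIV \<subseteq> span (range a)"
      using card_image[OF inj] by (intro card_ge_dim_independent) auto
    then have "x \<in> V" using sub by auto
    then have "y = 0" unfolding y True V_def by simp
    then show ?thesis by simp
  next
    case False
    then obtain k where k: "k \<notin> I" by auto
    have orth: "y \<bullet> (S *v a j) = 0" if j: "j \<in> I" for j
    proof -
      have "(\<Sum>i\<in>I. (x \<bullet> (S *v a i)) *\<^sub>R a i) \<bullet> (S *v a j) = (\<Sum>i\<in>I. if i = j then x \<bullet> (S *v a i) else 0)"
        unfolding inner_sum_left using on j by (intro sum.cong) auto
      then show ?thesis using j by (simp add: y inner_diff_left)
    qed
    show ?thesis
    proof (rule ccontr)
      assume "y \<bullet> (S *v y) \<noteq> 0"
      then have pos: "0 < y \<bullet> (S *v y)" using psd[of y] by simp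
      define c where "c = inverse (sqrt (y \<bullet> (S *v y)))"
      have c: "c * c * (y \<bullet> (S *v y)) = 1"
        using pos by (simp add: c_def field_simps)
      have "P (insert k I) (a(k := c *\<^sub>R y))"
        unfolding P_def using on orth k c sym[of "a _" y]
        by (auto simp: matrix_vector_mult_scaleR mult.assoc)
      then have "I = insert k I" by (intro I(2)) auto
      then show False using k by auto
    qed
  qed
  with on show ?thesis by (intro exI[of _ I] exI[of _ a]) blast
qed

text \<open>Collects what the Brownian representation uses of the noise; from here on the drift and
  the solution no longer appear.\<close>

locale gaussian_indep_increments = centered_gaussian_paths +
  assumes Z_start: "\<And>\<omega>. \<omega> \<in> space M \<Longrightarrow> Z 0 \<omega> = 0"
    and uncorrelated: "\<And>\<theta> x r h u. 0 \<le> r \<Longrightarrow> r \<le> h \<Longrightarrow> h \<le> u \<Longrightarrow>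
      (\<integral>\<omega>. (\<theta> \<bullet> (Z u \<omega> - Z h \<omega>)) * (x \<bullet> Z r \<omega>) \<partial>M) = 0"
    and stationary_variance: "\<And>\<theta> s t. 0 \<le> s \<Longrightarrow> 0 \<le> t \<Longrightarrow>
      (\<integral>\<omega>. (\<theta> \<bullet> (Z (s + t) \<omega> - Z s \<omega>))\<^sup>2 \<partial>M) = (\<integral>\<omega>. (\<theta> \<bullet> Z t \<omega>)\<^sup>2 \<partial>M)"
begin

definition var :: "real ^ 'b \<Rightarrow> real \<Rightarrow> real" where
  "var \<theta> t = (\<integral>\<omega>. (\<theta> \<bullet> Z t \<omega>)\<^sup>2 \<partial>M)"

lemma var_nonneg: "0 \<le> var \<theta> t"
  by (simp add: var_def)

lemma var_add: "0 \<le> s \<Longrightarrow> 0 \<le> t \<Longrightarrow> var \<theta> (s + t) = var \<theta> s + var \<theta> t"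
  using gspan_square_add[OF gspan_incr[of s "s + t" \<theta>] gspan_Z[of s \<theta>], of 1] uncorrelated[of s s "s + t" \<theta> \<theta>] stationary_variance[of s t \<theta>]
  by (simp add: var_def inner_diff_right)

lemma var_mult: "0 \<le> t \<Longrightarrow> var \<theta> (real n * t) = real n * var \<theta> t"
proof (induction n)
  case 0
  have "var \<theta> 0 = (\<integral>\<omega>. 0 \<partial>M)" unfolding var_def by (intro Bochner_Integration.integral_cong) (auto simp: Z_start)
  then show ?case by simp
next
  case (Suc n)
  then show ?case using var_add[of "real n * t" t \<theta>] by (simp add: algebra_simps)
qed

text \<open>Cauchy's functional equation with a monotone solution: \<open>var \<theta>\<close> is
  additive and nonnegative, hence increasing. Enclosing \<open>real (Suc n) * t\<close> between
  consecutive integers leaves an error of at most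
  \<open>var \<theta> 1 / real (Suc n)\<close>.\<close>

lemma var_linear:
  assumes t: "0 \<le> t"
  shows "var \<theta> t = t * var \<theta> 1"
proof -
  have mono: "var \<theta> s \<le> var \<theta> u" if "0 \<le> s" "s \<le> u" for s u
    using var_add[of s "u - s" \<theta>] var_nonneg[of \<theta> "u - s"] that by simp
  have "\<bar>var \<theta> t - t * var \<theta> 1\<bar> \<le> var \<theta> 1 / real (Suc n)" for n
  proof -
    define m where "m = nat \<lfloor>real (Suc n) * t\<rfloor>"
    have m: "real m \<le> real (Suc n) * t" "real (Suc n) * t \<le> real (Suc m)"
      using t by (auto simp: m_def) linarith+
    have "var \<theta> (real (Suc n) * t) = real (Suc n) * var \<theta> t" using t by (rule var_mult)
    moreover have "var \<theta> (real m) = real m * var \<theta> 1" "var \<theta> (real (Suc m)) = real (Suc m) * var \<theta> 1"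
      using var_mult[of 1 \<theta> m] var_mult[of 1 \<theta> "Suc m"] by simp_all
    ultimately have 1: "real m * var \<theta> 1 \<le> real (Suc n) * var \<theta> t" "real (Suc n) * var \<theta> t \<le> real (Suc m) * var \<theta> 1"
      using mono[of "real m" "real (Suc n) * t"] mono[of "real (Suc n) * t" "real (Suc m)"] m t by (simp_all del: of_nat_Suc)
    have 2: "real m * var \<theta> 1 \<le> real (Suc n) * t * var \<theta> 1" "real (Suc n) * t * var \<theta> 1 \<le> real (Suc m) * var \<theta> 1"
      using m var_nonneg[of \<theta> 1] by (auto intro!: mult_right_mono simp del: of_nat_Suc)
    have "real (Suc m) * var \<theta> 1 = real m * var \<theta> 1 + var \<theta> 1" by (simp add: algebra_simps)
    then have "\<bar>real (Suc n) * var \<theta> t - real (Suc n) * t * var \<theta> 1\<bar> \<le> var \<theta> 1"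
      using 1 2 unfolding abs_le_iff by linarith
    then have "real (Suc n) * \<bar>var \<theta> t - t * var \<theta> 1\<bar> \<le> var \<theta> 1"
      by (simp only: mult.assoc right_diff_distrib[symmetric] abs_mult abs_of_nat)
    then show ?thesis by (simp add: field_simps del: of_nat_Suc)
  qed
  moreover have "(\<lambda>n. var \<theta> 1 / real (Suc n)) \<longlonglongrightarrow> 0"
    by (rule LIMSEQ_Suc[OF lim_const_over_n])
  ultimately have "\<bar>var \<theta> t - t * var \<theta> 1\<bar> \<le> 0"
    by (intro LIMSEQ_le_const) auto
  then show ?thesis by simp
qed

text \<open>A later increment is uncorrelated with \<open>Z\<close> at both ends of an earlier
  interval, so the cross terms vanish and the variances, linear in the length of the interval, add
  up.\<close>

lemma increments_square:
  fixes \<theta> :: "nat \<Rightarrow> real ^ 'b"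
  assumes t: "0 \<le> t 0" "\<And>i. i < n \<Longrightarrow> t i \<le> t (Suc i)"
  shows "(\<lambda>\<omega>. \<Sum>i<n. \<theta> i \<bullet> (Z (t (Suc i)) \<omega> - Z (t i) \<omega>)) \<in> gspan"
    and "(\<integral>\<omega>. (\<Sum>i<n. \<theta> i \<bullet> (Z (t (Suc i)) \<omega> - Z (t i) \<omega>))\<^sup>2 \<partial>M) = (\<Sum>i<n. (t (Suc i) - t i) * var (\<theta> i) 1)"
proof -
  define D where "D i \<omega> = \<theta> i \<bullet> (Z (t (Suc i)) \<omega> - Z (t i) \<omega>)" for i \<omega>
  note mono = chain_mono[of n t, OF t(2)]
  have pos: "0 \<le> t i" if "i \<le> n" for i using mono[of 0 i] t that by auto
  have D: "D i \<in> gspan" if "i < n" for i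
    unfolding D_def[abs_def] using that pos by (intro gspan_incr) auto
  have D2: "(\<integral>\<omega>. (D i \<omega>)\<^sup>2 \<partial>M) = (t (Suc i) - t i) * var (\<theta> i) 1" if i: "i < n" for i
    using stationary_variance[of "t i" "t (Suc i) - t i" "\<theta> i"] var_linear[of "t (Suc i) - t i" "\<theta> i"] pos[of i] t(2)[OF i] i
    by (simp add: D_def var_def)
  have cross: "(\<integral>\<omega>. D j \<omega> * D i \<omega> \<partial>M) = 0" if "i < j" "j < n" for i j
  proof -
    have ti: "0 \<le> t i" "0 \<le> t (Suc i)" "t (Suc i) \<le> t j" "t i \<le> t j" "t j \<le> t (Suc j)" "0 \<le> t j" "0 \<le> t (Suc j)"
      using that by (auto intro: pos mono)
    have "(\<integral>\<omega>. D j \<omega> * D i \<omega> \<partial>M) = (\<integral>\<omega>. D j \<omega> * (\<theta> i \<bullet> Z (t (Suc i)) \<omega>) - D j \<omega> * (\<theta> i \<bullet> Z (t i) \<omega>) \<partial>M)"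
      by (simp add: D_def inner_diff_right right_diff_distrib)
    also have "\<dots> = (\<integral>\<omega>. D j \<omega> * (\<theta> i \<bullet> Z (t (Suc i)) \<omega>) \<partial>M) - (\<integral>\<omega>. D j \<omega> * (\<theta> i \<bullet> Z (t i) \<omega>) \<partial>M)"
      using D[OF that(2)] ti by (intro Bochner_Integration.integral_diff gspan_prod_integrable gspan_Z)
    also have "\<dots> = 0" unfolding D_def using ti by (simp add: uncorrelated)
    finally show ?thesis .
  qed
  have "(\<lambda>\<omega>. \<Sum>i<m. D i \<omega>) \<in> gspan \<and> (\<integral>\<omega>. (\<Sum>i<m. D i \<omega>)\<^sup>2 \<partial>M) = (\<Sum>i<m. (t (Suc i) - t i) * var (\<theta> i) 1)" if "m \<le> n" for m
    using that
  proof (induction m)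
    case 0
    show ?case using gspan_sum[of "{}" "\<lambda>_ _. 0"] by simp
  next
    case (Suc m)
    then have S: "(\<lambda>\<omega>. \<Sum>i<m. D i \<omega>) \<in> gspan" by simp
    have "(\<integral>\<omega>. D m \<omega> * (\<Sum>i<m. D i \<omega>) \<partial>M) = (\<Sum>i<m. \<integral>\<omega>. D m \<omega> * D i \<omega> \<partial>M)"
      unfolding sum_distrib_left using Suc.prems
      by (intro Bochner_Integration.integral_sum gspan_prod_integrable D) auto
    also have "\<dots> = 0" using Suc.prems by (intro sum.neutral ballI cross) auto
    finally have c: "(\<integral>\<omega>. D m \<omega> * (\<Sum>i<m. D i \<omega>) \<partial>M) = 0" .
    then show ?case
      using gspan_square_add[OF D S, of m 1] D2[of m] Suc gspan_add[OF S D, of m]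
      by (simp add: add.commute)
  qed
  then show "(\<lambda>\<omega>. \<Sum>i<n. \<theta> i \<bullet> (Z (t (Suc i)) \<omega> - Z (t i) \<omega>)) \<in> gspan"
    "(\<integral>\<omega>. (\<Sum>i<n. \<theta> i \<bullet> (Z (t (Suc i)) \<omega> - Z (t i) \<omega>))\<^sup>2 \<partial>M) = (\<Sum>i<n. (t (Suc i) - t i) * var (\<theta> i) 1)"
    unfolding D_def by auto
qed

lemma increments_cis:
  fixes \<theta> :: "nat \<Rightarrow> real ^ 'b"
  assumes t: "0 \<le> t 0" "\<And>i. i < n \<Longrightarrow> t i \<le> t (Suc i)"
  shows "(\<integral>\<omega>. cis (\<Sum>i<n. \<theta> i \<bullet> (Z (t (Suc i)) \<omega> - Z (t i) \<omega>)) \<partial>M) =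
      complex_of_real (exp (- (\<Sum>i<n. (t (Suc i) - t i) * var (\<theta> i) 1) / 2))"
  using increments_square[of t n \<theta>] t gspan_cis by simp

definition covmat :: "real ^ 'b ^ 'b" where
  "covmat = (\<chi> i j. \<integral>\<omega>. Z 1 \<omega> $ i * Z 1 \<omega> $ j \<partial>M)"

lemma inner_covmat: "x \<bullet> (covmat *v y) = (\<integral>\<omega>. (x \<bullet> Z 1 \<omega>) * (y \<bullet> Z 1 \<omega>) \<partial>M)"
proof -
  have int: "integrable M (\<lambda>\<omega>. Z 1 \<omega> $ i * Z 1 \<omega> $ j)" for i j
    using gspan_prod_integrable[OF gspan_Z[of 1 "axis i 1"] gspan_Z[of 1 "axis j 1"]] by (simp add: inner_axis')
  have "(x \<bullet> Z 1 \<omega>) * (y \<bullet> Z 1 \<omega>) = (\<Sum>i\<in>UNIV. \<Sum>j\<in>UNIV. x $ i * y $ j * (Z 1 \<omega> $ i * Z 1 \<omega> $ j))" for \<omega>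
    by (simp add: inner_vec_def sum_product algebra_simps)
  then have "(\<integral>\<omega>. (x \<bullet> Z 1 \<omega>) * (y \<bullet> Z 1 \<omega>) \<partial>M) = (\<Sum>i\<in>UNIV. \<Sum>j\<in>UNIV. x $ i * y $ j * (\<integral>\<omega>. Z 1 \<omega> $ i * Z 1 \<omega> $ j \<partial>M))"
    using int by simp
  then show ?thesis
    by (simp add: inner_vec_def matrix_vector_mult_def covmat_def sum_distrib_left algebra_simps)
qed

lemma var_covmat: "var \<theta> 1 = \<theta> \<bullet> (covmat *v \<theta>)"
  by (simp add: var_def inner_covmat power2_eq_square)

lemma Z_independent_increments: "independent_increments M Z"
proof (rule independent_increments_if_cis[where q="\<lambda>\<theta>. var \<theta> 1"])
  show "prob_space M" by unfold_locales
qed (auto simp: increments_cis var_covmat)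

text \<open>For the \<open>k\<close>-th unit vector \<open>x\<close>, the residual \<open>y\<close>
  has form value 0, so \<open>y \<bullet> Z t\<close> has variance 0 and vanishes almost surely.
  That variable is the \<open>k\<close>-th coordinate of the difference of the two sides.\<close>

lemma Z_AE_reproduce:
  assumes repr: "\<And>x y. y = x - (\<Sum>i\<in>I. (x \<bullet> (covmat *v a i)) *\<^sub>R a i) \<Longrightarrow> y \<bullet> (covmat *v y) = 0"
    and t: "0 \<le> t"
  shows "AE \<omega> in M. Z t \<omega> = (\<Sum>i\<in>I. (a i \<bullet> Z t \<omega>) *\<^sub>R (covmat *v a i))"
proof -
  have "AE \<omega> in M. Z t \<omega> $ k = (\<Sum>i\<in>I. (a i \<bullet> Z t \<omega>) *\<^sub>R (covmat *v a i)) $ k" for k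
  proof -
    define x where "x = (axis k 1 :: real ^ 'b)"
    define y where "y = x - (\<Sum>i\<in>I. (x \<bullet> (covmat *v a i)) *\<^sub>R a i)"
    have "var y t = 0" using var_linear[OF t, of y] repr[OF y_def] by (simp add: var_covmat)
    then have ae: "AE \<omega> in M. (y \<bullet> Z t \<omega>)\<^sup>2 = 0"
      unfolding var_def using gspan_square_integrable[OF gspan_Z[OF t, of y]]
      by (subst (asm) integral_nonneg_eq_0_iff_AE) auto
    have y: "y \<bullet> Z t \<omega> = Z t \<omega> $ k - (\<Sum>i\<in>I. (a i \<bullet> Z t \<omega>) *\<^sub>R (covmat *v a i)) $ k" for \<omega>
      by (simp add: y_def x_def inner_diff_left inner_sum_left inner_axis' mult.commute)
    show ?thesis using ae by eventually_elim (simp add: y)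
  qed
  then have "AE \<omega> in M. \<forall>k\<in>UNIV. Z t \<omega> $ k = (\<Sum>i\<in>I. (a i \<bullet> Z t \<omega>) *\<^sub>R (covmat *v a i)) $ k"
    by (subst AE_finite_all) auto
  then show ?thesis by eventually_elim (simp add: vec_eq_iff)
qed

end

section \<open>Standard normal vectors\<close>

text \<open>Written with the same Lebesgue density as in \<open>standard_brownian_motion\<close>, so
  that the requirement there unfolds to it; \<open>\<sigma>\<close> is the standard deviation of
  each coordinate.\<close>

definition normal_vec :: "real \<Rightarrow> (real ^ 'd::finite) measure" where
  "normal_vec \<sigma> = density lborel (\<lambda>x. ennreal (\<Prod>i\<in>UNIV. normal_density 0 \<sigma> (x $ i)))"

lemma prod_Basis_vec: "(\<Prod>b\<in>(Basis :: (real ^ 'd::finite) set). F b) = (\<Prod>i\<in>UNIV. F (axis i 1))"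
proof -
  have "(Basis :: (real ^ 'd) set) = range (\<lambda>i. axis i 1)" by (auto simp: Basis_vec_def)
  moreover have "inj (\<lambda>i. axis i 1 :: real ^ 'd)" by (auto simp: inj_def axis_eq_axis)
  ultimately show ?thesis using prod.reindex[of "\<lambda>i. axis i 1 :: real ^ 'd" UNIV F] by (simp add: comp_def)
qed

lemma borel_measurable_vec_lambda:
  fixes f :: "'a \<Rightarrow> 'd::finite \<Rightarrow> real"
  assumes "\<And>i. (\<lambda>x. f x i) \<in> borel_measurable M"
  shows "(\<lambda>x. \<chi> i. f x i) \<in> borel_measurable M"
  unfolding borel_measurable_euclidean_space[of "\<lambda>x. \<chi> i. f x i"]
proof
  fix b :: "real ^ 'd" assume "b \<in> Basis"
  then obtain i where "b = axis i 1" by (auto simp: Basis_vec_def)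
  then show "(\<lambda>x. (\<chi> i. f x i) \<bullet> b) \<in> borel_measurable M" using assms[of i] by (simp add: inner_axis)
qed

lemma borel_measurable_vec_nth [measurable]:
  "f \<in> borel_measurable M \<Longrightarrow> (\<lambda>x. (f x :: real ^ 'd::finite) $ i) \<in> borel_measurable M"
  using borel_measurable_inner[of f M "\<lambda>_. axis i 1"] by (simp add: inner_axis)

text \<open>On a box both sides are products of one-dimensional masses. The product description
  makes integrals of products over the coordinates factor.\<close>

lemma normal_vec_eq_distr:
  assumes \<sigma>: "0 < \<sigma>"
  shows "normal_vec \<sigma> = distr (\<Pi>\<^sub>M i\<in>(UNIV :: 'd::finite set). density lborel (\<lambda>x. ennreal (normal_density 0 \<sigma> x))) borel (\<lambda>f. \<chi> i. f i)"
    (is "_ = distr ?P borel ?v")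
proof -
  let ?N = "density lborel (\<lambda>x. ennreal (normal_density 0 \<sigma> x))"
  interpret N: prob_space ?N using \<sigma> by (rule prob_space_normal_density)
  interpret product_prob_space "\<lambda>_ :: 'd. ?N" by (rule product_prob_spaceI) unfold_locales
  have [measurable]: "?v \<in> borel_measurable ?P"
    by (intro borel_measurable_vec_lambda) (auto intro: measurable_compose[OF measurable_component_singleton])
  show ?thesis
  proof (rule measure_eqI_generator_eq[symmetric])
    let ?E = "range (\<lambda>(a, b). box a b :: (real ^ 'd) set)"
    show "Int_stable ?E" by (auto simp: Int_stable_def box_Int_box)
    show "?E \<subseteq> Pow UNIV" by auto
    show "sets (normal_vec \<sigma>) = sigma_sets UNIV ?E" "sets (distr ?P borel ?v) = sigma_sets UNIV ?E"
      by (simp_all add: normal_vec_def borel_eq_box)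
    let ?A = "\<lambda>n::nat. box (- (real n *\<^sub>R One)) (real n *\<^sub>R One) :: (real ^ 'd) set"
    show "range ?A \<subseteq> ?E" "(\<Union>i. ?A i) = UNIV"
      unfolding UN_box_eq_UNIV by auto
    have "prob_space (distr ?P borel ?v)" by (intro prob_space.prob_space_distr prob_space_PiM N.prob_space_axioms) measurable
    from finite_measure.emeasure_finite[OF prob_space.axioms(1)[OF this]]
    show "emeasure (distr ?P borel ?v) (?A i) \<noteq> \<infinity>" for i by simp
    fix X assume "X \<in> ?E"
    then obtain l u :: "real ^ 'd" where X: "X = box l u" by auto
    define f where "f b y = ennreal (normal_density 0 \<sigma> y) * indicator {l \<bullet> b<..<u \<bullet> b} y" for b y
    have [measurable]: "f b \<in> borel_measurable borel" for b unfolding f_def[abs_def] by measurable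
    have "emeasure (normal_vec \<sigma>) X = (\<integral>\<^sup>+x. (\<Prod>b\<in>Basis. f b (x \<bullet> b)) \<partial>lborel)"
    proof (unfold normal_vec_def, subst emeasure_density)
      show "(\<integral>\<^sup>+x. ennreal (\<Prod>i\<in>UNIV. normal_density 0 \<sigma> (x $ i)) * indicator X x \<partial>lborel) = (\<integral>\<^sup>+x. (\<Prod>b\<in>Basis. f b (x \<bullet> b)) \<partial>lborel)"
      proof (rule nn_integral_cong)
        fix x :: "real ^ 'd"
        have "indicator X x = (\<Prod>b\<in>Basis. indicator {l \<bullet> b<..<u \<bullet> b} (x \<bullet> b) :: ennreal)"
          by (auto simp: X box_def indicator_def prod_zero_iff)
        then show "ennreal (\<Prod>i\<in>UNIV. normal_density 0 \<sigma> (x $ i)) * indicator X x = (\<Prod>b\<in>Basis. f b (x \<bullet> b))"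
          by (simp add: f_def prod.distrib prod_Basis_vec inner_axis prod_ennreal)
      qed
    qed (auto simp: X)
    also have "\<dots> = (\<Prod>b\<in>Basis. \<integral>\<^sup>+x. f b x \<partial>lborel)" by (rule nn_integral_lborel_prod) auto
    also have "\<dots> = (\<Prod>i\<in>UNIV. emeasure ?N {l $ i<..<u $ i})"
      by (simp add: prod_Basis_vec f_def inner_axis emeasure_density)
    also have "\<dots> = emeasure ?P (Pi\<^sub>E UNIV (\<lambda>i. {l $ i<..<u $ i}))"
      by (subst emeasure_PiM) auto
    also have "Pi\<^sub>E UNIV (\<lambda>i. {l $ i<..<u $ i}) = ?v -` X \<inter> space ?P"
      by (auto simp: X mem_box_cart space_PiM PiE_UNIV_domain Pi_iff)
    also have "emeasure ?P \<dots> = emeasure (distr ?P borel ?v) X"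
      by (subst emeasure_distr) (auto simp: X)
    finally show "emeasure (distr ?P borel ?v) X = emeasure (normal_vec \<sigma>) X" by simp
  qed
qed

lemma integral_cis_normal:
  assumes \<sigma>: "0 < \<sigma>"
  shows "(\<integral>x. cis (c * x) \<partial>density lborel (\<lambda>x. ennreal (normal_density 0 \<sigma> x))) = complex_of_real (exp (- (\<sigma>\<^sup>2 * c\<^sup>2) / 2))"
proof -
  let ?N = "density lborel (\<lambda>x. ennreal (normal_density 0 \<sigma> x))"
  interpret N: prob_space ?N using \<sigma> by (rule prob_space_normal_density)
  have "distr ?N lborel (\<lambda>x. x) = ?N"
    by (rule distr_id2) simp
  then have "distributed ?N lborel (\<lambda>x. x) (normal_density 0 \<sigma>)"
    by (simp add: distributed_def)
  then have "distributed ?N lborel (\<lambda>x. (x - 0) / \<sigma>) std_normal_density"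
    using N.normal_standard_normal_convert[OF \<sigma>, of "\<lambda>x. x" 0] by simp
  then have std: "distr ?N borel (\<lambda>x. x / \<sigma>) = std_normal_distribution"
    using distr_cong[of ?N ?N lborel borel "\<lambda>x. x / \<sigma>"] by (simp add: distributed_def)
  have "(\<integral>x. cis (c * x) \<partial>?N) = char (distr ?N borel (\<lambda>x. x / \<sigma>)) (\<sigma> * c)"
    unfolding char_def using \<sigma> by (subst integral_distr) (auto simp: cis_conv_exp)
  then show ?thesis unfolding std char_std_normal_distribution by (simp add: power_mult_distrib)
qed

lemma prob_space_normal_vec: "0 < \<sigma> \<Longrightarrow> prob_space (normal_vec \<sigma> :: (real ^ 'd::finite) measure)"
  unfolding normal_vec_eq_distr
  by (intro prob_space.prob_space_distr prob_space_PiM prob_space_normal_density borel_measurable_vec_lambda)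
    (auto intro: measurable_compose[OF measurable_component_singleton])

lemma sets_normal_vec [measurable_cong, simp]: "sets (normal_vec \<sigma>) = sets borel"
  and space_normal_vec [simp]: "space (normal_vec \<sigma>) = UNIV"
  by (simp_all add: normal_vec_def)

lemma integral_cis_normal_vec:
  assumes \<sigma>: "0 < \<sigma>"
  shows "(\<integral>x. cis (\<theta> \<bullet> x) \<partial>normal_vec \<sigma>) = complex_of_real (exp (- (\<sigma>\<^sup>2 * (\<theta> \<bullet> \<theta>)) / 2))"
proof -
  let ?N = "density lborel (\<lambda>x. ennreal (normal_density 0 \<sigma> x))"
  let ?P = "\<Pi>\<^sub>M i\<in>(UNIV :: 'a set). ?N"
  interpret N: prob_space ?N using \<sigma> by (rule prob_space_normal_density)
  interpret product_prob_space "\<lambda>_ :: 'a. ?N" by (rule product_prob_spaceI) unfold_locales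
  have [measurable]: "(\<lambda>f. \<chi> i. f i) \<in> borel_measurable ?P"
    by (intro borel_measurable_vec_lambda) (auto intro: measurable_compose[OF measurable_component_singleton])
  have "(\<integral>x. cis (\<theta> \<bullet> x) \<partial>normal_vec \<sigma>) = (\<integral>f. cis (\<Sum>i\<in>UNIV. \<theta> $ i * f i) \<partial>?P)"
    unfolding normal_vec_eq_distr[OF \<sigma>] by (subst integral_distr) (auto simp: inner_vec_def)
  also have "\<dots> = (\<integral>f. (\<Prod>i\<in>UNIV. cis (\<theta> $ i * f i)) \<partial>?P)"
    by (simp add: cis_conv_exp exp_sum[symmetric] sum_distrib_left)
  also have "\<dots> = (\<Prod>i\<in>UNIV. \<integral>x. cis (\<theta> $ i * x) \<partial>?N)"
    by (rule product_integral_prod) (auto intro!: N.integrable_const_bound[where B=1])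
  also have "\<dots> = complex_of_real (exp (\<Sum>i\<in>UNIV. - (\<sigma>\<^sup>2 * (\<theta> $ i)\<^sup>2) / 2))"
    by (simp add: integral_cis_normal[OF \<sigma>] exp_sum)
  finally show ?thesis
    by (simp add: inner_vec_def sum_negf sum_divide_distrib sum_distrib_left power2_eq_square)
qed

text \<open>Fourth moments are for the Borel-Cantelli step of \<open>AE_levy_good\<close>: with
  second moments, about \<open>2 ^ m\<close> events of probability of order \<open>(1/2) ^ m\<close>
  or more would not be summable.\<close>

lemma integrable_normal_vec_norm_power4:
  assumes \<sigma>: "0 < \<sigma>"
  shows "integrable (normal_vec \<sigma> :: (real ^ 'd::finite) measure) (\<lambda>x. norm x ^ 4)"
proof -
  let ?N = "density lborel (\<lambda>x. ennreal (normal_density 0 \<sigma> x))"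
  let ?P = "\<Pi>\<^sub>M i\<in>(UNIV :: 'd set). ?N"
  interpret N: prob_space ?N using \<sigma> by (rule prob_space_normal_density)
  interpret product_prob_space "\<lambda>_ :: 'd. ?N" by (rule product_prob_spaceI) unfold_locales
  have [measurable]: "(\<lambda>f. \<chi> i. f i) \<in> borel_measurable ?P"
    by (intro borel_measurable_vec_lambda) (auto intro: measurable_compose[OF measurable_component_singleton])
  have 1: "integrable ?N (\<lambda>x. x ^ 4)"
    using integrable_normal_moment[OF \<sigma>, of 0 4] by (subst integrable_density) auto
  have "integrable ?P (\<lambda>f. (f i) ^ 4)" for i
  proof -
    have "integrable (distr ?P ?N (\<lambda>f. f i)) (\<lambda>x. x ^ 4)" 
      using 1 distr_PiM_component[of UNIV "\<lambda>_ :: 'd. ?N" i] N.prob_space_axioms by simp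
    then show ?thesis by (subst (asm) integrable_distr_eq) auto
  qed
  then have "integrable ?P (\<lambda>f. real CARD('d) * (\<Sum>i\<in>UNIV. (f i) ^ 4))" by auto
  then have 2: "integrable (normal_vec \<sigma>) (\<lambda>x :: real ^ 'd. real CARD('d) * (\<Sum>i\<in>UNIV. (x $ i) ^ 4))"
    unfolding normal_vec_eq_distr[OF \<sigma>] by (subst integrable_distr_eq) auto
  have "norm x ^ 4 \<le> real CARD('d) * (\<Sum>i\<in>UNIV. (x $ i) ^ 4)" for x :: "real ^ 'd"
  proof -
    have "(norm x)\<^sup>2 = (\<Sum>i\<in>UNIV. 1 * (x $ i)\<^sup>2)"
      unfolding power2_norm_eq_inner inner_vec_def by (simp add: power2_eq_square)
    then have "norm x ^ 4 = (\<Sum>i\<in>UNIV. 1 * (x $ i)\<^sup>2)\<^sup>2"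
      using power_mult[of "norm x" 2 2] by simp
    also have "\<dots> \<le> (\<Sum>i\<in>(UNIV :: 'd set). 1\<^sup>2) * (\<Sum>i\<in>UNIV. ((x $ i)\<^sup>2)\<^sup>2)" by (rule Cauchy_Schwarz_ineq_sum[of "\<lambda>_. 1" "\<lambda>i. (x $ i)\<^sup>2" UNIV])
    finally show ?thesis by (simp add: power_mult[symmetric])
  qed
  then show ?thesis
    by (intro Bochner_Integration.integrable_bound[OF 2]) (auto intro!: AE_I2 order_trans[OF _ abs_ge_self])
qed

section \<open>Levy's construction of Brownian motion\<close>

text \<open>
  \<open>ramp k\<close> interpolates the increment over \<open>[k, k + 1]\<close> and \<open>tent m k\<close> is the
  Schauder function of the dyadic interval \<open>[k / 2^m, (k + 1) / 2^m]\<close>; at each time at most one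
  tent of a level is nonzero, namely that of \<open>cell m t\<close>. The coordinates of \<open>\<xi>\<close> are indexed by
  \<open>prod_encode (0, k)\<close> for the ramps and \<open>prod_encode (Suc m, k)\<close> for the tents.
\<close>

definition ramp :: "nat \<Rightarrow> real \<Rightarrow> real" where
  "ramp k t = min 1 (max 0 (t - real k))"

definition tent :: "nat \<Rightarrow> nat \<Rightarrow> real \<Rightarrow> real" where
  "tent m k t = max 0 (1 - \<bar>2 * 2 ^ m * t - (2 * real k + 1)\<bar>)"

definition cell :: "nat \<Rightarrow> real \<Rightarrow> nat" where
  "cell m t = nat \<lfloor>2 ^ m * t\<rfloor>"

text \<open>The standard deviation of the midpoint of a Brownian path given its values at the ends
  of an interval of length \<open>1 / 2 ^ m\<close>; the variance is a quarter of the
  length.\<close>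

definition amp :: "nat \<Rightarrow> real" where
  "amp m = (1/2) * (1 / sqrt 2) ^ m"

definition schauder :: "nat \<Rightarrow> real \<Rightarrow> (nat \<Rightarrow> 'a::real_normed_vector) \<Rightarrow> 'a" where
  "schauder m t \<xi> = (amp m * tent m (cell m t) t) *\<^sub>R \<xi> (prod_encode (Suc m, cell m t))"

definition base :: "real \<Rightarrow> (nat \<Rightarrow> 'a::real_normed_vector) \<Rightarrow> 'a" where
  "base t \<xi> = (\<Sum>k<nat \<lceil>t\<rceil>. ramp k t *\<^sub>R \<xi> (prod_encode (0, k)))"

definition levy_partial :: "nat \<Rightarrow> real \<Rightarrow> (nat \<Rightarrow> 'a::real_normed_vector) \<Rightarrow> 'a" where
  "levy_partial n t \<xi> = base t \<xi> + (\<Sum>m<n. schauder m t \<xi>)"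

lemma amp_pos: "0 < amp m"
  by (simp add: amp_def)

lemma amp_square: "(amp m)\<^sup>2 = (1/4) * (1/2) ^ m"
  by (simp add: amp_def power_mult_distrib power_divide power_mult[symmetric] mult.commute[of m])
    (simp add: power_mult)

lemma tent_01: "0 \<le> tent m k t" "tent m k t \<le> 1"
  by (auto simp: tent_def)

lemma tent_eq_0: "0 \<le> t \<Longrightarrow> k \<noteq> cell m t \<Longrightarrow> tent m k t = 0"
proof -
  assume t: "0 \<le> t" and k: "k \<noteq> cell m t"
  define x where "x = 2 ^ m * t"
  have x: "0 \<le> x" using t by (simp add: x_def)
  have c: "real (cell m t) \<le> x" "x < real (cell m t) + 1"
    using x by (auto simp: cell_def x_def[symmetric])
  have "real k + 1 \<le> x \<or> x \<le> real k"
  proof (cases "k < cell m t")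
    case True
    then have "real k + 1 \<le> real (cell m t)" by linarith
    then show ?thesis using c by linarith
  next
    case False
    then have "real (cell m t) + 1 \<le> real k" using k by linarith
    then show ?thesis using c by linarith
  qed
  then have "1 \<le> \<bar>2 * x - (2 * real k + 1)\<bar>" by linarith
  then show ?thesis by (simp add: tent_def x_def mult.assoc)
qed

text \<open>Since \<open>cell m t\<close> jumps with \<open>t\<close>, the single term of
  \<open>schauder\<close> is traded for a sum over a range that does not depend on \<open>t\<close>;
  continuity and linear relations between different times can then be checked term by term.\<close>

lemma schauder_eq_sum:
  assumes t: "0 \<le> t" "2 ^ m * t < real K"
  shows "schauder m t \<xi> = (\<Sum>k<K. (amp m * tent m k t) *\<^sub>R \<xi> (prod_encode (Suc m, k)))"
proof -
  have "cell m t < K" using t by (auto simp: cell_def floor_less_iff nat_less_iff)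
  then have "(\<Sum>k<K. (amp m * tent m k t) *\<^sub>R \<xi> (prod_encode (Suc m, k)))
     = (\<Sum>k\<in>{cell m t}. (amp m * tent m k t) *\<^sub>R \<xi> (prod_encode (Suc m, k)))"
    using tent_eq_0[OF t(1)] by (intro sum.mono_neutral_right) auto
  then show ?thesis by (simp add: schauder_def)
qed

lemma base_eq_sum:
  assumes t: "0 \<le> t" "t \<le> real K"
  shows "base t \<xi> = (\<Sum>k<K. ramp k t *\<^sub>R \<xi> (prod_encode (0, k)))"
proof -
  have "nat \<lceil>t\<rceil> \<le> K" using t by (simp add: ceiling_le_iff)
  moreover have "ramp k t = 0" if "nat \<lceil>t\<rceil> \<le> k" for k
  proof -
    have "t \<le> real k" using that t by linarith
    then show ?thesis by (simp add: ramp_def)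
  qed
  ultimately show ?thesis
    unfolding base_def by (intro sum.mono_neutral_left) auto
qed

lemma continuous_on_schauder: "continuous_on {0..} (\<lambda>t. schauder m t \<xi>)"
proof (rule continuous_on_halfline)
  fix T :: real
  obtain K :: nat where K: "2 ^ m * T < real K" using reals_Archimedean2 by blast
  have c: "continuous_on {0..T} (\<lambda>t. \<Sum>k<K. (amp m * tent m k t) *\<^sub>R \<xi> (prod_encode (Suc m, k)))"
    unfolding tent_def by (intro continuous_intros)
  have e: "schauder m t \<xi> = (\<Sum>k<K. (amp m * tent m k t) *\<^sub>R \<xi> (prod_encode (Suc m, k)))" if "t \<in> {0..T}" for t
  proof (rule schauder_eq_sum)
    have "2 ^ m * t \<le> 2 ^ m * T" using that by simp
    then show "2 ^ m * t < real K" using K by linarith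
  qed (use that in auto)
  show "continuous_on {0..T} (\<lambda>t. schauder m t \<xi>)" by (rule continuous_on_eq[OF c e[symmetric]])
qed

lemma continuous_on_base: "continuous_on {0..} (\<lambda>t. base t \<xi>)"
proof (rule continuous_on_halfline)
  fix T :: real
  obtain K :: nat where K: "T < real K" using reals_Archimedean2 by blast
  have c: "continuous_on {0..T} (\<lambda>t. \<Sum>k<K. ramp k t *\<^sub>R \<xi> (prod_encode (0, k)))"
    unfolding ramp_def by (intro continuous_intros)
  have e: "base t \<xi> = (\<Sum>k<K. ramp k t *\<^sub>R \<xi> (prod_encode (0, k)))" if "t \<in> {0..T}" for t
    using that K by (intro base_eq_sum) auto
  show "continuous_on {0..T} (\<lambda>t. base t \<xi>)" by (rule continuous_on_eq[OF c e[symmetric]])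
qed

section \<open>Affine interpolation on dyadic intervals\<close>

lemma ramp_midpoint:
  "2 * ramp k ((2 * real p + 1) / (2 * 2 ^ n)) = ramp k (real p / 2 ^ n) + ramp k ((real p + 1) / 2 ^ n)"
proof -
  define N :: nat where "N = 2 ^ n"
  have N: "0 < N" "(2::real) ^ n = real N" by (auto simp: N_def)
  \<comment> \<open>\<open>a\<close> is the offset from the left kink in units of
    \<open>1 / 2 ^ n\<close>. As it is an integer, no kink lies strictly between \<open>a\<close>
    and \<open>a + 1\<close>, and three affine cases remain.\<close>
  define a :: int where "a = int p - int (k * N)"
  have a: "real p = real_of_int a + real k * real N" by (simp add: a_def)
  have r: "ramp k (x / real N) = min (real N) (max 0 (x - real k * real N)) / real N" for x
    using N by (auto simp: ramp_def min_def max_def field_simps)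
  have 1: "(2 * real p + 1) / (2 * 2 ^ n) = (real p + 1/2) / real N" using N by (simp add: field_simps)
  consider "a \<le> -1" | "0 \<le> a" "a \<le> int N - 1" | "a \<ge> int N" by linarith
  then have "2 * min (real N) (max 0 (real_of_int a + 1/2)) = min (real N) (max 0 (real_of_int a)) + min (real N) (max 0 (real_of_int a + 1))"
  proof cases
    case 1
    then have "real_of_int a \<le> -1" by linarith
    then show ?thesis by (simp add: max_def min_def)
  next
    case 2
    then have "0 \<le> real_of_int a" "real_of_int a \<le> real N - 1" by linarith+
    then show ?thesis by (simp add: max_def min_def)
  next
    case 3
    then have "real_of_int a \<ge> real N" by linarith
    then show ?thesis by (simp add: max_def min_def)
  qed
  then show ?thesis unfolding 1 unfolding N(2) r using N(1) by (simp add: a add_divide_distrib[symmetric] algebra_simps)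
qed

text \<open>A tent of level \<open>m\<close> is affine between multiples of
  \<open>1 / 2 ^ (m + 1)\<close>, and for \<open>m < n\<close> these are dyadics of level
  \<open>n\<close>. In the proof \<open>a\<close> is the integer offset from the peak in units of
  \<open>1 / 2 ^ n\<close>.\<close>

lemma tent_midpoint:
  assumes "m < n"
  shows "2 * tent m k ((2 * real p + 1) / (2 * 2 ^ n)) = tent m k (real p / 2 ^ n) + tent m k ((real p + 1) / 2 ^ n)"
proof -
  obtain e where e: "n = m + 1 + e" using assms less_iff_Suc_add by auto
  define N :: nat where "N = 2 ^ e"
  have N: "0 < N" "(2::real) ^ n = 2 * 2 ^ m * real N" by (auto simp: N_def e power_add)
  define a :: int where "a = int p - int ((2 * k + 1) * N)"
  have a: "real p = real_of_int a + (2 * real k + 1) * real N" by (simp add: a_def algebra_simps)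
  have r: "tent m k (x / (2 * 2 ^ m * real N)) = max 0 (real N - \<bar>x - (2 * real k + 1) * real N\<bar>) / real N" for x
  proof -
    have "2 * 2 ^ m * (x / (2 * 2 ^ m * real N)) - (2 * real k + 1) = (x - (2 * real k + 1) * real N) / real N"
      using N(1) by (simp add: field_simps)
    then have "tent m k (x / (2 * 2 ^ m * real N)) = max 0 (1 - \<bar>x - (2 * real k + 1) * real N\<bar> / real N)"
      using N(1) by (simp add: tent_def abs_divide)
    then show ?thesis using N(1) by (auto simp: max_def field_simps)
  qed
  have 1: "(2 * real p + 1) / (2 * 2 ^ n) = (real p + 1/2) / (2 * 2 ^ m * real N)" using N by (simp add: field_simps)
  consider "a \<le> - int N - 1" | "- int N \<le> a" "a \<le> -1" | "0 \<le> a" "a \<le> int N - 1" | "a \<ge> int N" by linarith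
  then have "2 * max 0 (real N - \<bar>real_of_int a + 1/2\<bar>) = max 0 (real N - \<bar>real_of_int a\<bar>) + max 0 (real N - \<bar>real_of_int a + 1\<bar>)"
  proof cases
    case 1
    then have "real_of_int a \<le> - real N - 1" by linarith
    then show ?thesis by (simp add: max_def)
  next
    case 2
    then have "- real N \<le> real_of_int a" "real_of_int a \<le> -1" by linarith+
    then show ?thesis by (simp add: max_def)
  next
    case 3
    then have "0 \<le> real_of_int a" "real_of_int a \<le> real N - 1" by linarith+
    then show ?thesis by (simp add: max_def)
  next
    case 4
    then have "real_of_int a \<ge> real N" by linarith
    then show ?thesis by (simp add: max_def)
  qed
  moreover have q: "real p + 1/2 - (2 * real k + 1) * real N = real_of_int a + 1/2"
    "real p - (2 * real k + 1) * real N = real_of_int a" "real p + 1 - (2 * real k + 1) * real N = real_of_int a + 1"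
    by (simp_all add: a)
  ultimately show ?thesis unfolding 1 unfolding N(2) r unfolding q using N(1) by (simp add: add_divide_distrib[symmetric])
qed

text \<open>At such a time \<open>2 * 2 ^ m * t\<close> is an even integer, at distance at least 1
  from the odd number \<open>2 * k + 1\<close> at which the tent peaks. New levels thus leave the
  values at coarser dyadics unchanged.\<close>

lemma schauder_dyadic: "n \<le> m \<Longrightarrow> schauder m (real p / 2 ^ n) \<xi> = 0"
proof -
  assume "n \<le> m"
  then obtain e where e: "m = n + e" using le_Suc_ex by blast
  have "tent m k (real p / 2 ^ n) = 0" for k
  proof -
    have "2 * 2 ^ m * (real p / 2 ^ n) - (2 * real k + 1) = real_of_int (2 * (2 ^ e * int p) - (2 * int k + 1))"
      by (simp add: e power_add)
    moreover have "2 * (2 ^ e * int p) - (2 * int k + 1) \<noteq> 0" by presburger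
    then have "1 \<le> \<bar>2 * (2 ^ e * int p) - (2 * int k + 1)\<bar>" by linarith
    then have "1 \<le> \<bar>real_of_int (2 * (2 ^ e * int p) - (2 * int k + 1))\<bar>" by linarith
    ultimately show ?thesis by (simp only: tent_def)
  qed
  then show ?thesis by (simp add: schauder_def)
qed

lemma schauder_midpoint:
  "schauder n ((2 * real p + 1) / (2 * 2 ^ n)) \<xi> = amp n *\<^sub>R \<xi> (prod_encode (Suc n, p))"
proof -
  have "2 ^ n * ((2 * real p + 1) / (2 * 2 ^ n)) = real p + 1/2" by (simp add: field_simps)
  then have "cell n ((2 * real p + 1) / (2 * 2 ^ n)) = p"
    unfolding cell_def by (simp add: floor_eq_iff nat_eq_iff)
  moreover have "tent n p ((2 * real p + 1) / (2 * 2 ^ n)) = 1"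
    by (simp add: tent_def)
  ultimately show ?thesis by (simp add: schauder_def)
qed

text \<open>The midpoint form of the fact that \<open>levy_partial n\<close> is affine on dyadic
  intervals of level \<open>n\<close>: this holds for each ramp and each tent of a level below
  \<open>n\<close>.\<close>

lemma levy_partial_midpoint:
  "2 *\<^sub>R levy_partial n ((2 * real p + 1) / (2 * 2 ^ n)) \<xi> =
    levy_partial n (real p / 2 ^ n) \<xi> + levy_partial n ((real p + 1) / 2 ^ n) \<xi>"
proof -
  define x y z where "x = (2 * real p + 1) / (2 * 2 ^ n)" and "y = real p / 2 ^ n" and "z = (real p + 1) / 2 ^ n"
  obtain K :: nat where K: "2 ^ n * z < real K" using reals_Archimedean2 by blast
  have le: "0 \<le> y" "y \<le> x" "x \<le> z" "0 \<le> x" "0 \<le> z" by (auto simp: x_def y_def z_def field_simps)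
  have K': "2 ^ m * u < real K" if "m \<le> n" "0 \<le> u" "u \<le> z" for m u
  proof -
    have "(2::real) ^ m * u \<le> 2 ^ n * z" using that le by (intro mult_mono power_increasing) auto
    then show ?thesis using K by linarith
  qed
  have b: "base u \<xi> = (\<Sum>k<K. ramp k u *\<^sub>R \<xi> (prod_encode (0, k)))" if "u \<in> {x, y, z}" for u
    using K'[of 0 u] that le by (intro base_eq_sum) auto
  have s: "schauder m u \<xi> = (\<Sum>k<K. (amp m * tent m k u) *\<^sub>R \<xi> (prod_encode (Suc m, k)))" if "m < n" "u \<in> {x, y, z}" for m u
    using K'[of m u] that le by (intro schauder_eq_sum) auto
  have "2 *\<^sub>R base x \<xi> = (\<Sum>k<K. (2 * ramp k x) *\<^sub>R \<xi> (prod_encode (0, k)))"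
    by (simp add: b scaleR_sum_right)
  also have "\<dots> = base y \<xi> + base z \<xi>"
    unfolding x_def ramp_midpoint y_def[symmetric] z_def[symmetric]
    by (simp add: b scaleR_add_left sum.distrib)
  finally have B: "2 *\<^sub>R base x \<xi> = base y \<xi> + base z \<xi>" .
  have S: "2 *\<^sub>R schauder m x \<xi> = schauder m y \<xi> + schauder m z \<xi>" if m: "m < n" for m
  proof -
    have "2 *\<^sub>R schauder m x \<xi> = (\<Sum>k<K. (amp m * (2 * tent m k x)) *\<^sub>R \<xi> (prod_encode (Suc m, k)))"
      using m by (simp add: s scaleR_sum_right mult.left_commute)
    also have "\<dots> = schauder m y \<xi> + schauder m z \<xi>"
      unfolding x_def tent_midpoint[OF m] y_def[symmetric] z_def[symmetric]
      using m by (simp add: s distrib_left scaleR_add_left sum.distrib)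
    finally show ?thesis .
  qed
  have "2 *\<^sub>R (\<Sum>m<n. schauder m x \<xi>) = (\<Sum>m<n. schauder m y \<xi>) + (\<Sum>m<n. schauder m z \<xi>)"
    unfolding scaleR_sum_right sum.distrib[symmetric] by (intro sum.cong) (auto simp: S)
  then show ?thesis
    unfolding x_def[symmetric] y_def[symmetric] z_def[symmetric]
    by (simp add: levy_partial_def scaleR_add_right B)
qed

section \<open>Joint law of the dyadic increments\<close>

definition levy_incr :: "nat \<Rightarrow> nat \<Rightarrow> (nat \<Rightarrow> 'a::real_normed_vector) \<Rightarrow> 'a" where
  "levy_incr n k \<xi> = levy_partial n ((real k + 1) / 2 ^ n) \<xi> - levy_partial n (real k / 2 ^ n) \<xi>"

lemma levy_incr_0: "levy_incr 0 k \<xi> = \<xi> (prod_encode (0, k))"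
proof -
  have "base (real p) \<xi> = (\<Sum>j<p. \<xi> (prod_encode (0, j)))" for p
    by (subst base_eq_sum[of _ p]) (auto intro!: sum.cong simp: ramp_def)
  from this[of k] this[of "Suc k"] show ?thesis
    by (simp add: levy_incr_def levy_partial_def add.commute)
qed

text \<open>The tent of level \<open>n\<close> vanishes at both ends of the interval and adds its
  coefficient at the midpoint, so the two halves differ from half of the increment by the same
  Gaussian vector with opposite signs.\<close>

lemma levy_incr_Suc:
  "levy_incr (Suc n) (2 * k) \<xi> = (1/2) *\<^sub>R levy_incr n k \<xi> + amp n *\<^sub>R \<xi> (prod_encode (Suc n, k))" (is ?A)
  "levy_incr (Suc n) (2 * k + 1) \<xi> = (1/2) *\<^sub>R levy_incr n k \<xi> - amp n *\<^sub>R \<xi> (prod_encode (Suc n, k))" (is ?B)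
proof -
  define x where "x = (2 * real k + 1) / (2 * 2 ^ n)"
  have e: "levy_partial (Suc n) (real p / 2 ^ n) \<xi> = levy_partial n (real p / 2 ^ n) \<xi>" for p
    by (simp add: levy_partial_def schauder_dyadic)
  have mid: "levy_partial (Suc n) x \<xi> = levy_partial n x \<xi> + amp n *\<^sub>R \<xi> (prod_encode (Suc n, k))"
    by (simp add: levy_partial_def schauder_midpoint x_def)
  have "levy_partial n x \<xi> = (1/2) *\<^sub>R (2 *\<^sub>R levy_partial n x \<xi>)" by simp
  also have "\<dots> = (1/2) *\<^sub>R (levy_partial n (real k / 2 ^ n) \<xi> + levy_partial n ((real k + 1) / 2 ^ n) \<xi>)"
    unfolding x_def levy_partial_midpoint ..
  finally have h: "levy_partial n x \<xi> = (1/2) *\<^sub>R (levy_partial n (real k / 2 ^ n) \<xi> + levy_partial n ((real k + 1) / 2 ^ n) \<xi>)" .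
  have t: "real (2 * k) / 2 ^ Suc n = real k / 2 ^ n" "(real (2 * k) + 1) / 2 ^ Suc n = x"
    "real (2 * k + 1) / 2 ^ Suc n = x" "(real (2 * k + 1) + 1) / 2 ^ Suc n = real (Suc k) / 2 ^ n"
    by (auto simp: x_def field_simps)
  define P Q where "P = levy_partial n (real k / 2 ^ n) \<xi>" and "Q = levy_partial n ((real k + 1) / 2 ^ n) \<xi>"
  have PQ: "(1/2) *\<^sub>R (P + Q) - P = (1/2) *\<^sub>R (Q - P)" "Q - (1/2) *\<^sub>R (P + Q) = (1/2) *\<^sub>R (Q - P)"
  proof -
    have "P = (1/2) *\<^sub>R P + (1/2) *\<^sub>R P" "Q = (1/2) *\<^sub>R Q + (1/2) *\<^sub>R Q"
      by (simp_all flip: scaleR_add_left)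
    then show "(1/2) *\<^sub>R (P + Q) - P = (1/2) *\<^sub>R (Q - P)" "Q - (1/2) *\<^sub>R (P + Q) = (1/2) *\<^sub>R (Q - P)"
      by (metis add_diff_cancel_left scaleR_right_diff_distrib scaleR_right_distrib,
          metis add_diff_cancel_right scaleR_right_diff_distrib scaleR_right_distrib)
  qed
  have Q': "levy_partial n (real (Suc k) / 2 ^ n) \<xi> = Q" by (simp add: Q_def add.commute)
  show ?A
    unfolding levy_incr_def t e mid h P_def[symmetric] Q_def[symmetric]
    using PQ(1) by (simp add: algebra_simps)
  show ?B
    unfolding levy_incr_def t e mid h Q' P_def[symmetric] Q_def[symmetric]
    using PQ(2) by (simp add: algebra_simps)
qed

text \<open>The law of the coefficient sequence, not of a path. Its outcomes have the type that
  \<open>brownian_representation\<close> prescribes for the auxiliary space.\<close>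

definition wiener :: "(nat \<Rightarrow> real ^ 'd::finite) measure" where
  "wiener = (\<Pi>\<^sub>M j\<in>UNIV. normal_vec 1)"

lemma prob_space_wiener: "prob_space wiener"
  unfolding wiener_def by (intro prob_space_PiM prob_space_normal_vec) simp

lemma wiener_component_measurable [measurable]: "(\<lambda>\<xi>. \<xi> j) \<in> borel_measurable wiener"
proof -
  have "(\<lambda>\<xi>. \<xi> j) \<in> wiener \<rightarrow>\<^sub>M (normal_vec 1 :: (real ^ 'a) measure)"
    unfolding wiener_def by (rule measurable_component_singleton) simp
  then show ?thesis by (simp cong: measurable_cong_sets)
qed

lemma distr_wiener_component: "distr wiener borel (\<lambda>\<xi>. \<xi> j) = normal_vec 1"
proof -
  have "distr wiener (normal_vec 1) (\<lambda>\<xi>. \<xi> j) = (normal_vec 1 :: (real ^ 'a) measure)"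
    unfolding wiener_def by (rule distr_PiM_component) (auto intro: prob_space_normal_vec)
  then show ?thesis by (simp cong: distr_cong)
qed

lemma wiener_cis:
  assumes J: "finite J"
  shows "(\<integral>\<xi>. cis (\<Sum>j\<in>J. a j \<bullet> \<xi> j) \<partial>wiener) = complex_of_real (exp (- (\<Sum>j\<in>J. a j \<bullet> a j) / 2))"
proof -
  let ?N = "normal_vec 1 :: (real ^ 'a) measure"
  interpret N: prob_space ?N by (rule prob_space_normal_vec) simp
  interpret product_prob_space "\<lambda>_ :: nat. ?N" UNIV by (rule product_prob_spaceI) unfold_locales
  let ?P = "\<Pi>\<^sub>M j\<in>J. ?N"
  have m: "(\<lambda>\<xi>. cis (\<Sum>j\<in>J. a j \<bullet> \<xi> j)) \<in> borel_measurable ?P"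
  proof -
    have [measurable]: "(\<lambda>\<xi>. \<xi> j) \<in> borel_measurable ?P" if "j \<in> J" for j
    proof -
      have "(\<lambda>\<xi>. \<xi> j) \<in> ?P \<rightarrow>\<^sub>M ?N" using that by (rule measurable_component_singleton)
      then show ?thesis by (simp cong: measurable_cong_sets)
    qed
    show ?thesis by measurable
  qed
  have "(\<integral>\<xi>. cis (\<Sum>j\<in>J. a j \<bullet> \<xi> j) \<partial>wiener) = (\<integral>\<xi>. cis (\<Sum>j\<in>J. a j \<bullet> \<xi> j) \<partial>distr wiener ?P (\<lambda>\<xi>. restrict \<xi> J))"
    using m unfolding wiener_def by (subst integral_distr) (auto intro!: measurable_restrict_subset)
  also have "distr wiener ?P (\<lambda>\<xi>. restrict \<xi> J) = ?P"
    unfolding wiener_def by (rule distr_PiM_restrict_finite[OF J subset_UNIV])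
  also have "(\<integral>\<xi>. cis (\<Sum>j\<in>J. a j \<bullet> \<xi> j) \<partial>?P) = (\<integral>\<xi>. (\<Prod>j\<in>J. cis (a j \<bullet> \<xi> j)) \<partial>?P)"
    using J by (simp add: cis_conv_exp exp_sum[symmetric] sum_distrib_left)
  also have "\<dots> = (\<Prod>j\<in>J. \<integral>x. cis (a j \<bullet> x) \<partial>?N)"
  proof (rule product_integral_prod[OF J])
    fix j
    have "(\<lambda>x. cis (a j \<bullet> x)) \<in> borel_measurable borel"
      by (intro borel_measurable_continuous_onI continuous_intros)
    then have "(\<lambda>x. cis (a j \<bullet> x)) \<in> borel_measurable ?N"
      by (simp cong: measurable_cong_sets)
    then show "integrable ?N (\<lambda>x. cis (a j \<bullet> x))"
      by (intro N.integrable_const_bound[where B=1]) simp_all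
  qed
  also have "\<dots> = complex_of_real (exp (\<Sum>j\<in>J. - (a j \<bullet> a j) / 2))"
    using J by (simp add: integral_cis_normal_vec exp_sum)
  finally show ?thesis by (simp add: sum_negf sum_divide_distrib)
qed

text \<open>Merges coefficients on two disjoint sets of coordinates. The quantifier over
  \<open>F\<close> lets one \<open>a'\<close> serve the linear form and the quadratic form at
  once.\<close>

lemma sum_union_image:
  fixes a :: "nat \<Rightarrow> 'a" and c :: "nat \<Rightarrow> 'a"
  assumes J: "finite J" and g: "inj_on g {..<K}" "g ` {..<K} \<inter> J = {}"
  obtains a' :: "nat \<Rightarrow> 'a" where "\<And>F :: nat \<Rightarrow> 'a \<Rightarrow> real.
    (\<Sum>j\<in>J \<union> g ` {..<K}. F j (a' j)) = (\<Sum>k<K. F (g k) (c k)) + (\<Sum>j\<in>J. F j (a j))"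
proof
  define a' where "a' j = (if j \<in> J then a j else c (inv_into {..<K} g j))" for j
  fix F :: "nat \<Rightarrow> 'a \<Rightarrow> real"
  have "(\<Sum>j\<in>J \<union> g ` {..<K}. F j (a' j)) = (\<Sum>j\<in>J. F j (a' j)) + (\<Sum>j\<in>g ` {..<K}. F j (a' j))"
    using J g by (intro sum.union_disjoint) auto
  also have "(\<Sum>j\<in>J. F j (a' j)) = (\<Sum>j\<in>J. F j (a j))" by (simp add: a'_def)
  also have "(\<Sum>j\<in>g ` {..<K}. F j (a' j)) = (\<Sum>k<K. F (g k) (c k))"
    using g by (subst sum.reindex) (fastforce intro!: sum.cong simp: a'_def)+
  finally show "(\<Sum>j\<in>J \<union> g ` {..<K}. F j (a' j)) = (\<Sum>k<K. F (g k) (c k)) + (\<Sum>j\<in>J. F j (a j))"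
    by (simp add: add.commute)
qed

lemma sum_double: "(\<Sum>k<2 * K. f k) = (\<Sum>k<K. f (2 * k) + f (2 * k + 1))" for f :: "nat \<Rightarrow> real"
  by (induction K) auto

text \<open>The claim includes a combination over coordinates of levels \<open>n\<close> and above,
  none of which enters \<open>levy_incr n\<close>. The induction depends on this:
  \<open>levy_incr_Suc\<close> turns increments of level \<open>Suc n\<close> into increments of
  level \<open>n\<close> plus fresh coordinates, which join \<open>J\<close>.\<close>

lemma levy_incr_cis_aux:
  fixes \<theta> a :: "nat \<Rightarrow> real ^ 'd::finite"
  assumes "finite J" "\<And>j. j \<in> J \<Longrightarrow> \<exists>m k. n \<le> m \<and> j = prod_encode (Suc m, k)"
  shows "(\<integral>\<xi>. cis ((\<Sum>k<K. \<theta> k \<bullet> levy_incr n k \<xi>) + (\<Sum>j\<in>J. a j \<bullet> \<xi> j)) \<partial>wiener)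
    = complex_of_real (exp (- ((\<Sum>k<K. \<theta> k \<bullet> \<theta> k) / 2 ^ n + (\<Sum>j\<in>J. a j \<bullet> a j)) / 2))"
  using assms
proof (induction n arbitrary: K \<theta> J a)
  case 0
  define g where "g k = prod_encode (0, k)" for k
  have g: "inj_on g {..<K}" "g ` {..<K} \<inter> J = {}" using 0(2) by (fastforce simp: g_def inj_on_def)+
  obtain a' where a': "\<And>F :: nat \<Rightarrow> real ^ 'd \<Rightarrow> real.
    (\<Sum>j\<in>J \<union> g ` {..<K}. F j (a' j)) = (\<Sum>k<K. F (g k) (\<theta> k)) + (\<Sum>j\<in>J. F j (a j))"
    using sum_union_image[OF 0(1) g, where a=a and c=\<theta>] by metis
  have "(\<integral>\<xi>. cis (\<Sum>j\<in>J \<union> g ` {..<K}. a' j \<bullet> \<xi> j) \<partial>wiener) =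
      complex_of_real (exp (- (\<Sum>j\<in>J \<union> g ` {..<K}. a' j \<bullet> a' j) / 2))"
    using 0(1) by (intro wiener_cis) auto
  then show ?case
    unfolding a'[of "\<lambda>j x. x \<bullet> x"] using a'[of "\<lambda>j x. x \<bullet> _ j"] by (simp add: levy_incr_0 g_def)
next
  case (Suc n)
  \<comment> \<open>Padding with zeros up to \<open>2 * K\<close> lets indices be grouped into left
    and right halves of the same interval, also when \<open>K\<close> is odd.\<close>
  define \<theta>' where "\<theta>' k = (if k < K then \<theta> k else 0)" for k
  define u where "u k = (1/2) *\<^sub>R (\<theta>' (2 * k) + \<theta>' (2 * k + 1))" for k
  define v where "v k = amp n *\<^sub>R (\<theta>' (2 * k) - \<theta>' (2 * k + 1))" for k
  define g where "g k = prod_encode (Suc n, k)" for k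
  have ext: "(\<Sum>k<K. F k (\<theta> k)) = (\<Sum>k<2 * K. F k (\<theta>' k))" if "\<And>k. F k 0 = 0" for F :: "nat \<Rightarrow> real ^ 'd \<Rightarrow> real"
    using that by (intro sum.mono_neutral_cong_left) (auto simp: \<theta>'_def)
  have g: "inj_on g {..<K}" "g ` {..<K} \<inter> J = {}" using Suc.prems(2) by (fastforce simp: g_def inj_on_def)+
  obtain a' where a': "\<And>F :: nat \<Rightarrow> real ^ 'd \<Rightarrow> real.
    (\<Sum>j\<in>J \<union> g ` {..<K}. F j (a' j)) = (\<Sum>k<K. F (g k) (v k)) + (\<Sum>j\<in>J. F j (a j))"
    using sum_union_image[OF Suc.prems(1) g, where a=a and c=v] by metis
  have "(\<Sum>k<K. \<theta> k \<bullet> levy_incr (Suc n) k \<xi>) = (\<Sum>k<K. u k \<bullet> levy_incr n k \<xi>) + (\<Sum>k<K. v k \<bullet> \<xi> (g k))" for \<xi>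
  proof -
    have "(\<Sum>k<K. \<theta> k \<bullet> levy_incr (Suc n) k \<xi>) = (\<Sum>k<2 * K. \<theta>' k \<bullet> levy_incr (Suc n) k \<xi>)"
      by (rule ext[of "\<lambda>k x. x \<bullet> levy_incr (Suc n) k \<xi>"]) simp
    also have "\<dots> = (\<Sum>k<K. u k \<bullet> levy_incr n k \<xi> + v k \<bullet> \<xi> (g k))"
      unfolding sum_double levy_incr_Suc
      by (intro sum.cong) (auto simp: u_def v_def g_def inner_add_left inner_add_right inner_diff_left inner_diff_right algebra_simps)
    finally show ?thesis by (simp add: sum.distrib)
  qed
  then have L: "(\<Sum>k<K. \<theta> k \<bullet> levy_incr (Suc n) k \<xi>) + (\<Sum>j\<in>J. a j \<bullet> \<xi> j) =
      (\<Sum>k<K. u k \<bullet> levy_incr n k \<xi>) + (\<Sum>j\<in>J \<union> g ` {..<K}. a' j \<bullet> \<xi> j)" for \<xi>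
    using a'[of "\<lambda>j x. x \<bullet> \<xi> j"] by simp
  have "(\<Sum>k<K. \<theta> k \<bullet> \<theta> k) / 2 ^ Suc n = (\<Sum>k<2 * K. \<theta>' k \<bullet> \<theta>' k) / 2 ^ Suc n"
    by (subst ext[of "\<lambda>k x. x \<bullet> x"]) simp_all
  also have "\<dots> = (\<Sum>k<K. (u k \<bullet> u k) / 2 ^ n + v k \<bullet> v k)"
    unfolding sum_double sum_divide_distrib
  proof (intro sum.cong refl)
    fix k
    \<comment> \<open>The variances match by the parallelogram identity: the sum and the difference
      of the two coefficients carry the same factor, since \<open>(amp n)\<^sup>2\<close> is 1/4
      divided by \<open>2 ^ n\<close>.\<close>
    have vv: "v k \<bullet> v k = (1/4) * (1/2) ^ n * ((\<theta>' (2 * k) - \<theta>' (2 * k + 1)) \<bullet> (\<theta>' (2 * k) - \<theta>' (2 * k + 1)))"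
      unfolding v_def amp_square[symmetric] by (simp add: power2_eq_square)
    have uu: "u k \<bullet> u k = (1/4) * ((\<theta>' (2 * k) + \<theta>' (2 * k + 1)) \<bullet> (\<theta>' (2 * k) + \<theta>' (2 * k + 1)))"
      unfolding u_def by simp
    show "(\<theta>' (2 * k) \<bullet> \<theta>' (2 * k) + \<theta>' (2 * k + 1) \<bullet> \<theta>' (2 * k + 1)) / 2 ^ Suc n = (u k \<bullet> u k) / 2 ^ n + v k \<bullet> v k"
      unfolding uu vv by (simp add: inner_add_left inner_add_right inner_diff_left inner_diff_right power_one_over field_simps inner_commute)
  qed
  finally have Q: "(\<Sum>k<K. \<theta> k \<bullet> \<theta> k) / 2 ^ Suc n = (\<Sum>k<K. u k \<bullet> u k) / 2 ^ n + (\<Sum>k<K. v k \<bullet> v k)"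
    by (simp add: sum.distrib sum_divide_distrib)
  have "(\<integral>\<xi>. cis ((\<Sum>k<K. u k \<bullet> levy_incr n k \<xi>) + (\<Sum>j\<in>J \<union> g ` {..<K}. a' j \<bullet> \<xi> j)) \<partial>wiener) =
      complex_of_real (exp (- ((\<Sum>k<K. u k \<bullet> u k) / 2 ^ n + (\<Sum>j\<in>J \<union> g ` {..<K}. a' j \<bullet> a' j)) / 2))"
  proof (rule Suc.IH)
    fix j assume "j \<in> J \<union> g ` {..<K}"
    then show "\<exists>m k. n \<le> m \<and> j = prod_encode (Suc m, k)"
      using Suc.prems(2)[of j] by (auto simp: g_def intro: Suc_leD)
  qed (use Suc.prems(1) in auto)
  then show ?case
    unfolding L Q a'[of "\<lambda>j x. x \<bullet> x"] by (simp add: add.assoc)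
qed

lemma levy_incr_cis:
  fixes \<theta> :: "nat \<Rightarrow> real ^ 'd::finite"
  shows "(\<integral>\<xi>. cis (\<Sum>k<K. \<theta> k \<bullet> levy_incr n k \<xi>) \<partial>wiener) = complex_of_real (exp (- ((\<Sum>k<K. \<theta> k \<bullet> \<theta> k) / 2 ^ n) / 2))"
  using levy_incr_cis_aux[where J="{}" and n=n and K=K and \<theta>=\<theta>] by simp

section \<open>Almost sure uniform convergence of the series\<close>

definition levy_good :: "(nat \<Rightarrow> 'a::real_normed_vector) \<Rightarrow> bool" where
  "levy_good \<xi> \<longleftrightarrow> (\<exists>n0. \<forall>m\<ge>n0. \<forall>k<Suc m * 2 ^ m. amp m * norm (\<xi> (prod_encode (Suc m, k))) \<le> (9/10) ^ m)"

text \<open>Set to 0 off the good event, so that every path is continuous, as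
  \<open>continuous_process\<close> demands, and not just almost every one.\<close>

definition levy_path :: "real \<Rightarrow> (nat \<Rightarrow> 'a::banach) \<Rightarrow> 'a" where
  "levy_path t \<xi> = (if levy_good \<xi> then base t \<xi> + (\<Sum>m. schauder m t \<xi>) else 0)"

text \<open>The indices \<open>k < Suc m * 2 ^ m\<close> are the cells of level \<open>m\<close>
  before time \<open>m + 1\<close>. The range grows with \<open>m\<close>, so every fixed horizon is
  covered from some level on.\<close>

lemma schauder_bound:
  assumes good: "\<forall>m\<ge>n0. \<forall>k<Suc m * 2 ^ m. amp m * norm (\<xi> (prod_encode (Suc m, k))) \<le> (9/10) ^ m"
    and m: "n0 \<le> m" "T \<le> real m" and t: "0 \<le> t" "t \<le> T"
  shows "norm (schauder m t \<xi>) \<le> (9/10) ^ m"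
proof -
  have "2 ^ m * t \<le> 2 ^ m * real m" using m t by (intro mult_left_mono) auto
  also have "\<dots> < real (Suc m * 2 ^ m)" by (simp add: algebra_simps)
  finally have "cell m t < Suc m * 2 ^ m"
    using t unfolding cell_def by (subst nat_less_iff) (auto simp: floor_less_iff)
  then have "amp m * norm (\<xi> (prod_encode (Suc m, cell m t))) \<le> (9/10) ^ m" using good m by blast
  moreover have "norm (schauder m t \<xi>) = tent m (cell m t) t * (amp m * norm (\<xi> (prod_encode (Suc m, cell m t))))"
    using tent_01(1) amp_pos[of m] by (simp add: schauder_def abs_mult)
  moreover have "\<dots> \<le> 1 * (amp m * norm (\<xi> (prod_encode (Suc m, cell m t))))"
    using tent_01(2) amp_pos[of m] by (intro mult_right_mono) auto
  ultimately show ?thesis by simp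
qed

lemma levy_partial_uniform_limit:
  fixes \<xi> :: "nat \<Rightarrow> 'a::banach"
  assumes "levy_good \<xi>"
  shows "uniform_limit {0..T} (\<lambda>n t. levy_partial n t \<xi>) (\<lambda>t. levy_path t \<xi>) sequentially"
proof -
  obtain n0 where n0: "\<forall>m\<ge>n0. \<forall>k<Suc m * 2 ^ m. amp m * norm (\<xi> (prod_encode (Suc m, k))) \<le> (9/10) ^ m"
    using assms unfolding levy_good_def by blast
  obtain n1 :: nat where n1: "T \<le> real n1" using real_arch_simple by blast
  have "\<forall>\<^sub>F m in sequentially. \<forall>t\<in>{0..T}. norm (schauder m t \<xi>) \<le> (9/10) ^ m"
    using eventually_ge_at_top[of "max n0 n1"]
  proof eventually_elim
    case (elim m)
    then show ?case using schauder_bound[OF n0, of m T] n1 by auto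
  qed
  then have "uniform_limit {0..T} (\<lambda>n t. \<Sum>m<n. schauder m t \<xi>) (\<lambda>t. \<Sum>m. schauder m t \<xi>) sequentially"
    by (rule Weierstrass_m_test_ev) (simp add: summable_geometric)
  then have "uniform_limit {0..T} (\<lambda>n t. base t \<xi> + (\<Sum>m<n. schauder m t \<xi>)) (\<lambda>t. base t \<xi> + (\<Sum>m. schauder m t \<xi>)) sequentially"
    by (intro uniform_limit_add uniform_limit_const)
  then show ?thesis using assms by (simp add: levy_partial_def[abs_def] levy_path_def[abs_def])
qed

lemma continuous_on_levy_partial: "continuous_on {0..} (\<lambda>t. levy_partial n t \<xi>)"
  unfolding levy_partial_def by (intro continuous_intros continuous_on_base continuous_on_schauder)

lemma continuous_on_levy_path:
  fixes \<xi> :: "nat \<Rightarrow> 'a::banach"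
  shows "continuous_on {0..} (\<lambda>t. levy_path t \<xi>)"
proof (cases "levy_good \<xi>")
  case True
  show ?thesis
  proof (rule continuous_on_halfline)
    fix T :: real
    show "continuous_on {0..T} (\<lambda>t. levy_path t \<xi>)"
      by (rule uniform_limit_theorem[OF _ levy_partial_uniform_limit[OF True]])
        (auto intro!: always_eventually continuous_on_subset[OF continuous_on_levy_partial])
  qed
qed (simp add: levy_path_def)

lemma levy_path_0: "levy_path 0 \<xi> = 0"
  using schauder_dyadic[of 0 _ 0 \<xi>] by (simp add: levy_path_def base_def)

lemma levy_path_dyadic:
  assumes "levy_good \<xi>"
  shows "levy_path (real p / 2 ^ n) \<xi> = levy_partial n (real p / 2 ^ n) \<xi>"
  using assms suminf_finite[of "{..<n}" "\<lambda>m. schauder m (real p / 2 ^ n) \<xi>"] schauder_dyadic[of n _ p \<xi>]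
  by (simp add: levy_path_def levy_partial_def not_less)

lemma levy_partial_measurable [measurable]: "levy_partial n t \<in> borel_measurable wiener"
  unfolding levy_partial_def[abs_def] base_def schauder_def by measurable

lemma levy_good_measurable [measurable]: "Measurable.pred wiener levy_good"
  unfolding levy_good_def[abs_def] by measurable

lemma levy_path_measurable [measurable]: "0 \<le> t \<Longrightarrow> levy_path t \<in> borel_measurable wiener"
proof (rule borel_measurable_LIMSEQ_metric)
  show "(\<lambda>\<xi>. if levy_good \<xi> then levy_partial n t \<xi> else 0) \<in> borel_measurable wiener" for n
    by measurable
  show "(\<lambda>n. if levy_good \<xi> then levy_partial n t \<xi> else 0) \<longlonglongrightarrow> levy_path t \<xi>" if "0 \<le> t" for \<xi> :: "nat \<Rightarrow> real ^ 'a"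
    using tendsto_uniform_limitI[OF levy_partial_uniform_limit[of \<xi> t], of t] that
    by (cases "levy_good \<xi>") (auto simp: levy_path_def)
qed

text \<open>Markov's inequality for fourth moments bounds each exceptional event of level
  \<open>m\<close> by a multiple of \<open>((1/4) / (9/10) ^ 4) ^ m\<close>. There are
  \<open>Suc m * 2 ^ m\<close> of them and \<open>2 * ((1/4) / (9/10) ^ 4) = 5000/6561 < 1\<close>,
  so Borel-Cantelli applies. For this the rate 9/10 has to exceed \<open>2 powr (-1/4)\<close>, and
  for the convergence of the series it has to be below 1.\<close>

lemma AE_levy_good: "AE \<xi> in (wiener :: (nat \<Rightarrow> real ^ 'd::finite) measure). levy_good \<xi>"
proof -
  let ?W = "wiener :: (nat \<Rightarrow> real ^ 'd) measure"
  interpret prob_space ?W by (rule prob_space_wiener)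
  define C where "C = (\<integral>x. norm x ^ 4 \<partial>(normal_vec 1 :: (real ^ 'd) measure))"
  define E where "E m k = {\<xi>\<in>space ?W. (9/10) ^ m < amp m * norm (\<xi> (prod_encode (Suc m, k)))}" for m k
  define A where "A m = (\<Union>k<Suc m * 2 ^ m. E m k)" for m
  have Em[measurable]: "E m k \<in> sets ?W" for m k unfolding E_def by measurable
  have int4: "integrable ?W (\<lambda>\<xi>. norm (\<xi> j) ^ 4)" "(\<integral>\<xi>. norm (\<xi> j) ^ 4 \<partial>?W) = C" for j
  proof -
    have "integrable (distr ?W borel (\<lambda>\<xi>. \<xi> j)) (\<lambda>x. norm x ^ 4)"
      unfolding distr_wiener_component by (rule integrable_normal_vec_norm_power4) simp
    then show "integrable ?W (\<lambda>\<xi>. norm (\<xi> j) ^ 4)" by (subst (asm) integrable_distr_eq) auto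
    show "(\<integral>\<xi>. norm (\<xi> j) ^ 4 \<partial>?W) = C"
      unfolding C_def distr_wiener_component[symmetric, of j] by (subst integral_distr) auto
  qed
  have amp4: "amp m ^ 4 = (1/16) * (1/4) ^ m" for m
  proof -
    have "amp m ^ 4 = ((amp m)\<^sup>2)\<^sup>2" by (simp flip: power_mult)
    also have "\<dots> = (1/4)\<^sup>2 * ((1/2) ^ m)\<^sup>2" unfolding amp_square by (rule power_mult_distrib)
    also have "((1/2) ^ m)\<^sup>2 = ((1/2)\<^sup>2 :: real) ^ m" by (simp only: power_mult[symmetric] mult.commute)
    finally show ?thesis by (simp add: power2_eq_square)
  qed
  have E: "prob (E m k) \<le> C * (1/16) * ((1/4) / (9/10) ^ 4) ^ m" for m k
  proof -
    define c where "c = ((9/10) ^ m / amp m) ^ 4"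
    have c: "0 < c" using amp_pos[of m] by (simp add: c_def)
    have "prob (E m k) \<le> prob {\<xi>\<in>space ?W. c \<le> norm (\<xi> (prod_encode (Suc m, k))) ^ 4}"
    proof (rule finite_measure_mono)
      show "E m k \<subseteq> {\<xi>\<in>space ?W. c \<le> norm (\<xi> (prod_encode (Suc m, k))) ^ 4}"
      proof
        fix \<xi> assume "\<xi> \<in> E m k"
        then have "\<xi> \<in> space ?W" "(9/10) ^ m / amp m \<le> norm (\<xi> (prod_encode (Suc m, k)))"
          using amp_pos[of m] by (auto simp: E_def field_simps)
        then show "\<xi> \<in> {\<xi>\<in>space ?W. c \<le> norm (\<xi> (prod_encode (Suc m, k))) ^ 4}"
          unfolding c_def using amp_pos[of m] by (auto intro!: power_mono)
      qed
    qed measurable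
    also have "\<dots> \<le> (\<integral>\<xi>. norm (\<xi> (prod_encode (Suc m, k))) ^ 4 \<partial>?W) / c"
      using c int4(1) by (intro integral_Markov_inequality_measure[where A="{}"]) auto
    also have "c = ((9/10) ^ 4) ^ m / ((1/16) * (1/4) ^ m)"
    proof -
      have "((9/10) ^ m) ^ 4 = ((9/10 :: real) ^ 4) ^ m" by (simp only: power_mult[symmetric] mult.commute)
      then show ?thesis by (simp only: c_def power_divide[of "(9/10) ^ m" "amp m"] amp4)
    qed
    also have "(\<integral>\<xi>. norm (\<xi> (prod_encode (Suc m, k))) ^ 4 \<partial>?W) / (((9/10) ^ 4) ^ m / ((1/16) * (1/4) ^ m))
        = C * (1/16) * ((1/4) / (9/10) ^ 4) ^ m"
      unfolding int4(2) power_divide[of "1/4" "(9/10) ^ 4"] by simp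
    finally show ?thesis .
  qed
  have A: "prob (A m) \<le> C * (1/16) * (real (Suc m) * (5000/6561) ^ m)" for m
  proof -
    have p2: "real (Suc m * 2 ^ m) * x ^ m = real (Suc m) * (2 * x) ^ m" for x :: real
      by (simp add: power_mult_distrib algebra_simps)
    have "prob (A m) \<le> (\<Sum>k<Suc m * 2 ^ m. prob (E m k))"
      unfolding A_def by (rule finite_measure_subadditive_finite) auto
    also have "\<dots> \<le> (\<Sum>k<Suc m * 2 ^ m. C * (1/16) * ((1/4) / (9/10) ^ 4) ^ m)"
      by (intro sum_mono E)
    also have "\<dots> = C * (1/16) * (real (Suc m) * (2 * ((1/4) / (9/10) ^ 4)) ^ m)"
      unfolding p2[symmetric] by (simp only: sum_constant card_lessThan mult.left_commute)
    also have "2 * ((1/4) / (9/10) ^ 4) = (5000/6561 :: real)" by (simp add: power4_eq_xxxx)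
    finally show ?thesis .
  qed
  have "AE \<xi> in ?W. eventually (\<lambda>m. \<xi> \<in> space ?W - A m) sequentially"
  proof (rule borel_cantelli_AE1)
    show "A m \<in> sets ?W" for m unfolding A_def by measurable
    show "emeasure ?W (A m) < \<infinity>" for m by (simp add: emeasure_eq_measure)
    have "summable (\<lambda>m. C * (1/16) * (real (Suc m) * (5000/6561) ^ m))"
      using geometric_deriv_sums[of "5000/6561 :: real"] by (intro summable_mult) (auto dest: sums_summable)
    then show "summable (\<lambda>m. measure ?W (A m))"
      by (rule summable_comparison_test') (use A in auto)
  qed
  then show ?thesis
  proof eventually_elim
    case (elim \<xi>)
    then show ?case
      unfolding levy_good_def eventually_sequentially by (auto simp: A_def E_def not_less)
  qed
qed

text \<open>\<open>\<sigma>\<close> is a step function: \<open>\<theta> i\<close> on the block from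
  \<open>p i\<close> to \<open>p (Suc i)\<close> and 0 before \<open>p 0\<close>.
  \<open>LEAST\<close> selects the first block whose right end exceeds \<open>k\<close>, so empty
  blocks are passed over.\<close>

lemma sum_blocks:
  fixes \<theta> :: "nat \<Rightarrow> 'a::zero" and p :: "nat \<Rightarrow> nat" and F :: "nat \<Rightarrow> 'a \<Rightarrow> real"
  assumes p: "\<And>i. i < n \<Longrightarrow> p i \<le> p (Suc i)" and F: "\<And>k. F k 0 = 0"
    and \<sigma>: "\<sigma> = (\<lambda>k. if k < p 0 then 0 else \<theta> (LEAST i. k < p (Suc i)))"
  shows "(\<Sum>k<p n. F k (\<sigma> k)) = (\<Sum>i<n. \<Sum>k=p i..<p (Suc i). F k (\<theta> i))"
  using p
proof (induction n)
  case 0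
  show ?case using F by (simp add: \<sigma>)
next
  case (Suc n)
  note mono = chain_mono[of "Suc n" p, OF Suc.prems]
  have "\<sigma> k = \<theta> n" if k: "p n \<le> k" "k < p (Suc n)" for k
  proof -
    have "(LEAST i. k < p (Suc i)) = n"
    proof (rule Least_equality)
      fix y assume y: "k < p (Suc y)"
      show "n \<le> y"
      proof (rule ccontr)
        assume "\<not> n \<le> y"
        then have "p (Suc y) \<le> p n" by (intro mono) auto
        then show False using y k by simp
      qed
    qed fact
    moreover have "\<not> k < p 0" using mono[of 0 n] k by auto
    ultimately show ?thesis by (simp add: \<sigma>)
  qed
  then have "(\<Sum>k=p n..<p (Suc n). F k (\<sigma> k)) = (\<Sum>k=p n..<p (Suc n). F k (\<theta> n))"
    by (intro sum.cong) auto
  moreover have "(\<Sum>k<p (Suc n). F k (\<sigma> k)) = (\<Sum>k<p n. F k (\<sigma> k)) + (\<Sum>k=p n..<p (Suc n). F k (\<sigma> k))"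
    using Suc.prems[of n] by (simp add: lessThan_atLeast0 sum.atLeastLessThan_concat)
  ultimately show ?case using Suc by simp
qed

text \<open>On the good event path and partial sum agree at dyadic times, and each increment
  telescopes into increments of level \<open>N\<close>, all with the coefficient of their
  block.\<close>

lemma levy_path_cis_dyadic:
  fixes \<theta> :: "nat \<Rightarrow> real ^ 'd::finite" and p :: "nat \<Rightarrow> nat"
  assumes p: "\<And>i. i < n \<Longrightarrow> p i \<le> p (Suc i)"
  shows "(\<integral>\<xi>. cis (\<Sum>i<n. \<theta> i \<bullet> (levy_path (real (p (Suc i)) / 2 ^ N) \<xi> - levy_path (real (p i) / 2 ^ N) \<xi>)) \<partial>wiener)
    = complex_of_real (exp (- (\<Sum>i<n. (real (p (Suc i)) / 2 ^ N - real (p i) / 2 ^ N) * (\<theta> i \<bullet> \<theta> i)) / 2))"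
proof -
  define \<sigma> where "\<sigma> = (\<lambda>k. if k < p 0 then 0 else \<theta> (LEAST i. k < p (Suc i)))"
  have tele: "(\<Sum>k=p i..<p (Suc i). levy_incr N k \<xi>) = levy_partial N (real (p (Suc i)) / 2 ^ N) \<xi> - levy_partial N (real (p i) / 2 ^ N) \<xi>"
    if "i < n" for i and \<xi> :: "nat \<Rightarrow> real ^ 'd"
    using sum_Suc_diff'[OF p[OF that], of "\<lambda>k. levy_partial N (real k / 2 ^ N) \<xi>"]
    by (simp add: levy_incr_def add.commute)
  have "(\<Sum>k<p n. \<sigma> k \<bullet> levy_incr N k \<xi>) = (\<Sum>i<n. \<theta> i \<bullet> (levy_path (real (p (Suc i)) / 2 ^ N) \<xi> - levy_path (real (p i) / 2 ^ N) \<xi>))"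
    if "levy_good \<xi>" for \<xi>
    using sum_blocks[of n p "\<lambda>k x. x \<bullet> levy_incr N k \<xi>" \<sigma> \<theta>] p that
    by (simp add: \<sigma>_def inner_sum_right[symmetric] tele levy_path_dyadic)
  then have "(\<integral>\<xi>. cis (\<Sum>i<n. \<theta> i \<bullet> (levy_path (real (p (Suc i)) / 2 ^ N) \<xi> - levy_path (real (p i) / 2 ^ N) \<xi>)) \<partial>wiener)
     = (\<integral>\<xi>. cis (\<Sum>k<p n. \<sigma> k \<bullet> levy_incr N k \<xi>) \<partial>wiener)"
    unfolding levy_incr_def by (intro integral_cong_AE) (use AE_levy_good in \<open>auto elim!: eventually_mono\<close>)
  also have "\<dots> = complex_of_real (exp (- ((\<Sum>k<p n. \<sigma> k \<bullet> \<sigma> k) / 2 ^ N) / 2))" by (rule levy_incr_cis)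
  also have "(\<Sum>k<p n. \<sigma> k \<bullet> \<sigma> k) = (\<Sum>i<n. (real (p (Suc i)) - real (p i)) * (\<theta> i \<bullet> \<theta> i))"
    using sum_blocks[of n p "\<lambda>k x. x \<bullet> x" \<sigma> \<theta>] p by (simp add: \<sigma>_def of_nat_diff)
  also have "(\<Sum>i<n. (real (p (Suc i)) - real (p i)) * (\<theta> i \<bullet> \<theta> i)) / 2 ^ N
      = (\<Sum>i<n. (real (p (Suc i)) / 2 ^ N - real (p i) / 2 ^ N) * (\<theta> i \<bullet> \<theta> i))"
    unfolding sum_divide_distrib by (intro sum.cong) (auto simp: diff_divide_distrib left_diff_distrib)
  finally show ?thesis .
qed

text \<open>Times are rounded down to dyadics, and continuity of paths with dominated convergence
  carries the formula to the limit. Rounding preserves order but may merge neighbours, hence the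
  non-strict order in the dyadic case.\<close>

lemma levy_path_cis:
  fixes \<theta> :: "nat \<Rightarrow> real ^ 'd::finite"
  assumes t: "0 \<le> t 0" "\<And>i. i < n \<Longrightarrow> t i \<le> t (Suc i)"
  shows "(\<integral>\<xi>. cis (\<Sum>i<n. \<theta> i \<bullet> (levy_path (t (Suc i)) \<xi> - levy_path (t i) \<xi>)) \<partial>wiener)
    = complex_of_real (exp (- (\<Sum>i<n. (t (Suc i) - t i) * (\<theta> i \<bullet> \<theta> i)) / 2))"
proof -
  interpret prob_space "wiener :: (nat \<Rightarrow> real ^ 'd) measure" by (rule prob_space_wiener)
  define D where "D r \<xi> = (\<Sum>i<n. \<theta> i \<bullet> (levy_path (r (Suc i)) \<xi> - levy_path (r i) \<xi>))" for r \<xi>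
  define p where "p N i = nat \<lfloor>2 ^ N * t i\<rfloor>" for N i
  define s where "s N i = real (p N i) / 2 ^ N" for N i
  have pos: "0 \<le> t i" if "i \<le> n" for i
    using chain_mono[of n t 0 i] t that by force
  have s0: "0 \<le> s N i" for N i by (simp add: s_def)
  have lim: "(\<lambda>N. s N i) \<longlonglongrightarrow> t i" if i: "i \<le> n" for i
  proof (rule tendsto_sandwich[of "\<lambda>N. t i - (1/2) ^ N" _ _ "\<lambda>_. t i"])
    have fl: "real (p N i) = real_of_int \<lfloor>2 ^ N * t i\<rfloor>" for N using pos[OF i] by (simp add: p_def)
    show "\<forall>\<^sub>F N in sequentially. t i - (1/2) ^ N \<le> s N i"
    proof (intro always_eventually allI)
      fix N
      have "2 ^ N * t i - 1 \<le> real (p N i)" unfolding fl by linarith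
      then have "(2 ^ N * t i - 1) / 2 ^ N \<le> s N i" unfolding s_def by (intro divide_right_mono) auto
      then show "t i - (1/2) ^ N \<le> s N i" by (simp add: power_one_over diff_divide_distrib)
    qed
    show "\<forall>\<^sub>F N in sequentially. s N i \<le> t i"
    proof (intro always_eventually allI)
      fix N
      have "real (p N i) \<le> 2 ^ N * t i" unfolding fl by linarith
      then show "s N i \<le> t i" by (simp add: s_def field_simps)
    qed
    have "(\<lambda>N. t i - (1/2) ^ N) \<longlonglongrightarrow> t i - 0"
      by (intro tendsto_intros LIMSEQ_power_zero) simp
    then show "(\<lambda>N. t i - (1/2) ^ N) \<longlonglongrightarrow> t i" by simp
  qed simp
  have pathlim: "(\<lambda>N. levy_path (s N i) \<xi>) \<longlonglongrightarrow> levy_path (t i) \<xi>" if "i \<le> n" for i and \<xi> :: "nat \<Rightarrow> real ^ 'd"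
    by (rule continuous_on_tendsto_compose[OF continuous_on_levy_path lim[OF that]])
      (use pos[OF that] s0 in auto)
  have "(\<lambda>N. \<integral>\<xi>. cis (D (s N) \<xi>) \<partial>wiener) \<longlonglongrightarrow>
      (\<integral>\<xi>. cis (D t \<xi>) \<partial>wiener)"
  proof (rule integral_dominated_convergence[where w="\<lambda>_. 1"])
    have [measurable]: "levy_path (t (Suc i)) \<in> borel_measurable (wiener :: (nat \<Rightarrow> real ^ 'd) measure)"
      "levy_path (t i) \<in> borel_measurable (wiener :: (nat \<Rightarrow> real ^ 'd) measure)" if "i \<in> {..<n}" for i
      using that pos by (auto intro: levy_path_measurable)
    show "(\<lambda>\<xi>. cis (D t \<xi>)) \<in> borel_measurable wiener"
      unfolding D_def by measurable
    have [measurable]: "levy_path (s N i) \<in> borel_measurable (wiener :: (nat \<Rightarrow> real ^ 'd) measure)" for N i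
      using s0 by (rule levy_path_measurable)
    show "(\<lambda>\<xi>. cis (D (s N) \<xi>)) \<in> borel_measurable wiener" for N
      unfolding D_def by measurable
    show "AE \<xi> in wiener. (\<lambda>N. cis (D (s N) \<xi>)) \<longlonglongrightarrow> cis (D t \<xi>)"
    proof (rule AE_I2)
      fix \<xi> :: "nat \<Rightarrow> real ^ 'd"
      have "(\<lambda>N. D (s N) \<xi>) \<longlonglongrightarrow> D t \<xi>"
        unfolding D_def by (intro tendsto_intros pathlim) auto
      then show "(\<lambda>N. cis (D (s N) \<xi>)) \<longlonglongrightarrow> cis (D t \<xi>)"
        by (intro continuous_on_tendsto_compose[of UNIV cis]) (auto intro!: continuous_intros)
    qed
  qed auto
  moreover have "(\<integral>\<xi>. cis (D (s N) \<xi>) \<partial>wiener) =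
      complex_of_real (exp (- (\<Sum>i<n. (s N (Suc i) - s N i) * (\<theta> i \<bullet> \<theta> i)) / 2))" for N
    unfolding D_def s_def
  proof (rule levy_path_cis_dyadic)
    fix i assume "i < n"
    then have "2 ^ N * t i \<le> 2 ^ N * t (Suc i)" using t(2) by simp
    then show "p N i \<le> p N (Suc i)" unfolding p_def by (intro nat_mono floor_mono)
  qed
  ultimately have "(\<lambda>N. complex_of_real (exp (- (\<Sum>i<n. (s N (Suc i) - s N i) * (\<theta> i \<bullet> \<theta> i)) / 2))) \<longlonglongrightarrow>
      (\<integral>\<xi>. cis (D t \<xi>) \<partial>wiener)" by simp
  moreover have "(\<lambda>N. complex_of_real (exp (- (\<Sum>i<n. (s N (Suc i) - s N i) * (\<theta> i \<bullet> \<theta> i)) / 2))) \<longlonglongrightarrow>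
      complex_of_real (exp (- (\<Sum>i<n. (t (Suc i) - t i) * (\<theta> i \<bullet> \<theta> i)) / 2))"
    by (intro tendsto_intros lim) auto
  ultimately show ?thesis unfolding D_def by (rule LIMSEQ_unique)
qed

section \<open>The Brownian representation\<close>

text \<open>The product form of \<open>cis\<close> gives independence of increments; its case
  \<open>n = 1\<close> is the transform of \<open>normal_vec (sqrt (t - s))\<close>, which gives
  their law.\<close>

lemma standard_brownian_motion_if_cis:
  fixes W :: "('w, 'd::finite) process"
  assumes P: "prob_space P" and W: "continuous_process P W" and W0: "\<And>\<omega>. \<omega> \<in> space P \<Longrightarrow> W 0 \<omega> = 0"
    and cis: "\<And>n t \<theta>. 0 \<le> t 0 \<Longrightarrow> (\<And>i. i < n \<Longrightarrow> t i \<le> t (Suc i)) \<Longrightarrow>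
      (\<integral>\<omega>. cis (\<Sum>i<n. \<theta> i \<bullet> (W (t (Suc i)) \<omega> - W (t i) \<omega>)) \<partial>P) =
      complex_of_real (exp (- (\<Sum>i<n. (t (Suc i) - t i) * (\<theta> i \<bullet> \<theta> i)) / 2))"
  shows "standard_brownian_motion P W"
proof -
  interpret prob_space P by fact
  have Wm: "W t \<in> borel_measurable P" if "0 \<le> t" for t using W that by (simp add: continuous_process_def)
  have "independent_increments P W"
    by (rule independent_increments_if_cis[where q="\<lambda>\<theta>. \<theta> \<bullet> \<theta>", OF P Wm _ cis]) auto
  moreover have "distributed P lborel (\<lambda>\<omega>. W t \<omega> - W s \<omega>)
      (\<lambda>x. ennreal (\<Prod>i\<in>UNIV. normal_density 0 (sqrt (t - s)) (x $ i)))" if st: "0 \<le> s" "s < t" for s t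
  proof -
    have D[measurable]: "(\<lambda>\<omega>. W t \<omega> - W s \<omega>) \<in> borel_measurable P" using st by (intro borel_measurable_diff Wm) auto
    have pos: "0 < sqrt (t - s)" using st by simp
    have "distr P borel (\<lambda>\<omega>. W t \<omega> - W s \<omega>) = normal_vec (sqrt (t - s))"
    proof (rule finite_measure_eqI_cis)
      show "finite_measure (distr P borel (\<lambda>\<omega>. W t \<omega> - W s \<omega>))"
        by (intro finite_measure_distr D)
      show "finite_measure (normal_vec (sqrt (t - s)) :: (real ^ 'd) measure)"
        using prob_space_normal_vec[OF pos] by (rule prob_space.axioms(1))
      fix \<theta> :: "real ^ 'd"
      have "(\<integral>x. cis (\<theta> \<bullet> x) \<partial>distr P borel (\<lambda>\<omega>. W t \<omega> - W s \<omega>)) = (\<integral>\<omega>. cis (\<theta> \<bullet> (W t \<omega> - W s \<omega>)) \<partial>P)"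
        by (rule integral_distr) auto
      also have "\<dots> = complex_of_real (exp (- ((t - s) * (\<theta> \<bullet> \<theta>)) / 2))"
        using cis[of "\<lambda>i. if i = 0 then s else t" 1 "\<lambda>_. \<theta>"] st by simp
      also have "\<dots> = (\<integral>x. cis (\<theta> \<bullet> x) \<partial>normal_vec (sqrt (t - s)))"
        using integral_cis_normal_vec[OF pos, of \<theta>] st by simp
      finally show "(\<integral>x. cis (\<theta> \<bullet> x) \<partial>distr P borel (\<lambda>\<omega>. W t \<omega> - W s \<omega>)) = (\<integral>x. cis (\<theta> \<bullet> x) \<partial>normal_vec (sqrt (t - s)))" .
    qed simp_all
    then have "distr P lborel (\<lambda>\<omega>. W t \<omega> - W s \<omega>) = normal_vec (sqrt (t - s))"
      by (simp cong: distr_cong)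
    then show ?thesis by (auto simp: distributed_def normal_vec_def)
  qed
  ultimately show ?thesis using P W W0 by (auto simp: standard_brownian_motion_def)
qed

context gaussian_indep_increments
begin

lemma AE_fst:
  assumes "AE \<omega> in M. R \<omega>" and N: "prob_space N"
  shows "AE \<omega> in M \<Otimes>\<^sub>M N. R (fst \<omega>)"
proof -
  interpret N: prob_space N by fact
  have "AE \<omega> in distr (M \<Otimes>\<^sub>M N) M fst. R \<omega>"
    unfolding N.distr_pair_fst by (rule assms(1))
  then show ?thesis by (rule AE_distrD[OF measurable_fst])
qed

text \<open>\<open>Q\<close> has the column \<open>covmat *v a i\<close> for \<open>i\<close> in
  \<open>I\<close> and 0 elsewhere, so the auxiliary coordinates of \<open>W\<close> do not enter
  \<open>Q *v W t \<omega>\<close>. The product structure of the space splits the transform of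
  \<open>W\<close> into one of \<open>Z\<close> and one of \<open>levy_path\<close>.\<close>

lemma brownian_representation_Z: "\<exists>Q. brownian_representation M Z Q"
proof -
  have sym: "x \<bullet> (covmat *v y) = y \<bullet> (covmat *v x)" for x y
    by (simp add: inner_covmat mult.commute)
  have psd: "0 \<le> x \<bullet> (covmat *v x)" for x
    using var_nonneg[of x 1] by (simp add: var_covmat)
  from psd_orthonormal_family[of covmat, OF sym psd] obtain I :: "'b set" and a :: "'b \<Rightarrow> real ^ 'b"
    where Ia: "(\<forall>i\<in>I. \<forall>j\<in>I. a i \<bullet> (covmat *v a j) = (if i = j then 1 else 0)) \<and>
      (\<forall>x y. y = x - (\<Sum>i\<in>I. (x \<bullet> (covmat *v a i)) *\<^sub>R a i) \<longrightarrow> y \<bullet> (covmat *v y) = 0)"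
    by (elim exE) (rule that)
  note on = conjunct1[OF Ia, rule_format] and repr = conjunct2[OF Ia, rule_format]
  let ?N = "wiener :: (nat \<Rightarrow> real ^ 'b) measure"
  interpret N: prob_space ?N by (rule prob_space_wiener)
  interpret MN: pair_prob_space M ?N ..
  define W where "W t \<omega> = (\<chi> i. if i \<in> I then a i \<bullet> Z t (fst \<omega>) else levy_path t (snd \<omega>) $ i)"
    for t and \<omega> :: "'a \<times> (nat \<Rightarrow> real ^ 'b)"
  define Q where "Q = (\<chi> k i. if i \<in> I then (covmat *v a i) $ k else 0)"
  have QW: "Q *v W t \<omega> = (\<Sum>i\<in>I. (a i \<bullet> Z t (fst \<omega>)) *\<^sub>R (covmat *v a i))" for t \<omega>
    by (auto simp: vec_eq_iff matrix_vector_mult_def Q_def W_def mult.commute intro!: sum.mono_neutral_cong_right)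
  have Zm[measurable]: "(\<lambda>\<omega>. Z t (fst \<omega>)) \<in> borel_measurable (M \<Otimes>\<^sub>M ?N)" if "0 \<le> t" for t
    using that by (intro measurable_compose[OF measurable_fst] Z_measurable)
  have Lm[measurable]: "(\<lambda>\<omega>. levy_path t (snd \<omega>)) \<in> borel_measurable (M \<Otimes>\<^sub>M ?N)" if "0 \<le> t" for t
    using that by (intro measurable_compose[OF measurable_snd] levy_path_measurable)
  have Wm: "W t \<in> borel_measurable (M \<Otimes>\<^sub>M ?N)" if "0 \<le> t" for t
  proof -
    note [measurable] = Zm[OF that] Lm[OF that]
    show ?thesis unfolding W_def[abs_def] by (intro borel_measurable_vec_lambda) measurable
  qed
  define r where "r t \<omega> = (\<Sum>i\<in>I. (a i \<bullet> Z t \<omega>) *\<^sub>R (covmat *v a i))" for t \<omega>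
  have "standard_brownian_motion (M \<Otimes>\<^sub>M ?N) W"
  proof (rule standard_brownian_motion_if_cis)
    show "prob_space (M \<Otimes>\<^sub>M ?N)" by unfold_locales
    show "continuous_process (M \<Otimes>\<^sub>M ?N) W"
      unfolding continuous_process_def
    proof (intro conjI allI impI ballI Wm)
      fix \<omega> assume "\<omega> \<in> space (M \<Otimes>\<^sub>M ?N)"
      then have \<omega>: "fst \<omega> \<in> space M" by (auto simp: space_pair_measure)
      have "continuous_on {0..} (\<lambda>t. if i \<in> I then a i \<bullet> Z t (fst \<omega>) else levy_path t (snd \<omega>) $ i)" for i
        by (cases "i \<in> I") (auto intro!: continuous_intros Z_path[OF \<omega>] continuous_on_levy_path)
      then show "continuous_on {0..} (\<lambda>t. W t \<omega>)"
        unfolding W_def by (intro continuous_on_vec_lambda)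
    qed
    show "W 0 \<omega> = 0" if "\<omega> \<in> space (M \<Otimes>\<^sub>M ?N)" for \<omega>
    proof -
      have z: "Z 0 (fst \<omega>) = 0" using that by (intro Z_start) (auto simp: space_pair_measure)
      show ?thesis unfolding W_def z levy_path_0 by (simp add: vec_eq_iff)
    qed
    fix n and t :: "nat \<Rightarrow> real" and \<theta> :: "nat \<Rightarrow> real ^ 'b"
    assume t: "0 \<le> t 0" "\<And>i. i < n \<Longrightarrow> t i \<le> t (Suc i)"
    have pos: "0 \<le> t i" if "i \<le> n" for i
      using chain_mono[of n t 0 i] t that by force
    \<comment> \<open>The test vector is split along \<open>I\<close>: \<open>\<alpha> i\<close>
      acts on \<open>Z\<close> and \<open>\<beta> i\<close> on the auxiliary motion. By
      orthonormality the covariance form of \<open>\<alpha> i\<close> is the sum of squares over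
      \<open>I\<close>, so the two variances add up to
      \<open>\<theta> i \<bullet> \<theta> i\<close>.\<close>
    define \<alpha> where "\<alpha> i = (\<Sum>k\<in>I. \<theta> i $ k *\<^sub>R a k)" for i
    define \<beta> where "\<beta> i = (\<chi> k. if k \<in> I then 0 else \<theta> i $ k)" for i
    have split: "\<theta> i \<bullet> (W u \<omega> - W s \<omega>) = \<alpha> i \<bullet> (Z u (fst \<omega>) - Z s (fst \<omega>)) + \<beta> i \<bullet> (levy_path u (snd \<omega>) - levy_path s (snd \<omega>))" for i u s \<omega>
    proof -
      have "\<theta> i \<bullet> W u \<omega> = \<alpha> i \<bullet> Z u (fst \<omega>) + \<beta> i \<bullet> levy_path u (snd \<omega>)" for u
      proof -
        have "\<theta> i \<bullet> W u \<omega> = (\<Sum>k\<in>UNIV. (if k \<in> I then \<theta> i $ k * (a k \<bullet> Z u (fst \<omega>)) else 0) + \<beta> i $ k * levy_path u (snd \<omega>) $ k)"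
          unfolding inner_vec_def W_def \<beta>_def by (intro sum.cong) auto
        also have "\<dots> = (\<Sum>k\<in>I. \<theta> i $ k * (a k \<bullet> Z u (fst \<omega>))) + \<beta> i \<bullet> levy_path u (snd \<omega>)"
          by (simp add: sum.distrib sum.If_cases inner_vec_def)
        finally show ?thesis by (simp add: \<alpha>_def inner_sum_left)
      qed
      then show ?thesis by (simp add: inner_diff_right)
    qed
    have norm: "\<alpha> i \<bullet> (covmat *v \<alpha> i) + \<beta> i \<bullet> \<beta> i = \<theta> i \<bullet> \<theta> i" for i
    proof -
      have "\<alpha> i \<bullet> (covmat *v \<alpha> i) = (\<Sum>k\<in>I. \<theta> i $ k * (a k \<bullet> (covmat *v \<alpha> i)))"
        by (subst \<alpha>_def) (simp add: inner_sum_left)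
      also have "\<dots> = (\<Sum>k\<in>I. \<theta> i $ k * \<theta> i $ k)"
      proof (rule sum.cong)
        fix k assume k: "k \<in> I"
        have "a k \<bullet> (covmat *v \<alpha> i) = \<alpha> i \<bullet> (covmat *v a k)" by (rule sym)
        also have "\<dots> = (\<Sum>j\<in>I. \<theta> i $ j * (if j = k then 1 else 0))"
          unfolding \<alpha>_def inner_sum_left using k by (intro sum.cong) (auto simp: on)
        also have "\<dots> = \<theta> i $ k" using k by (simp add: mult_delta_right)
        finally show "\<theta> i $ k * (a k \<bullet> (covmat *v \<alpha> i)) = \<theta> i $ k * \<theta> i $ k" by simp
      qed simp
      also have "\<dots> = (\<Sum>k\<in>UNIV. if k \<in> I then \<theta> i $ k * \<theta> i $ k else 0)" by (simp add: sum.If_cases)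
      finally have "\<alpha> i \<bullet> (covmat *v \<alpha> i) + \<beta> i \<bullet> \<beta> i = (\<Sum>k\<in>UNIV. (if k \<in> I then \<theta> i $ k * \<theta> i $ k else 0) + \<beta> i $ k * \<beta> i $ k)"
        by (simp add: sum.distrib inner_vec_def)
      also have "\<dots> = \<theta> i \<bullet> \<theta> i" unfolding inner_vec_def \<beta>_def by (intro sum.cong) auto
      finally show ?thesis .
    qed
    define U where "U \<omega> = (\<Sum>i<n. \<alpha> i \<bullet> (Z (t (Suc i)) \<omega> - Z (t i) \<omega>))" for \<omega>
    define L where "L \<omega> = (\<Sum>i<n. \<beta> i \<bullet> (levy_path (t (Suc i)) \<omega> - levy_path (t i) \<omega>))" for \<omega>
    have [measurable]: "U \<in> borel_measurable M"
      unfolding U_def[abs_def] using pos by (intro borel_measurable_sum borel_measurable_inner borel_measurable_diff Z_measurable) auto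
    have [measurable]: "L \<in> borel_measurable ?N"
      unfolding L_def[abs_def] using pos by (intro borel_measurable_sum borel_measurable_inner borel_measurable_diff levy_path_measurable) auto
    have "(\<integral>\<omega>. cis (\<Sum>i<n. \<theta> i \<bullet> (W (t (Suc i)) \<omega> - W (t i) \<omega>)) \<partial>(M \<Otimes>\<^sub>M ?N)) = (\<integral>\<omega>. cis (U (fst \<omega>)) * cis (L (snd \<omega>)) \<partial>(M \<Otimes>\<^sub>M ?N))"
      by (simp add: split sum.distrib U_def L_def cis_mult)
    also have "\<dots> = (\<integral>x. \<integral>y. cis (U x) * cis (L y) \<partial>?N \<partial>M)"
      by (subst MN.integral_fst'[symmetric]) (auto intro!: MN.integrable_const_bound[where B=1] simp: norm_mult)
    also have "\<dots> = (\<integral>x. cis (U x) \<partial>M) * (\<integral>y. cis (L y) \<partial>?N)" by simp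
    also have "\<dots> = complex_of_real (exp (- (\<Sum>i<n. (t (Suc i) - t i) * var (\<alpha> i) 1) / 2)) * complex_of_real (exp (- (\<Sum>i<n. (t (Suc i) - t i) * (\<beta> i \<bullet> \<beta> i)) / 2))"
      unfolding U_def L_def using t by (simp only: increments_cis levy_path_cis)
    also have "\<dots> = complex_of_real (exp (- (\<Sum>i<n. (t (Suc i) - t i) * (\<theta> i \<bullet> \<theta> i)) / 2))"
      unfolding norm[symmetric] var_covmat
      by (simp add: exp_add[symmetric] sum.distrib distrib_left add_divide_distrib flip: of_real_mult)
    finally show "(\<integral>\<omega>. cis (\<Sum>i<n. \<theta> i \<bullet> (W (t (Suc i)) \<omega> - W (t i) \<omega>)) \<partial>(M \<Otimes>\<^sub>M ?N)) =
      complex_of_real (exp (- (\<Sum>i<n. (t (Suc i) - t i) * (\<theta> i \<bullet> \<theta> i)) / 2))" .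
  qed
  moreover have "AE \<omega> in M \<Otimes>\<^sub>M ?N. \<forall>t\<ge>0. Z t (fst \<omega>) = Q *v W t \<omega>"
    unfolding QW r_def[symmetric]
  proof (rule AE_fst[OF _ prob_space_wiener])
    \<comment> \<open>At each fixed time the identity holds almost surely. A countable dense set of
      times and the continuity of both sides give one null set for all times.\<close>
    obtain T :: "real set" where T: "countable T" "T \<subseteq> {0..}" "{0..} \<subseteq> closure T"
      by (rule separable[of "{0::real..}"])
    have cl: "closure T = {0..}" using T closure_minimal[OF T(2)] by auto
    have "AE \<omega> in M. \<forall>t\<in>T. Z t \<omega> = r t \<omega>"
      unfolding AE_ball_countable[OF T(1)]
    proof
      fix t assume "t \<in> T"
      then have "0 \<le> t" using T(2) by auto
      then show "AE \<omega> in M. Z t \<omega> = r t \<omega>"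
        unfolding r_def by (intro Z_AE_reproduce repr)
    qed
    then show "AE \<omega> in M. \<forall>t\<ge>0. Z t \<omega> = r t \<omega>"
    proof (rule AE_mp, intro AE_I2 impI allI)
      fix \<omega> t assume \<omega>: "\<omega> \<in> space M" and eq: "\<forall>t\<in>T. Z t \<omega> = r t \<omega>" and t: "0 \<le> (t :: real)"
      define f where "f t = Z t \<omega> - r t \<omega>" for t
      have "continuous_on (closure T) f"
        unfolding cl f_def r_def by (intro continuous_intros Z_path[OF \<omega>])
      then have "f t = 0"
        by (rule continuous_constant_on_closure[of T f 0]) (use eq t cl in \<open>auto simp: f_def\<close>)
      then show "Z t \<omega> = r t \<omega>" by (simp add: f_def)
    qed
  qed
  ultimately show ?thesis
    unfolding brownian_representation_def using prob_space_wiener by blast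
qed

end

text \<open>Stationarity of the variances comes from \<open>shift_invariance\<close> with
  \<open>B = UNIV\<close> and the bounded continuous function \<open>cos\<close>: for a centred
  Gaussian variable of variance \<open>v\<close> the mean of the cosine is
  \<open>exp (- v / 2)\<close>, which determines \<open>v\<close>.\<close>

lemma (in independent_sde) gaussian_indep_increments_Z: "gaussian_indep_increments M Z"
proof
  show "Z 0 \<omega> = 0" for \<omega> by (rule Z_0)
  show "(\<integral>\<omega>. (\<theta> \<bullet> (Z u \<omega> - Z h \<omega>)) * (x \<bullet> Z r \<omega>) \<partial>M) = 0" if "0 \<le> r" "r \<le> h" "h \<le> u" for \<theta> x r h u
    using that by (rule uncorrelated_increments)
  show "(\<integral>\<omega>. (\<theta> \<bullet> (Z (s + t) \<omega> - Z s \<omega>))\<^sup>2 \<partial>M) = (\<integral>\<omega>. (\<theta> \<bullet> Z t \<omega>)\<^sup>2 \<partial>M)" if "0 \<le> s" "0 \<le> t" for \<theta> s t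
  proof -
    have cos: "(\<integral>\<omega>. cos (Y \<omega>) \<partial>M) = exp (- (\<integral>\<omega>. (Y \<omega>)\<^sup>2 \<partial>M) / 2)" if Y: "Y \<in> gspan" for Y
    proof -
      have "integrable M (\<lambda>\<omega>. cis (Y \<omega>))"
        using gspan_measurable[OF Y] by (intro integrable_const_bound[where B=1]) auto
      then have "(\<integral>\<omega>. Re (cis (Y \<omega>)) \<partial>M) = Re (\<integral>\<omega>. cis (Y \<omega>) \<partial>M)" by (rule integral_Re)
      then show ?thesis by (simp add: gspan_cis[OF Y])
    qed
    have "(\<integral>\<omega>. cos (\<theta> \<bullet> (Z (s + t) \<omega> - Z s \<omega>)) \<partial>M) = (\<integral>\<omega>. cos (\<theta> \<bullet> Z t \<omega>) \<partial>M)"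
      using shift_invariance[OF that(1) order_refl that(2), of UNIV cos \<theta>] by (simp add: Z_0 continuous_on_cos)
    then show ?thesis
      using that by (simp add: cos gspan_incr gspan_Z)
  qed
qed

text \<open>Both properties are read off finite-dimensional laws: a linear combination is a
  measurable function of finitely many values, and a mean involves a single one. They thus pass from
  \<open>G\<close> to the noise on the other space.\<close>

lemma same_fdd_gaussian_centered:
  assumes fdd: "same_fdd M Z N G" and Z: "\<And>t. 0 \<le> t \<Longrightarrow> Z t \<in> borel_measurable M"
    and G: "gaussian_process N G" "centered_process N G"
  shows "gaussian_process M Z" "centered_process M Z"
proof -
  have Gm: "G t \<in> borel_measurable N" if "0 \<le> t" for t using G(1) that by (simp add: gaussian_process_def)
  have restr: "(\<lambda>\<omega>. \<lambda>t\<in>J. Z t \<omega>) \<in> M \<rightarrow>\<^sub>M (\<Pi>\<^sub>M t\<in>J. borel)" "(\<lambda>\<omega>. \<lambda>t\<in>J. G t \<omega>) \<in> N \<rightarrow>\<^sub>M (\<Pi>\<^sub>M t\<in>J. borel)"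
    if "J \<subseteq> {0..}" for J
    using that by (auto intro!: measurable_restrict Z Gm)
  have eq: "distr M (\<Pi>\<^sub>M t\<in>J. borel) (\<lambda>\<omega>. \<lambda>t\<in>J. Z t \<omega>) = distr N (\<Pi>\<^sub>M t\<in>J. borel) (\<lambda>\<omega>. \<lambda>t\<in>J. G t \<omega>)"
    if "finite J" "J \<subseteq> {0..}" for J
    using fdd that by (simp add: same_fdd_def)
  show "gaussian_process M Z"
    unfolding gaussian_process_def
  proof (intro conjI allI impI Z)
    fix J :: "real set" and a :: "real \<Rightarrow> real ^ 'b" assume J: "finite J \<and> J \<subseteq> {0..}"
    define F where "F x = (\<Sum>t\<in>J. a t \<bullet> x t)" for x :: "real \<Rightarrow> real ^ 'b"
    have Fm: "F \<in> borel_measurable (\<Pi>\<^sub>M t\<in>J. borel)"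
      unfolding F_def[abs_def] by (intro borel_measurable_sum borel_measurable_inner measurable_component_singleton) auto
    have "distr M borel (\<lambda>\<omega>. \<Sum>t\<in>J. a t \<bullet> Z t \<omega>) = distr (distr M (\<Pi>\<^sub>M t\<in>J. borel) (\<lambda>\<omega>. \<lambda>t\<in>J. Z t \<omega>)) borel F"
      using J by (subst distr_distr[OF Fm restr(1)]) (auto simp: comp_def F_def)
    also have "\<dots> = distr N borel (\<lambda>\<omega>. \<Sum>t\<in>J. a t \<bullet> G t \<omega>)"
      using J by (subst eq, simp, simp, subst distr_distr[OF Fm restr(2)]) (auto simp: comp_def F_def)
    finally have "distr M borel (\<lambda>\<omega>. \<Sum>t\<in>J. a t \<bullet> Z t \<omega>) = distr N borel (\<lambda>\<omega>. \<Sum>t\<in>J. a t \<bullet> G t \<omega>)" .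
    moreover have "(\<lambda>\<omega>. \<Sum>t\<in>J. a t \<bullet> Z t \<omega>) \<in> borel_measurable M"
      using J by (intro borel_measurable_sum borel_measurable_inner Z) auto
    moreover have "gaussian_rv N (\<lambda>\<omega>. \<Sum>t\<in>J. a t \<bullet> G t \<omega>)" using G(1) J by (simp add: gaussian_process_def)
    ultimately show "gaussian_rv M (\<lambda>\<omega>. \<Sum>t\<in>J. a t \<bullet> Z t \<omega>)" by (simp add: gaussian_rv_def)
  qed
  show "centered_process M Z"
    unfolding centered_process_def
  proof (intro allI impI)
    fix t :: real assume t: "0 \<le> t"
    have Fm: "(\<lambda>x. x t) \<in> borel_measurable (\<Pi>\<^sub>M t\<in>{t}. (borel :: (real ^ 'b) measure))"
      by (rule measurable_component_singleton) simp
    have "distr M borel (Z t) = distr (distr M (\<Pi>\<^sub>M t\<in>{t}. borel) (\<lambda>\<omega>. \<lambda>t\<in>{t}. Z t \<omega>)) borel (\<lambda>x. x t)"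
      using t by (subst distr_distr[OF Fm restr(1)]) (auto simp: comp_def)
    also have "\<dots> = distr N borel (G t)"
      using t by (subst eq, simp, simp, subst distr_distr[OF Fm restr(2)]) (auto simp: comp_def)
    finally have d: "distr M borel (Z t) = distr N borel (G t)" .
    have "integrable N (G t)" "(\<integral>\<omega>. G t \<omega> \<partial>N) = 0" using G(2) t by (auto simp: centered_process_def)
    then have "integrable (distr N borel (G t)) (\<lambda>x. x)" "(\<integral>x. x \<partial>distr N borel (G t)) = 0"
      using Gm[OF t] by (simp_all add: integrable_distr_eq integral_distr)
    then show "integrable M (Z t) \<and> (\<integral>\<omega>. Z t \<omega> \<partial>M) = 0"
      unfolding d[symmetric] using Z[OF t] by (simp add: integrable_distr_eq integral_distr)
  qed
qed

theorem proposition5: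
  fixes N :: "'v measure" and G :: "('v, 'd::finite) process"
    and M :: "'w measure" and X Z :: "('w, 'd) process"
    and b :: "real ^ 'd \<Rightarrow> real ^ 'd"
  assumes "driving_process N G"
    and "continuous_on UNIV b"
    and "stationary_solution N G b M X"
    and "Z = noise_of b X"
    and "indep_of_process M (X 0) Z"
  shows "independent_increments M Z \<and> (\<exists>Q. brownian_representation M Z Q)"
proof -
  interpret stationary_sde M b X
    using assms(2,3) by (simp add: stationary_sde_def stationary_sde_axioms_def stationary_solution_def)
  have "same_fdd M (noise_of b X) N G" "gaussian_process N G" "centered_process N G"
    using assms(1,3) by (auto simp: stationary_solution_def driving_process_def)
  then have "gaussian_process M (noise_of b X)" "centered_process M (noise_of b X)"
    using same_fdd_gaussian_centered[of M "noise_of b X" N G] Z_measurable by auto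
  then interpret independent_sde M b X
    using assms(4,5) by unfold_locales auto
  interpret Z: gaussian_indep_increments M "noise_of b X" by (rule gaussian_indep_increments_Z)
  show ?thesis
    unfolding assms(4) using Z.Z_independent_increments Z.brownian_representation_Z by blast
qed

end
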